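(* Let $I\subset\mathbb{R}$ be an open interval, $(F,g_F)$ a pseudo-Riemannian manifold with $\dim F=l\neq3$ and scalar curvature $S^F=0$, $f:I\to(0,\infty)$ smooth, and let $M=I\times F$ carry the metric $g=-dt^2+f(t)^2g_F$. Let $\lambda_1,\lambda_2$ be nonzero real constants, $P=\frac{\partial}{\partial t}$, and let $\overline\nabla$ be the quarter-symmetric connection on $M$ determined by $P,\lambda_1,\lambda_2$. Put $v(t)=f(t)^2$ and $$D=\frac{l^2}{4}(\lambda_1+\lambda_2)^2-(l+1)\left[(l+1)\lambda_1\lambda_2-\lambda_1^2-\lambda_2^2+\frac{\overline S}{l}\right],\qquad S_0=\frac{l^3}{4(l+1)}(\lambda_1+\lambda_2)^2-l[(l+1)\lambda_1\lambda_2-\lambda_1^2-\lambda_2^2].$$ Then $(M,\overline\nabla)$ has constant scalar curvature $\overline S$ if and only if one of the following holds for some real constants $c_1,c_2$: (1) $\overline S<S_0$ and $v(t)=\left[c_1e^{\frac12\left(\frac l2(\lambda_1+\lambda_2)+\sqrt D\right)t}+c_2e^{\frac12\left(\frac l2(\lambda_1+\lambda_2)-\sqrt D\right)t}\right]^{\frac4{l+1}}$; (2) $\overline S=S_0$ and $v(t)=\left[c_1e^{\frac l4(\lambda_1+\lambda_2)t}+c_2te^{\frac l4(\lambda_1+\lambda_2)t}\right]^{\frac4{l+1}}$; (3) $\overline S>S_0$ and $v(t)=\left[c_1e^{\frac l4(\lambda_1+\lambda_2)t}\cos\left(\tfrac12\sqrt{-D}\,t\right)+c_2e^{\frac l4(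\lambda_1+\lambda_2)t}\sin\left(\tfrac12\sqrt{-D}\,t\right)\right]^{\frac4{l+1}}$.
   Context: On a pseudo-Riemannian manifold $(M,g)$ with Levi-Civita connection $\nabla$, a vector field $P$, the 1-form $\pi(X)=g(X,P)$ and nonzero real constants $\lambda_1,\lambda_2$, the quarter-symmetric connection is $\overline\nabla_XY=\nabla_XY+\lambda_1\pi(Y)X-\lambda_2g(X,Y)P$. Its curvature is $\overline R(X,Y)=\overline\nabla_X\overline\nabla_Y-\overline\nabla_Y\overline\nabla_X-\overline\nabla_{[X,Y]}$, its Ricci tensor is $\overline{Ric}(X,Y)=\sum_k\varepsilon_k\,g(\overline R(X,E_k)Y,E_k)$ and its scalar curvature is $\overline S=\sum_k\varepsilon_k\overline{Ric}(E_k,E_k)$, where $(E_k)$ is a local orthonormal frame with $g(E_k,E_k)=\varepsilon_k=\pm1$ (note the sign convention). $S^F$ is the scalar curvature of the Levi-Civita connection of $(F,g_F)$, with the same convention. The expressions in square brackets in (1)-(3) are understood to be positive on $I$. *)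

theory Defs
  imports "HOL-Analysis.Analysis"
begin

section \<open>Smooth functions between Euclidean spaces\<close>

text \<open>Only meant for open sets \<open>U\<close>.\<close>

primrec Ck_on :: "nat \<Rightarrow> ('a::euclidean_space \<Rightarrow> 'b::real_normed_vector) \<Rightarrow> 'a set \<Rightarrow> bool"
  where
    "Ck_on 0 f U \<longleftrightarrow> continuous_on U f"
  | "Ck_on (Suc k) f U \<longleftrightarrow>
       (\<forall>x\<in>U. f differentiable (at x)) \<and>
       (\<forall>v. Ck_on k (\<lambda>x. frechet_derivative f (at x) v) U)"

definition smooth_on :: "'a::euclidean_space set \<Rightarrow> ('a \<Rightarrow> 'b::real_normed_vector) \<Rightarrow> bool"
  where "smooth_on U f \<longleftrightarrow> (\<forall>k. Ck_on k f U)"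


section \<open>Smooth manifolds\<close>

text \<open>
  A manifold modelled on the Euclidean space \<open>'e\<close>, hence of dimension \<open>DIM('e) \<ge> 1\<close>.  A chart
  is a pair of its domain and a coordinate map, whose values outside the domain are irrelevant.
\<close>

record ('p, 'e) manifold =
  mtop :: "'p topology"
  atlas :: "('p set \<times> ('p \<Rightarrow> 'e)) set"

abbreviation points :: "('p, 'e) manifold \<Rightarrow> 'p set"
  where "points M \<equiv> topspace (mtop M)"

definition smooth_manifold :: "('p, 'e::euclidean_space) manifold \<Rightarrow> bool"
  where "smooth_manifold M \<longleftrightarrow>
    Hausdorff_space (mtop M) \<and> second_countable (mtop M) \<and>
    (\<forall>(U, \<phi>) \<in> atlas M. openin (mtop M) U \<and> open (\<phi> ` U) \<and>
       homeomorphic_map (subtopology (mtop M) U) (top_of_set (\<phi> ` U)) \<phi>) \<and>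
    (\<Union>(U, \<phi>) \<in> atlas M. U) = points M \<and>
    (\<forall>(U, \<phi>) \<in> atlas M. \<forall>(V, \<psi>) \<in> atlas M. smooth_on (\<phi> ` (U \<inter> V)) (\<psi> \<circ> inv_into U \<phi>))"

definition smooth_functions ::
    "('p, 'e::euclidean_space) manifold \<Rightarrow> 'p set \<Rightarrow> ('p \<Rightarrow> real) set"
  where "smooth_functions M W =
    {h. \<forall>(U, \<phi>) \<in> atlas M. smooth_on (\<phi> ` (U \<inter> W)) (h \<circ> inv_into U \<phi>)}"

definition smooth_near :: "('p, 'e::euclidean_space) manifold \<Rightarrow> 'p \<Rightarrow> ('p \<Rightarrow> real) \<Rightarrow> bool"
  where "smooth_near M p h \<longleftrightarrow>
    (\<exists>W. openin (mtop M) W \<and> p \<in> W \<and> h \<in> smooth_functions M W)"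


section \<open>Tangent vectors and vector fields\<close>

text \<open>
  A tangent vector at \<open>p\<close> is the directional derivative at \<open>p\<close>, in some chart, along some
  coordinate vector \<open>u\<close>.  It acts on functions that are smooth near \<open>p\<close> and is extended by \<open>0\<close>
  to all other functions, so that a tangent vector is determined by its action on smooth functions.
\<close>

type_synonym 'p tangent_vector = "('p \<Rightarrow> real) \<Rightarrow> real"

definition tangent_space ::
    "('p, 'e::euclidean_space) manifold \<Rightarrow> 'p \<Rightarrow> 'p tangent_vector set"
  where "tangent_space M p =
    {v. \<exists>(U, \<phi>) \<in> atlas M. p \<in> U \<and>
       (\<exists>u. v = (\<lambda>h. if smooth_near M p h
                     then frechet_derivative (h \<circ> inv_into U \<phi>) (at (\<phi> p)) u else 0))}"

type_synonym 'p vector_field = "'p \<Rightarrow> 'p tangent_vector"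

text \<open>
  Smooth vector fields on an open set \<open>W\<close>; the values outside \<open>W\<close> are irrelevant.
\<close>

definition vector_fields ::
    "('p, 'e::euclidean_space) manifold \<Rightarrow> 'p set \<Rightarrow> 'p vector_field set"
  where "vector_fields M W =
    {X. (\<forall>p\<in>W. X p \<in> tangent_space M p) \<and>
        (\<forall>W' h. openin (mtop M) W' \<longrightarrow> W' \<subseteq> W \<longrightarrow> h \<in> smooth_functions M W' \<longrightarrow>
           (\<lambda>p. X p h) \<in> smooth_functions M W')}"

definition vf_add :: "'p vector_field \<Rightarrow> 'p vector_field \<Rightarrow> 'p vector_field"  (infixl "+\<^sub>v" 65)
  where "X +\<^sub>v Y = (\<lambda>p h. X p h + Y p h)"

definition vf_diff :: "'p vector_field \<Rightarrow> 'p vector_field \<Rightarrow> 'p vector_field"  (infixl "-\<^sub>v" 65)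
  where "X -\<^sub>v Y = (\<lambda>p h. X p h - Y p h)"

definition vf_scale :: "('p \<Rightarrow> real) \<Rightarrow> 'p vector_field \<Rightarrow> 'p vector_field"  (infixr "*\<^sub>v" 75)
  where "k *\<^sub>v X = (\<lambda>p h. k p * X p h)"

definition lie_bracket ::
    "('p, 'e::euclidean_space) manifold \<Rightarrow> 'p vector_field \<Rightarrow> 'p vector_field \<Rightarrow> 'p vector_field"
  where "lie_bracket M X Y =
    (\<lambda>p h. if smooth_near M p h then X p (\<lambda>q. Y q h) - Y p (\<lambda>q. X q h) else 0)"


section \<open>Pseudo-Riemannian metrics\<close>

type_synonym 'p metric = "'p \<Rightarrow> 'p tangent_vector \<Rightarrow> 'p tangent_vector \<Rightarrow> real"

definition pseudo_riemannian_metric ::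
    "('p, 'e::euclidean_space) manifold \<Rightarrow> 'p metric \<Rightarrow> bool"
  where "pseudo_riemannian_metric M g \<longleftrightarrow>
    (\<forall>p \<in> points M.
       (\<forall>v \<in> tangent_space M p. \<forall>w \<in> tangent_space M p. g p v w = g p w v) \<and>
       (\<forall>v \<in> tangent_space M p. \<forall>v' \<in> tangent_space M p. \<forall>w \<in> tangent_space M p. \<forall>a b.
          g p (\<lambda>h. a * v h + b * v' h) w = a * g p v w + b * g p v' w) \<and>
       (\<forall>v \<in> tangent_space M p. (\<forall>w \<in> tangent_space M p. g p v w = 0) \<longrightarrow> v = (\<lambda>h. 0))) \<and>
    (\<forall>W. openin (mtop M) W \<longrightarrow>
       (\<forall>X \<in> vector_fields M W. \<forall>Y \<in> vector_fields M W.
          (\<lambda>p. g p (X p) (Y p)) \<in> smooth_functions M W))"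

definition pseudo_riemannian_manifold ::
    "('p, 'e::euclidean_space) manifold \<Rightarrow> 'p metric \<Rightarrow> bool"
  where "pseudo_riemannian_manifold M g \<longleftrightarrow> smooth_manifold M \<and> pseudo_riemannian_metric M g"


section \<open>Affine connections and curvature\<close>

type_synonym 'p connection = "'p vector_field \<Rightarrow> 'p vector_field \<Rightarrow> 'p vector_field"

text \<open>
  A connection is an operator \<open>nab X Y\<close> on local vector fields: the conditions below are imposed
  on each open set \<open>W\<close> separately, and the first one makes the operator compatible with
  restriction.
\<close>

definition affine_connection ::
    "('p, 'e::euclidean_space) manifold \<Rightarrow> 'p connection \<Rightarrow> bool"
  where "affine_connection M nab \<longleftrightarrow>
    (\<forall>W. openin (mtop M) W \<longrightarrow>
      (\<forall>X \<in> vector_fields M W. \<forall>Y \<in> vector_fields M W.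
         (\<forall>X' Y'. (\<forall>p\<in>W. X' p = X p \<and> Y' p = Y p) \<longrightarrow> (\<forall>p\<in>W. nab X' Y' p = nab X Y p)) \<and>
         nab X Y \<in> vector_fields M W \<and>
         (\<forall>Z \<in> vector_fields M W. \<forall>p\<in>W.
            nab (X +\<^sub>v Z) Y p = (nab X Y +\<^sub>v nab Z Y) p \<and>
            nab X (Y +\<^sub>v Z) p = (nab X Y +\<^sub>v nab X Z) p) \<and>
         (\<forall>k \<in> smooth_functions M W. \<forall>p\<in>W.
            nab (k *\<^sub>v X) Y p = (k *\<^sub>v nab X Y) p \<and>
            nab X (k *\<^sub>v Y) p = ((\<lambda>q. X q k) *\<^sub>v Y +\<^sub>v k *\<^sub>v nab X Y) p)))"

definition levi_civita_connection ::
    "('p, 'e::euclidean_space) manifold \<Rightarrow> 'p metric \<Rightarrow> 'p connection \<Rightarrow> bool"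
  where "levi_civita_connection M g nab \<longleftrightarrow>
    affine_connection M nab \<and>
    (\<forall>W. openin (mtop M) W \<longrightarrow>
      (\<forall>X \<in> vector_fields M W. \<forall>Y \<in> vector_fields M W. \<forall>p\<in>W.
         (nab X Y -\<^sub>v nab Y X) p = lie_bracket M X Y p \<and>
         (\<forall>Z \<in> vector_fields M W.
            X p (\<lambda>q. g q (Y q) (Z q)) = g p (nab X Y p) (Z p) + g p (Y p) (nab X Z p))))"

definition quarter_symmetric_connection ::
    "'p metric \<Rightarrow> 'p connection \<Rightarrow> 'p vector_field \<Rightarrow> real \<Rightarrow> real \<Rightarrow> 'p connection"
  where "quarter_symmetric_connection g nab P lam\<^sub>1 lam\<^sub>2 =
    (let \<pi> = (\<lambda>X p. g p (X p) (P p)) in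
     (\<lambda>X Y. nab X Y +\<^sub>v (\<lambda>p. lam\<^sub>1 * \<pi> Y p) *\<^sub>v X -\<^sub>v (\<lambda>p. lam\<^sub>2 * g p (X p) (Y p)) *\<^sub>v P))"

definition curvature ::
    "('p, 'e::euclidean_space) manifold \<Rightarrow> 'p connection \<Rightarrow>
     'p vector_field \<Rightarrow> 'p vector_field \<Rightarrow> 'p vector_field \<Rightarrow> 'p vector_field"
  where "curvature M nab X Y Z =
    nab X (nab Y Z) -\<^sub>v nab Y (nab X Z) -\<^sub>v nab (lie_bracket M X Y) Z"

text \<open>
  The vectors of a frame are indexed by the \<open>DIM('e)\<close> elements of \<open>Basis :: 'e set\<close>; the inner
  product of \<open>'e\<close> plays no role.
\<close>

definition orthonormal_frame ::
    "('p, 'e::euclidean_space) manifold \<Rightarrow> 'p metric \<Rightarrow> 'p set \<Rightarrow>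
     ('e \<Rightarrow> 'p vector_field) \<Rightarrow> ('e \<Rightarrow> real) \<Rightarrow> bool"
  where "orthonormal_frame M g W E \<epsilon> \<longleftrightarrow>
    openin (mtop M) W \<and>
    (\<forall>i\<in>Basis. E i \<in> vector_fields M W \<and> (\<epsilon> i = 1 \<or> \<epsilon> i = - 1)) \<and>
    (\<forall>i\<in>Basis. \<forall>j\<in>Basis. \<forall>p\<in>W. g p (E i p) (E j p) = (if i = j then \<epsilon> i else 0))"

text \<open>
  The following two notions do not depend on the local frame around \<open>p\<close>.  In the argument order
  used here both have the opposite sign of the more common convention, so that round spheres have
  negative scalar curvature.
\<close>

definition ricci ::
    "('p, 'e::euclidean_space) manifold \<Rightarrow> 'p metric \<Rightarrow> 'p connection \<Rightarrow>
     'p vector_field \<Rightarrow> 'p vector_field \<Rightarrow> 'p \<Rightarrow> real"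
  where "ricci M g nab X Y p =
    (THE r. \<exists>W E \<epsilon>. p \<in> W \<and> orthonormal_frame M g W E \<epsilon> \<and>
       r = (\<Sum>k\<in>Basis. \<epsilon> k * g p (curvature M nab X (E k) Y p) (E k p)))"

definition scalar_curvature ::
    "('p, 'e::euclidean_space) manifold \<Rightarrow> 'p metric \<Rightarrow> 'p connection \<Rightarrow> 'p \<Rightarrow> real"
  where "scalar_curvature M g nab p =
    (THE s. \<exists>W E \<epsilon>. p \<in> W \<and> orthonormal_frame M g W E \<epsilon> \<and>
       s = (\<Sum>k\<in>Basis. \<epsilon> k * ricci M g nab (E k) (E k) p))"


section \<open>Warped products over an open interval\<close>

definition interval_product ::
    "real set \<Rightarrow> ('p, 'e::euclidean_space) manifold \<Rightarrow> (real \<times> 'p, real \<times> 'e) manifold"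
  where "interval_product I F =
    \<lparr> mtop = prod_topology (top_of_set I) (mtop F),
      atlas = (\<lambda>(U, \<phi>). (I \<times> U, \<lambda>(t, p). (t, \<phi> p))) ` atlas F \<rparr>"

text \<open>
  \<open>-dt\<^sup>2 + f(t)\<^sup>2 g\<^sub>F\<close>: here \<open>v fst\<close> is \<open>dt(v)\<close>, and \<open>\<lambda>h. v (h \<circ> snd)\<close> is the image of \<open>v\<close> under
  the differential of the projection onto \<open>F\<close>.
\<close>

definition warped_metric :: "(real \<Rightarrow> real) \<Rightarrow> 'p metric \<Rightarrow> (real \<times> 'p) metric"
  where "warped_metric f g\<^sub>F = (\<lambda>(t, p) v w.
    - (v fst * w fst) + (f t)\<^sup>2 * g\<^sub>F p (\<lambda>h. v (h \<circ> snd)) (\<lambda>h. w (h \<circ> snd)))"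

definition time_field ::
    "real set \<Rightarrow> ('p, 'e::euclidean_space) manifold \<Rightarrow> (real \<times> 'p) vector_field"  \<comment> \<open>\<open>\<partial>/\<partial>t\<close>\<close>
  where "time_field I F = (\<lambda>(t, p) h.
    if smooth_near (interval_product I F) (t, p) h then deriv (\<lambda>s. h (s, p)) t else 0)"

end

theory Submission
  imports Defs
begin

text \<open>
  The frame sum defining the scalar curvature of an affine connection does not depend on the frame,
  because the curvature is linear over the smooth functions and two orthonormal frames differ by a
  matrix of smooth functions.  It may therefore be computed in a frame of \<open>I \<times> F\<close> consisting of
  \<open>\<partial>/\<partial>t\<close> and the lifts of an orthonormal frame of \<open>F\<close> divided by \<open>f\<close>.  The Koszul formula expresses
  the Levi-Civita connection of the warped product on lifted fields through that of \<open>F\<close>, and with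
  \<open>H = f'/f\<close> one gets
  \<open>S = S\<^sup>F / f\<^sup>2 - l (2 H' + (l+1) H\<^sup>2 - l (\<lambda>\<^sub>1 + \<lambda>\<^sub>2) H + (l+1) \<lambda>\<^sub>1 \<lambda>\<^sub>2 - \<lambda>\<^sub>1\<^sup>2 - \<lambda>\<^sub>2\<^sup>2)\<close>.
  For \<open>S\<^sup>F = 0\<close> the substitution \<open>w = f powr ((l+1)/2)\<close> turns this into a linear equation of second order
  with constant coefficients, whose discriminant \<open>D\<close> has the sign of \<open>S\<^sub>0 - S\<close>.
\<close>

section \<open>Calculus of smooth functions\<close>

text \<open>What shapes the proof is that all objects are total functions whose values are
  meaningful only locally. Vector fields are arbitrary outside their domain, and a formula for a
  covariant derivative holds only on an open set, so it can be differentiated again only after a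
  congruence step; hence a locality lemma for every operation. A tangent vector is a function of all
  \<open>h\<close>, extended by 0, so equalities of tangent vectors are reduced to a few test
  functions or to pairings with the metric. Ricci and scalar curvature are definite descriptions
  over all local frames, one nested in the other: frames must exist, although null vectors obstruct
  Gram-Schmidt in an indefinite metric, and both traces must be frame independent before anything
  can be evaluated. The exponent \<open>(l + 1) / 2\<close> is the one for which
  \<open>w'' / w\<close> is proportional to \<open>2 * H' + (l + 1) * H^2\<close>, so that the
  Riccati-type square disappears.\<close>

lemma Ck_on_cong:
  assumes "open U" "\<And>x. x \<in> U \<Longrightarrow> f x = g x"
  shows "Ck_on k f U \<longleftrightarrow> Ck_on k g U"
  using assms(2)
proof (induction k arbitrary: f g)
  case 0
  then show ?case by (auto cong: continuous_on_cong)
next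
  case (Suc k)
  have hd: "(f has_derivative D) (at x) \<longleftrightarrow> (g has_derivative D) (at x)" if "x \<in> U" for x D
    using has_derivative_transform_within_open[of _ _ x UNIV U] that assms(1) Suc.prems by metis
  then have "f differentiable (at x) \<longleftrightarrow> g differentiable (at x)" if "x \<in> U" for x
    using that by (auto simp: differentiable_def)
  moreover have "frechet_derivative f (at x) = frechet_derivative g (at x)" if "x \<in> U" for x
    using hd[OF that] by (auto simp: frechet_derivative_def)
  ultimately show ?case
    using Suc.IH[of "\<lambda>x. frechet_derivative f (at x) v" "\<lambda>x. frechet_derivative g (at x) v" for v]
    by simp
qed

lemma Ck_on_subset: "Ck_on k f U \<Longrightarrow> V \<subseteq> U \<Longrightarrow> Ck_on k f V"
  by (induction k arbitrary: f) (auto intro: continuous_on_subset)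

text \<open>Continuity, differentiability at a point and the derivative itself depend only on a
  neighbourhood, so the property passes from small open sets to their union.\<close>

lemma Ck_on_local:
  assumes "\<And>x. x \<in> U \<Longrightarrow> \<exists>V. open V \<and> x \<in> V \<and> Ck_on k f V"
  shows "Ck_on k f U"
  using assms
proof (induction k arbitrary: f)
  case 0
  then show ?case
    by (metis Ck_on.simps(1) continuous_at_imp_continuous_on continuous_on_eq_continuous_at)
next
  case (Suc k)
  have "\<exists>V. open V \<and> x \<in> V \<and> Ck_on k (\<lambda>x. frechet_derivative f (at x) v) V" if "x \<in> U" for x v
    using Suc.prems[OF that] by auto
  moreover have "f differentiable (at x)" if "x \<in> U" for x
    using Suc.prems[OF that] by auto
  ultimately show ?case
    using Suc.IH by auto
qed

lemma Ck_on_SucD: "Ck_on (Suc k) f U \<Longrightarrow> Ck_on k f U"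
proof (induction k arbitrary: f)
  case 0
  then show ?case
    by (auto intro!: continuous_at_imp_continuous_on differentiable_imp_continuous_within)
qed auto

text \<open>Uniqueness of derivatives identifies the chosen \<open>frechet_derivative\<close> with
  any explicit one, so the closure lemmas can be proved with hand-written derivatives.\<close>

lemma Ck_on_SucI:
  assumes "open U" "\<And>x. x \<in> U \<Longrightarrow> (f has_derivative f' x) (at x)" "\<And>v. Ck_on k (\<lambda>x. f' x v) U"
  shows "Ck_on (Suc k) f U"
proof -
  have "frechet_derivative f (at x) = f' x" if "x \<in> U" for x
    using assms(2)[OF that] frechet_derivative_at by metis
  then have "Ck_on k (\<lambda>x. frechet_derivative f (at x) v) U" for v
    using assms(3)[of v] Ck_on_cong[OF assms(1), of "\<lambda>x. frechet_derivative f (at x) v" "\<lambda>x. f' x v" k]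
    by auto
  then show ?thesis
    using assms(2) by (auto simp: differentiable_def)
qed

lemma Ck_on_Suc_has_derivative:
  "Ck_on (Suc k) f U \<Longrightarrow> x \<in> U \<Longrightarrow> (f has_derivative frechet_derivative f (at x)) (at x)"
  by (simp add: frechet_derivative_works)

lemma Ck_on_const: "open U \<Longrightarrow> Ck_on k (\<lambda>x. c) U"
proof (induction k arbitrary: c)
  case (Suc k)
  then show ?case
    by (intro Ck_on_SucI[where f'="\<lambda>x v. 0"]) (auto intro!: derivative_eq_intros)
qed auto

lemma Ck_on_bounded_linear:
  assumes "open U" "bounded_linear L"
  shows "Ck_on k L U"
proof (cases k)
  case 0
  then show ?thesis
    using assms(2) by (simp add: linear_continuous_on)
next
  case (Suc n)
  have "Ck_on (Suc n) L U"
    by (rule Ck_on_SucI[OF assms(1) bounded_linear_imp_has_derivative[OF assms(2)] Ck_on_const[OF assms(1)]])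
  then show ?thesis
    by (simp only: Suc)
qed

lemma Ck_on_compose_bounded_linear:
  assumes "open U" "bounded_linear L" "Ck_on k f U"
  shows "Ck_on k (\<lambda>x. L (f x)) U"
  using assms(3)
proof (induction k arbitrary: f)
  case 0
  then show ?case
    unfolding Ck_on.simps by (rule bounded_linear.continuous_on[OF assms(2)])
next
  case (Suc k)
  show ?case
  proof (rule Ck_on_SucI[OF assms(1)])
    show "((\<lambda>x. L (f x)) has_derivative (\<lambda>v. L (frechet_derivative f (at x) v))) (at x)" if "x \<in> U" for x
      by (rule bounded_linear.has_derivative[OF assms(2) Ck_on_Suc_has_derivative[OF Suc.prems that]])
    show "Ck_on k (\<lambda>x. L (frechet_derivative f (at x) v)) U" for v
      by (rule Suc.IH) (use Suc.prems in \<open>simp only: Ck_on.simps\<close>)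
  qed
qed

lemma Ck_on_add:
  assumes "open U" "Ck_on k f U" "Ck_on k g U"
  shows "Ck_on k (\<lambda>x. f x + g x) U"
  using assms(2,3)
proof (induction k arbitrary: f g)
  case 0
  then show ?case
    unfolding Ck_on.simps by (rule continuous_on_add)
next
  case (Suc k)
  show ?case
  proof (rule Ck_on_SucI[OF assms(1)])
    show "((\<lambda>x. f x + g x) has_derivative
        (\<lambda>v. frechet_derivative f (at x) v + frechet_derivative g (at x) v)) (at x)" if "x \<in> U" for x
      by (rule has_derivative_add[OF Suc.prems[THEN Ck_on_Suc_has_derivative, OF that]])
    show "Ck_on k (\<lambda>x. frechet_derivative f (at x) v + frechet_derivative g (at x) v) U" for v
      by (rule Suc.IH) (use Suc.prems in \<open>simp_all only: Ck_on.simps\<close>)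
  qed
qed

lemma Ck_on_scaleR:
  fixes f :: "'a::euclidean_space \<Rightarrow> real"
  assumes "open U" "Ck_on k f U" "Ck_on k g U"
  shows "Ck_on k (\<lambda>x. f x *\<^sub>R g x) U"
  using assms(2,3)
proof (induction k arbitrary: f g)
  case 0
  then show ?case
    unfolding Ck_on.simps by (rule continuous_on_scaleR)
next
  case (Suc k)
  note lower = Suc.prems[THEN Ck_on_SucD]
  show ?case
  proof (rule Ck_on_SucI[OF assms(1)])
    show "((\<lambda>x. f x *\<^sub>R g x) has_derivative
        (\<lambda>v. f x *\<^sub>R frechet_derivative g (at x) v + frechet_derivative f (at x) v *\<^sub>R g x)) (at x)"
      if "x \<in> U" for x
      by (rule has_derivative_scaleR[OF Suc.prems[THEN Ck_on_Suc_has_derivative, OF that]])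
    show "Ck_on k (\<lambda>x. f x *\<^sub>R frechet_derivative g (at x) v + frechet_derivative f (at x) v *\<^sub>R g x) U" for v
      by (intro Ck_on_add[OF assms(1)] Suc.IH) (use Suc.prems lower in \<open>simp_all only: Ck_on.simps\<close>)
  qed
qed

lemma Ck_on_sum:
  assumes "open U" "\<And>i. i \<in> A \<Longrightarrow> Ck_on k (f i) U"
  shows "Ck_on k (\<lambda>x. \<Sum>i\<in>A. f i x) U"
  using assms(2)
  by (induction A rule: infinite_finite_induct) (auto intro!: Ck_on_const Ck_on_add assms(1))

text \<open>The chain rule is written in coordinates: the derivative of \<open>g \<circ> f\<close>
  along \<open>v\<close> is a sum of products of components of the derivative of \<open>f\<close>
  with partial derivatives of \<open>g\<close> composed with \<open>f\<close>. The induction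
  hypothesis for arbitrary \<open>g\<close> covers those compositions, and sums and products are
  already treated.\<close>

lemma Ck_on_compose:
  fixes f :: "'a::euclidean_space \<Rightarrow> 'b::euclidean_space"
  assumes "open U" "open V" "f ` U \<subseteq> V" "Ck_on k f U" "Ck_on k g V"
  shows "Ck_on k (g \<circ> f) U"
  using assms(4,5)
proof (induction k arbitrary: g)
  case 0
  then show ?case
    unfolding Ck_on.simps by (intro continuous_on_compose continuous_on_subset[OF _ assms(3)])
next
  case (Suc k)
  let ?D = "\<lambda>x v. \<Sum>b\<in>Basis. (frechet_derivative f (at x) v \<bullet> b) *\<^sub>R frechet_derivative g (at (f x)) b"
  show ?case
  proof (rule Ck_on_SucI[OF assms(1), where f'="?D"])
    fix x assume "x \<in> U"
    then have f: "(f has_derivative frechet_derivative f (at x)) (at x)"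
      and g: "(g has_derivative frechet_derivative g (at (f x))) (at (f x))"
      using Suc.prems[THEN Ck_on_Suc_has_derivative] assms(3) by blast+
    have D: "(\<Sum>b\<in>Basis. (u \<bullet> b) *\<^sub>R frechet_derivative g (at (f x)) b) = frechet_derivative g (at (f x)) u" for u
    proof -
      interpret linear "frechet_derivative g (at (f x))"
        using g by (rule has_derivative_linear)
      have "frechet_derivative g (at (f x)) (\<Sum>b\<in>Basis. (u \<bullet> b) *\<^sub>R b) =
          (\<Sum>b\<in>Basis. (u \<bullet> b) *\<^sub>R frechet_derivative g (at (f x)) b)"
        by (simp only: sum scaleR)
      then show ?thesis
        by (simp only: euclidean_representation)
    qed
    have "?D x = frechet_derivative g (at (f x)) \<circ> frechet_derivative f (at x)"
      by (simp add: fun_eq_iff D)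
    then show "(g \<circ> f has_derivative ?D x) (at x)"
      using diff_chain_at[OF f g] by simp
  next
    fix v
    have "Ck_on k f U"
      by (rule Ck_on_SucD[OF Suc.prems(1)])
    then have "Ck_on k ((\<lambda>y. frechet_derivative g (at y) b) \<circ> f) U" for b
      by (rule Suc.IH) (use Suc.prems in \<open>simp only: Ck_on.simps\<close>)
    moreover have "Ck_on k (\<lambda>x. frechet_derivative f (at x) v \<bullet> b) U" for b
      by (rule Ck_on_compose_bounded_linear[OF assms(1) bounded_linear_inner_left])
        (use Suc.prems in \<open>simp only: Ck_on.simps\<close>)
    ultimately show "Ck_on k (\<lambda>x. ?D x v) U"
      unfolding o_def by (intro Ck_on_sum Ck_on_scaleR assms(1))
  qed
qed

text \<open>The factor \<open>c\<close> closes the induction: the derivative along \<open>v\<close>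
  is again a multiple of a power, with constant \<open>v * c * a\<close>.\<close>

lemma Ck_on_powr: "Ck_on k (\<lambda>x::real. c * x powr a) {0<..}"
proof (induction k arbitrary: c a)
  case 0
  then show ?case by (auto intro!: continuous_intros)
next
  case (Suc k)
  show ?case
  proof (rule Ck_on_SucI[where f'="\<lambda>x v. v * (c * (a * x powr (a - 1)))"])
    fix x :: real assume "x \<in> {0<..}"
    then show "((\<lambda>x. c * x powr a) has_derivative (\<lambda>v. v * (c * (a * x powr (a - 1))))) (at x)"
      using DERIV_cmult[OF has_real_derivative_powr[of x a], of c]
      by (simp add: has_field_derivative_def mult_commute_abs)
  next
    fix v :: real
    show "Ck_on k (\<lambda>x. v * (c * (a * x powr (a - 1)))) {0<..}"
      using Suc.IH[of "v * c * a" "a - 1"] by (simp add: mult.assoc)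
  qed auto
qed

section \<open>Closure properties of smooth functions\<close>

lemma smooth_on_cong: "open U \<Longrightarrow> (\<And>x. x \<in> U \<Longrightarrow> f x = g x) \<Longrightarrow> smooth_on U f \<longleftrightarrow> smooth_on U g"
  unfolding smooth_on_def using Ck_on_cong by blast

lemma smooth_on_subset: "smooth_on U f \<Longrightarrow> V \<subseteq> U \<Longrightarrow> smooth_on V f"
  unfolding smooth_on_def using Ck_on_subset by blast

lemma smooth_on_local:
  assumes "\<And>x. x \<in> U \<Longrightarrow> \<exists>V. open V \<and> x \<in> V \<and> smooth_on V f"
  shows "smooth_on U f"
  unfolding smooth_on_def using assms Ck_on_local[of U _ f] by (meson smooth_on_def)

lemma smooth_on_const: "open U \<Longrightarrow> smooth_on U (\<lambda>x. c)"
  by (simp add: smooth_on_def Ck_on_const)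

lemma smooth_on_bounded_linear: "open U \<Longrightarrow> bounded_linear L \<Longrightarrow> smooth_on U L"
  by (simp add: smooth_on_def Ck_on_bounded_linear)

lemma smooth_on_compose_bounded_linear:
  "open U \<Longrightarrow> bounded_linear L \<Longrightarrow> smooth_on U f \<Longrightarrow> smooth_on U (\<lambda>x. L (f x))"
  by (simp add: smooth_on_def Ck_on_compose_bounded_linear)

lemma smooth_on_add: "open U \<Longrightarrow> smooth_on U f \<Longrightarrow> smooth_on U g \<Longrightarrow> smooth_on U (\<lambda>x. f x + g x)"
  by (simp add: smooth_on_def Ck_on_add)

lemma smooth_on_mult:
  fixes f g :: "'a::euclidean_space \<Rightarrow> real"
  shows "open U \<Longrightarrow> smooth_on U f \<Longrightarrow> smooth_on U g \<Longrightarrow> smooth_on U (\<lambda>x. f x * g x)"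
  using Ck_on_scaleR[of U _ f g] by (simp add: smooth_on_def)

lemma smooth_on_compose:
  fixes f :: "'a::euclidean_space \<Rightarrow> 'b::euclidean_space"
  shows "open U \<Longrightarrow> open V \<Longrightarrow> f ` U \<subseteq> V \<Longrightarrow> smooth_on U f \<Longrightarrow> smooth_on V g \<Longrightarrow> smooth_on U (g \<circ> f)"
  unfolding smooth_on_def by (blast intro: Ck_on_compose)

lemma smooth_on_powr: "smooth_on {0<..} (\<lambda>x::real. x powr a)"
  unfolding smooth_on_def using Ck_on_powr[of _ 1 a] by simp

lemma smooth_on_differentiable: "smooth_on U f \<Longrightarrow> x \<in> U \<Longrightarrow> f differentiable (at x)"
  unfolding smooth_on_def using Ck_on.simps(2) by blast

lemma smooth_on_has_derivative:
  "smooth_on U f \<Longrightarrow> x \<in> U \<Longrightarrow> (f has_derivative frechet_derivative f (at x)) (at x)"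
  using smooth_on_differentiable frechet_derivative_works by blast

lemma smooth_on_frechet_derivative:
  "smooth_on U f \<Longrightarrow> smooth_on U (\<lambda>x. frechet_derivative f (at x) v)"
  unfolding smooth_on_def using Ck_on.simps(2) by blast

lemma smooth_on_continuous_on: "smooth_on U f \<Longrightarrow> continuous_on U f"
  unfolding smooth_on_def using Ck_on.simps(1) by blast

lemma smooth_on_Pair:
  fixes f :: "'a::euclidean_space \<Rightarrow> 'b::euclidean_space" and g :: "'a \<Rightarrow> 'c::euclidean_space"
  assumes "open U" "smooth_on U f" "smooth_on U g"
  shows "smooth_on U (\<lambda>x. (f x, g x))"
proof -
  have "bounded_linear (\<lambda>y::'b. (y, 0::'c))" "bounded_linear (\<lambda>y::'c. (0::'b, y))"
    by (auto intro!: bounded_linear_Pair bounded_linear_ident bounded_linear_zero)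
  from smooth_on_add[OF assms(1) smooth_on_compose_bounded_linear[OF assms(1) this(1) assms(2)]
    smooth_on_compose_bounded_linear[OF assms(1) this(2) assms(3)]]
  show ?thesis by simp
qed


section \<open>Tangent vectors and vector fields in charts\<close>

locale smooth_atlas =
  fixes M :: "('p, 'e::euclidean_space) manifold"
  assumes chart_openin: "(U, \<phi>) \<in> atlas M \<Longrightarrow> openin (mtop M) U"
    and chart_open_image: "(U, \<phi>) \<in> atlas M \<Longrightarrow> open (\<phi> ` U)"
    and chart_homeomorphic: "(U, \<phi>) \<in> atlas M \<Longrightarrow>
      homeomorphic_map (subtopology (mtop M) U) (top_of_set (\<phi> ` U)) \<phi>"
    and chart_exists: "p \<in> points M \<Longrightarrow> \<exists>U \<phi>. (U, \<phi>) \<in> atlas M \<and> p \<in> U"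
    and chart_transition: "(U, \<phi>) \<in> atlas M \<Longrightarrow> (V, \<psi>) \<in> atlas M \<Longrightarrow>
      smooth_on (\<phi> ` (U \<inter> V)) (\<psi> \<circ> inv_into U \<phi>)"

lemma smooth_atlasI: "smooth_manifold M \<Longrightarrow> smooth_atlas M"
  unfolding smooth_manifold_def by unfold_locales fast+

text \<open>With \<open>p\<close> fixed this is a tangent vector, with \<open>p\<close> varying the
  coordinate field of constant components \<open>u\<close>. One definition serves both readings, and
  every tangent vector extends to such a field.\<close>

definition chart_vector ::
    "('p, 'e::euclidean_space) manifold \<Rightarrow> 'p set \<Rightarrow> ('p \<Rightarrow> 'e) \<Rightarrow> 'e \<Rightarrow> 'p vector_field"
  where "chart_vector M U \<phi> u = (\<lambda>p h. if smooth_near M p h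
      then frechet_derivative (h \<circ> inv_into U \<phi>) (at (\<phi> p)) u else 0)"

lemma tangent_space_chart_vector:
  "tangent_space M p = {v. \<exists>U \<phi>. (U, \<phi>) \<in> atlas M \<and> p \<in> U \<and> (\<exists>u. v = chart_vector M U \<phi> u p)}"
  unfolding tangent_space_def chart_vector_def by auto

lemma vector_fields_tangent: "X \<in> vector_fields M W \<Longrightarrow> p \<in> W \<Longrightarrow> X p \<in> tangent_space M p"
  by (simp add: vector_fields_def)

lemma vector_fields_smooth:
  "X \<in> vector_fields M W \<Longrightarrow> openin (mtop M) W' \<Longrightarrow> W' \<subseteq> W \<Longrightarrow> h \<in> smooth_functions M W' \<Longrightarrow>
    (\<lambda>p. X p h) \<in> smooth_functions M W'"
  by (simp add: vector_fields_def)

lemma vector_fields_subset: "X \<in> vector_fields M W \<Longrightarrow> W' \<subseteq> W \<Longrightarrow> X \<in> vector_fields M W'"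
  by (auto simp: vector_fields_def)

lemma smooth_nearI: "h \<in> smooth_functions M W \<Longrightarrow> openin (mtop M) W \<Longrightarrow> p \<in> W \<Longrightarrow> smooth_near M p h"
  by (auto simp: smooth_near_def)

lemma smooth_functions_subset: "h \<in> smooth_functions M W \<Longrightarrow> W' \<subseteq> W \<Longrightarrow> h \<in> smooth_functions M W'"
  unfolding smooth_functions_def using smooth_on_subset[of "\<phi> ` (U \<inter> W)" _ "\<phi> ` (U \<inter> W')" for U \<phi>]
  by fastforce

context smooth_atlas
begin

lemma chart_subset: "(U, \<phi>) \<in> atlas M \<Longrightarrow> U \<subseteq> points M"
  by (simp add: chart_openin openin_subset)

lemma chart_inj: "(U, \<phi>) \<in> atlas M \<Longrightarrow> inj_on \<phi> U"
  using homeomorphic_imp_injective_map[OF chart_homeomorphic] chart_subset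
  by (metis inf.absorb_iff2 topspace_subtopology)

lemma chart_inv: "(U, \<phi>) \<in> atlas M \<Longrightarrow> p \<in> U \<Longrightarrow> inv_into U \<phi> (\<phi> p) = p"
  by (simp add: chart_inj)

lemma open_chart_image:
  assumes "(U, \<phi>) \<in> atlas M" "openin (mtop M) W"
  shows "open (\<phi> ` (U \<inter> W))"
proof -
  have "openin (subtopology (mtop M) U) (U \<inter> W)"
    using assms(2) by (simp add: openin_subtopology_Int2 Int_commute)
  then have "openin (top_of_set (\<phi> ` U)) (\<phi> ` (U \<inter> W))"
    using homeomorphic_imp_open_map[OF chart_homeomorphic[OF assms(1)]] by (simp add: open_map_def)
  then show ?thesis
    using chart_open_image[OF assms(1)] openin_open_trans by blast
qed

lemma openin_chart_vimage:
  assumes "(U, \<phi>) \<in> atlas M" "open B"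
  shows "openin (mtop M) (U \<inter> \<phi> -` B)"
proof -
  have "continuous_map (subtopology (mtop M) U) (top_of_set (\<phi> ` U)) \<phi>"
    using homeomorphic_imp_continuous_map[OF chart_homeomorphic[OF assms(1)]] .
  then have "openin (subtopology (mtop M) U) {x \<in> topspace (subtopology (mtop M) U). \<phi> x \<in> \<phi> ` U \<inter> B}"
    using assms(2) by (intro openin_continuous_map_preimage) auto
  moreover have "{x \<in> topspace (subtopology (mtop M) U). \<phi> x \<in> \<phi> ` U \<inter> B} = U \<inter> \<phi> -` B"
    using chart_subset[OF assms(1)] by auto
  ultimately show ?thesis
    using chart_openin[OF assms(1)] openin_trans_full by metis
qed

section \<open>The algebra of smooth functions on a manifold\<close>

lemma smooth_functions_chart:
  "h \<in> smooth_functions M W \<Longrightarrow> (U, \<phi>) \<in> atlas M \<Longrightarrow> smooth_on (\<phi> ` (U \<inter> W)) (h \<circ> inv_into U \<phi>)"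
  by (auto simp: smooth_functions_def)

text \<open>One chart about each point suffices, although the definition asks for all of them: the
  transition map carries smoothness into any other chart, on the overlap of the two domains with
  \<open>N\<close>.\<close>

lemma smooth_functionsI:
  assumes "\<And>p. p \<in> W \<Longrightarrow> \<exists>U \<phi> N. (U, \<phi>) \<in> atlas M \<and> p \<in> U \<and> openin (mtop M) N \<and> p \<in> N \<and>
      smooth_on (\<phi> ` (U \<inter> N)) (h \<circ> inv_into U \<phi>)"
  shows "h \<in> smooth_functions M W"
proof -
  have "smooth_on (\<psi> ` (V \<inter> W)) (h \<circ> inv_into V \<psi>)" if V: "(V, \<psi>) \<in> atlas M" for V \<psi>
  proof (rule smooth_on_local)
    fix y assume "y \<in> \<psi> ` (V \<inter> W)"
    then obtain q where q: "q \<in> V" "q \<in> W" "y = \<psi> q" by auto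
    obtain U \<phi> N where U: "(U, \<phi>) \<in> atlas M" "q \<in> U" and N: "openin (mtop M) N" "q \<in> N"
      and s: "smooth_on (\<phi> ` (U \<inter> N)) (h \<circ> inv_into U \<phi>)"
      using assms[OF q(2)] by auto
    let ?B = "\<psi> ` (V \<inter> (U \<inter> N))"
    have o: "open ?B" "open (\<phi> ` (U \<inter> N))"
      using open_chart_image V U N chart_openin openin_Int by blast+
    have "smooth_on ?B (\<phi> \<circ> inv_into V \<psi>)"
      using chart_transition[OF V U(1)] by (rule smooth_on_subset) auto
    then have "smooth_on ?B ((h \<circ> inv_into U \<phi>) \<circ> (\<phi> \<circ> inv_into V \<psi>))"
      using s o V by (intro smooth_on_compose[of _ "\<phi> ` (U \<inter> N)"]) (auto simp: chart_inv)
    then have "smooth_on ?B (h \<circ> inv_into V \<psi>)"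
      using V U by (subst smooth_on_cong[OF o(1)]) (auto simp: chart_inv)
    then show "\<exists>B. open B \<and> y \<in> B \<and> smooth_on B (h \<circ> inv_into V \<psi>)"
      using o q U N by blast
  qed
  then show ?thesis
    by (auto simp: smooth_functions_def)
qed

lemma smooth_functions_local:
  assumes "openin (mtop M) W"
    and "\<And>p. p \<in> W \<Longrightarrow> \<exists>N. openin (mtop M) N \<and> p \<in> N \<and> h \<in> smooth_functions M N"
  shows "h \<in> smooth_functions M W"
proof (rule smooth_functionsI)
  fix p assume "p \<in> W"
  then obtain N where "openin (mtop M) N" "p \<in> N" "h \<in> smooth_functions M N"
    using assms(2) by blast
  moreover obtain U \<phi> where "(U, \<phi>) \<in> atlas M" "p \<in> U"
    using chart_exists assms(1) \<open>p \<in> W\<close> openin_subset by blast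
  ultimately show "\<exists>U \<phi> N. (U, \<phi>) \<in> atlas M \<and> p \<in> U \<and> openin (mtop M) N \<and> p \<in> N \<and>
      smooth_on (\<phi> ` (U \<inter> N)) (h \<circ> inv_into U \<phi>)"
    using smooth_functions_chart by blast
qed

lemma smooth_functions_cong:
  assumes "openin (mtop M) W" "\<And>p. p \<in> W \<Longrightarrow> h p = k p"
  shows "h \<in> smooth_functions M W \<longleftrightarrow> k \<in> smooth_functions M W"
proof -
  have "smooth_on (\<phi> ` (U \<inter> W)) (h \<circ> inv_into U \<phi>) \<longleftrightarrow> smooth_on (\<phi> ` (U \<inter> W)) (k \<circ> inv_into U \<phi>)"
    if "(U, \<phi>) \<in> atlas M" for U \<phi>
    using that assms by (intro smooth_on_cong open_chart_image) (auto simp: chart_inv)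
  then show ?thesis
    unfolding smooth_functions_def by blast
qed

lemma smooth_functions_const:
  assumes "openin (mtop M) W"
  shows "(\<lambda>q. c) \<in> smooth_functions M W"
  unfolding smooth_functions_def
  using smooth_on_const open_chart_image[OF _ assms] by (auto simp: o_def)

lemma smooth_functions_add:
  assumes "openin (mtop M) W" "h \<in> smooth_functions M W" "k \<in> smooth_functions M W"
  shows "(\<lambda>q. h q + k q) \<in> smooth_functions M W"
  using assms(2,3) smooth_on_add[OF open_chart_image[OF _ assms(1)]]
  unfolding smooth_functions_def by (fastforce simp: o_def)

lemma smooth_functions_mult:
  assumes "openin (mtop M) W" "h \<in> smooth_functions M W" "k \<in> smooth_functions M W"
  shows "(\<lambda>q. h q * k q) \<in> smooth_functions M W"
  using assms(2,3) smooth_on_mult[OF open_chart_image[OF _ assms(1)]]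
  unfolding smooth_functions_def by (fastforce simp: o_def)

lemma smooth_functions_diff:
  assumes "openin (mtop M) W" "h \<in> smooth_functions M W" "k \<in> smooth_functions M W"
  shows "(\<lambda>q. h q - k q) \<in> smooth_functions M W"
  using smooth_functions_add[OF assms(1,2)
      smooth_functions_mult[OF assms(1) smooth_functions_const[OF assms(1), of "-1"] assms(3)]]
  by simp

lemma smooth_functions_sum:
  assumes "openin (mtop M) W" "\<And>i. i \<in> A \<Longrightarrow> h i \<in> smooth_functions M W"
  shows "(\<lambda>q. \<Sum>i\<in>A. h i q) \<in> smooth_functions M W"
  using assms(2)
  by (induction A rule: infinite_finite_induct)
     (auto intro!: smooth_functions_const smooth_functions_add assms(1))

lemma smooth_functions_compose:
  assumes "openin (mtop M) W" "h \<in> smooth_functions M W" "open A" "smooth_on A a" "h ` W \<subseteq> A"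
  shows "(\<lambda>q. a (h q)) \<in> smooth_functions M W"
proof -
  have "smooth_on (\<phi> ` (U \<inter> W)) (a \<circ> (h \<circ> inv_into U \<phi>))" if "(U, \<phi>) \<in> atlas M" for U \<phi>
    using that assms by (intro smooth_on_compose[of _ A] open_chart_image smooth_functions_chart)
      (auto simp: chart_inv)
  then show ?thesis
    unfolding smooth_functions_def by (auto simp: o_def)
qed

lemma smooth_functions_coordinate:
  assumes "(U, \<phi>) \<in> atlas M"
  shows "(\<lambda>q. \<phi> q \<bullet> b) \<in> smooth_functions M U"
proof -
  have "smooth_on (\<psi> ` (V \<inter> U)) (\<lambda>x. (\<phi> \<circ> inv_into V \<psi>) x \<bullet> b)" if "(V, \<psi>) \<in> atlas M" for V \<psi>
    by (rule smooth_on_compose_bounded_linear[OF open_chart_image[OF that chart_openin[OF assms]]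
          bounded_linear_inner_left chart_transition[OF that assms]])
  then show ?thesis
    by (auto simp: smooth_functions_def o_def)
qed

text \<open>Serves to shrink a neighbourhood to the set where a smooth function is positive, as the
  normalisation of a frame vector requires.\<close>

lemma openin_smooth_vimage:
  assumes "openin (mtop M) W" "h \<in> smooth_functions M W" "open B"
  shows "openin (mtop M) {q \<in> W. h q \<in> B}"
proof (subst openin_subopen, rule ballI)
  fix q assume q: "q \<in> {q \<in> W. h q \<in> B}"
  then obtain U \<phi> where U: "(U, \<phi>) \<in> atlas M" "q \<in> U"
    using chart_exists assms(1) openin_subset by blast
  let ?C = "\<phi> ` (U \<inter> W)"
  have "open (?C \<inter> (h \<circ> inv_into U \<phi>) -` B)"
    using smooth_on_continuous_on[OF smooth_functions_chart[OF assms(2) U(1)]]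
      open_chart_image[OF U(1) assms(1)] assms(3) continuous_on_open_vimage
    by (metis Int_commute)
  then have "openin (mtop M) (U \<inter> \<phi> -` (?C \<inter> (h \<circ> inv_into U \<phi>) -` B) \<inter> W)"
    by (intro openin_Int openin_chart_vimage U assms(1))
  moreover have "q \<in> U \<inter> \<phi> -` (?C \<inter> (h \<circ> inv_into U \<phi>) -` B) \<inter> W"
    using q U by (auto simp: chart_inv)
  moreover have "U \<inter> \<phi> -` (?C \<inter> (h \<circ> inv_into U \<phi>) -` B) \<inter> W \<subseteq> {q \<in> W. h q \<in> B}"
    using U(1) chart_inv by fastforce
  ultimately show "\<exists>T. openin (mtop M) T \<and> q \<in> T \<and> T \<subseteq> {q \<in> W. h q \<in> B}"
    by blast
qed

lemma smooth_near_combine: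
  assumes "smooth_near M p h" "smooth_near M p k"
  obtains W where "openin (mtop M) W" "p \<in> W" "h \<in> smooth_functions M W" "k \<in> smooth_functions M W"
proof -
  obtain V W where "openin (mtop M) V" "p \<in> V" "h \<in> smooth_functions M V"
    "openin (mtop M) W" "p \<in> W" "k \<in> smooth_functions M W"
    using assms by (auto simp: smooth_near_def)
  then show ?thesis
    using that[of "V \<inter> W"] smooth_functions_subset[of h M V "V \<inter> W"]
      smooth_functions_subset[of k M W "V \<inter> W"] by auto
qed

lemma smooth_near_add: "smooth_near M p h \<Longrightarrow> smooth_near M p k \<Longrightarrow> smooth_near M p (\<lambda>q. h q + k q)"
  by (rule smooth_near_combine[of p h k]) (auto intro: smooth_nearI smooth_functions_add)

lemma smooth_near_mult: "smooth_near M p h \<Longrightarrow> smooth_near M p k \<Longrightarrow> smooth_near M p (\<lambda>q. h q * k q)"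
  by (rule smooth_near_combine[of p h k]) (auto intro: smooth_nearI smooth_functions_mult)

lemma smooth_near_const: "p \<in> points M \<Longrightarrow> smooth_near M p (\<lambda>q. c)"
  using smooth_nearI[OF smooth_functions_const[OF openin_topspace]] by blast

lemma smooth_near_cong:
  assumes "openin (mtop M) W" "p \<in> W" "\<And>q. q \<in> W \<Longrightarrow> h q = k q"
  shows "smooth_near M p h \<longleftrightarrow> smooth_near M p k"
proof -
  have *: "smooth_near M p k" if "smooth_near M p h" "\<And>q. q \<in> W \<Longrightarrow> h q = k q" for h k
  proof -
    from that(1) obtain V where V: "openin (mtop M) V" "p \<in> V" "h \<in> smooth_functions M V"
      by (auto simp: smooth_near_def)
    have o: "openin (mtop M) (V \<inter> W)"
      using V assms(1) by blast
    have "h \<in> smooth_functions M (V \<inter> W)"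
      using V(3) smooth_functions_subset by blast
    then have "k \<in> smooth_functions M (V \<inter> W)"
      using smooth_functions_cong[OF o, of h k] that(2) by blast
    then show ?thesis
      using o V assms(2) by (auto intro: smooth_nearI)
  qed
  show ?thesis
    using *[of h k] *[of k h] assms(3) by auto
qed

lemma smooth_near_has_derivative:
  assumes "smooth_near M p h" "(U, \<phi>) \<in> atlas M" "p \<in> U"
  shows "(h \<circ> inv_into U \<phi> has_derivative frechet_derivative (h \<circ> inv_into U \<phi>) (at (\<phi> p))) (at (\<phi> p))"
proof -
  obtain W where "openin (mtop M) W" "p \<in> W" "h \<in> smooth_functions M W"
    using assms(1) by (auto simp: smooth_near_def)
  then show ?thesis
    using smooth_on_has_derivative[OF smooth_functions_chart[OF _ assms(2)]] assms(3) by blast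
qed

section \<open>Tangent vectors in coordinates\<close>

lemma chart_vector_eqI:
  assumes "(U, \<phi>) \<in> atlas M" "p \<in> U" "smooth_near M p h"
    and "(h \<circ> inv_into U \<phi> has_derivative D) (at (\<phi> p))"
  shows "chart_vector M U \<phi> u p h = D u"
  using assms(3) frechet_derivative_at[OF assms(4)] by (simp add: chart_vector_def)

text \<open>On functions smooth near \<open>p\<close> this is the chain rule for the transition map;
  on all others both sides carry the default 0. So a tangent vector may be represented in whichever
  chart is at hand.\<close>

lemma chart_vector_change:
  assumes U: "(U, \<phi>) \<in> atlas M" "p \<in> U" and V: "(V, \<psi>) \<in> atlas M" "p \<in> V"
  shows "chart_vector M U \<phi> u p =
    chart_vector M V \<psi> (frechet_derivative (\<psi> \<circ> inv_into U \<phi>) (at (\<phi> p)) u) p"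
proof
  fix h
  show "chart_vector M U \<phi> u p h =
    chart_vector M V \<psi> (frechet_derivative (\<psi> \<circ> inv_into U \<phi>) (at (\<phi> p)) u) p h"
  proof (cases "smooth_near M p h")
    case True
    let ?D = "frechet_derivative (\<psi> \<circ> inv_into U \<phi>) (at (\<phi> p))"
    let ?E = "frechet_derivative (h \<circ> inv_into V \<psi>) (at (\<psi> p))"
    have B: "open (\<phi> ` (U \<inter> V))" "\<phi> p \<in> \<phi> ` (U \<inter> V)"
      using open_chart_image[OF U(1) chart_openin[OF V(1)]] U V by auto
    have D: "(\<psi> \<circ> inv_into U \<phi> has_derivative ?D) (at (\<phi> p))"
      using smooth_on_has_derivative[OF chart_transition[OF U(1) V(1)]] U V by blast
    moreover have "(h \<circ> inv_into V \<psi> has_derivative ?E) (at ((\<psi> \<circ> inv_into U \<phi>) (\<phi> p)))"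
      using smooth_near_has_derivative[OF True V] U by (simp add: chart_inv)
    ultimately have "((h \<circ> inv_into V \<psi>) \<circ> (\<psi> \<circ> inv_into U \<phi>) has_derivative ?E \<circ> ?D) (at (\<phi> p))"
      by (rule diff_chain_at)
    then have "(h \<circ> inv_into U \<phi> has_derivative ?E \<circ> ?D) (at (\<phi> p))"
      by (rule has_derivative_transform_within_open[OF _ B]) (use U V in \<open>auto simp: chart_inv\<close>)
    then show ?thesis
      using chart_vector_eqI[OF U True] True by (simp add: chart_vector_def)
  qed (simp add: chart_vector_def)
qed

lemma chart_vector_tangent:
  "(U, \<phi>) \<in> atlas M \<Longrightarrow> p \<in> U \<Longrightarrow> chart_vector M U \<phi> u p \<in> tangent_space M p"
  unfolding tangent_space_chart_vector by blast

lemma tangent_chart_vectorE: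
  assumes "v \<in> tangent_space M p" "(U, \<phi>) \<in> atlas M" "p \<in> U"
  obtains u where "v = chart_vector M U \<phi> u p"
  using assms chart_vector_change unfolding tangent_space_chart_vector by blast

lemma tangent_point: "v \<in> tangent_space M p \<Longrightarrow> p \<in> points M"
  unfolding tangent_space_chart_vector using chart_subset by blast

lemma chart_vector_linear:
  assumes "(U, \<phi>) \<in> atlas M" "p \<in> U"
  shows "linear (\<lambda>u. chart_vector M U \<phi> u p h)"
proof (cases "smooth_near M p h")
  case True
  then show ?thesis
    using has_derivative_linear[OF smooth_near_has_derivative[OF True assms]]
    by (simp add: chart_vector_def)
next
  case False
  then show ?thesis
    by (simp add: chart_vector_def linear_iff)
qed

text \<open>Evaluation at the coordinate functions recovers \<open>u\<close>, so tangent vectors are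
  compared, and linear algebra is done, in the model space \<open>'e\<close>.\<close>

lemma chart_vector_coordinate:
  assumes "(U, \<phi>) \<in> atlas M" "p \<in> U"
  shows "chart_vector M U \<phi> u p (\<lambda>q. \<phi> q \<bullet> b) = u \<bullet> b"
proof (rule chart_vector_eqI[OF assms])
  show "smooth_near M p (\<lambda>q. \<phi> q \<bullet> b)"
    by (rule smooth_nearI[OF smooth_functions_coordinate[OF assms(1)] chart_openin[OF assms(1)] assms(2)])
  have "((\<lambda>x. x \<bullet> b) has_derivative (\<lambda>x. x \<bullet> b)) (at (\<phi> p))"
    by (auto intro!: derivative_eq_intros)
  then show "((\<lambda>q. \<phi> q \<bullet> b) \<circ> inv_into U \<phi> has_derivative (\<lambda>x. x \<bullet> b)) (at (\<phi> p))"
    by (rule has_derivative_transform_within_open[OF _ chart_open_image[OF assms(1)]])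
       (use assms in \<open>auto simp: chart_inv\<close>)
qed

lemma tangent_expand:
  assumes "v \<in> tangent_space M p" "(U, \<phi>) \<in> atlas M" "p \<in> U"
  shows "v h = (\<Sum>b\<in>Basis. v (\<lambda>q. \<phi> q \<bullet> b) * chart_vector M U \<phi> b p h)"
proof -
  obtain u where u: "v = chart_vector M U \<phi> u p"
    using tangent_chart_vectorE[OF assms] .
  interpret linear "\<lambda>u. chart_vector M U \<phi> u p h"
    by (rule chart_vector_linear[OF assms(2,3)])
  show ?thesis
    unfolding u chart_vector_coordinate[OF assms(2,3)]
    by (subst euclidean_representation[symmetric, of u]) (simp only: sum scaleR real_scaleR_def)
qed

lemma tangent_lincomb:
  assumes "v \<in> tangent_space M p" "w \<in> tangent_space M p"
  shows "(\<lambda>h. a * v h + b * w h) \<in> tangent_space M p"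
proof -
  obtain U \<phi> where U: "(U, \<phi>) \<in> atlas M" "p \<in> U"
    using chart_exists tangent_point assms(1) by blast
  obtain u u' where u: "v = chart_vector M U \<phi> u p" "w = chart_vector M U \<phi> u' p"
    using tangent_chart_vectorE[OF _ U] assms by metis
  have "(\<lambda>h. a * v h + b * w h) = chart_vector M U \<phi> (a *\<^sub>R u + b *\<^sub>R u') p"
    using linear_add[OF chart_vector_linear[OF U]] linear_scale[OF chart_vector_linear[OF U]]
    by (simp add: u fun_eq_iff)
  then show ?thesis
    using chart_vector_tangent[OF U] by simp
qed

lemma tangent_zero: "p \<in> points M \<Longrightarrow> (\<lambda>h. 0) \<in> tangent_space M p"
proof -
  assume "p \<in> points M"
  then obtain U \<phi> where U: "(U, \<phi>) \<in> atlas M" "p \<in> U"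
    using chart_exists by blast
  show ?thesis
    using tangent_lincomb[OF chart_vector_tangent[OF U, of 0] chart_vector_tangent[OF U, of 0], of 0 0] by simp
qed

lemma tangent_scale: "v \<in> tangent_space M p \<Longrightarrow> (\<lambda>h. a * v h) \<in> tangent_space M p"
  using tangent_lincomb[of v p v a 0] by simp

lemma tangent_sum:
  assumes "p \<in> points M" "\<And>i. i \<in> A \<Longrightarrow> v i \<in> tangent_space M p"
  shows "(\<lambda>h. \<Sum>i\<in>A. a i * v i h) \<in> tangent_space M p"
  using assms(2)
proof (induction A rule: infinite_finite_induct)
  case (insert i A)
  then show ?case
    using tangent_lincomb[of "v i" p "\<lambda>h. \<Sum>i\<in>A. a i * v i h" "a i" 1] by simp
qed (simp_all add: tangent_zero assms(1))

lemma tangent_not_smooth: "v \<in> tangent_space M p \<Longrightarrow> \<not> smooth_near M p h \<Longrightarrow> v h = 0"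
  unfolding tangent_space_chart_vector by (auto simp: chart_vector_def)

text \<open>Tangent vectors see only the germ of a function. This includes the default value,
  because smoothness near \<open>p\<close> is itself a property of the germ.\<close>

lemma tangent_cong:
  assumes "v \<in> tangent_space M p" "openin (mtop M) W" "p \<in> W" "\<And>q. q \<in> W \<Longrightarrow> h q = k q"
  shows "v h = v k"
proof (cases "smooth_near M p h")
  case True
  then have k: "smooth_near M p k"
    using smooth_near_cong[OF assms(2-4)] by simp
  obtain U \<phi> u where U: "(U, \<phi>) \<in> atlas M" "p \<in> U" and v: "v = chart_vector M U \<phi> u p"
    using assms(1) unfolding tangent_space_chart_vector by blast
  have "(k \<circ> inv_into U \<phi> has_derivative frechet_derivative (h \<circ> inv_into U \<phi>) (at (\<phi> p))) (at (\<phi> p))"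
    by (rule has_derivative_transform_within_open[OF smooth_near_has_derivative[OF True U]
          open_chart_image[OF U(1) assms(2)]]) (use U assms in \<open>auto simp: chart_inv\<close>)
  from chart_vector_eqI[OF U k this] show ?thesis
    using True by (simp add: v chart_vector_def)
next
  case False
  then show ?thesis
    using smooth_near_cong[OF assms(2-4)] tangent_not_smooth[OF assms(1)] by simp
qed

lemma tangent_add:
  assumes "v \<in> tangent_space M p" "smooth_near M p h" "smooth_near M p k"
  shows "v (\<lambda>q. h q + k q) = v h + v k"
proof -
  obtain U \<phi> u where U: "(U, \<phi>) \<in> atlas M" "p \<in> U" and v: "v = chart_vector M U \<phi> u p"
    using assms(1) unfolding tangent_space_chart_vector by blast
  show ?thesis
    unfolding v
    using chart_vector_eqI[OF U smooth_near_add[OF assms(2,3)], of _ u]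
      has_derivative_add[OF smooth_near_has_derivative[OF assms(2) U] smooth_near_has_derivative[OF assms(3) U]]
      assms(2,3)
    by (simp add: o_def chart_vector_def)
qed

lemma tangent_mult:
  assumes "v \<in> tangent_space M p" "smooth_near M p h" "smooth_near M p k"
  shows "v (\<lambda>q. h q * k q) = h p * v k + v h * k p"
proof -
  obtain U \<phi> u where U: "(U, \<phi>) \<in> atlas M" "p \<in> U" and v: "v = chart_vector M U \<phi> u p"
    using assms(1) unfolding tangent_space_chart_vector by blast
  show ?thesis
    unfolding v
    using chart_vector_eqI[OF U smooth_near_mult[OF assms(2,3)], of _ u]
      has_derivative_mult[OF smooth_near_has_derivative[OF assms(2) U] smooth_near_has_derivative[OF assms(3) U]]
      assms(2,3) U
    by (simp add: o_def chart_vector_def chart_inv)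
qed

lemma tangent_chain:
  assumes "v \<in> tangent_space M p" "smooth_near M p h" "smooth_near M p (\<lambda>q. a (h q))"
    and "(a has_real_derivative a') (at (h p))"
  shows "v (\<lambda>q. a (h q)) = a' * v h"
proof -
  obtain U \<phi> u where U: "(U, \<phi>) \<in> atlas M" "p \<in> U" and v: "v = chart_vector M U \<phi> u p"
    using assms(1) unfolding tangent_space_chart_vector by blast
  have "(a \<circ> (h \<circ> inv_into U \<phi>) has_derivative
      (*) a' \<circ> frechet_derivative (h \<circ> inv_into U \<phi>) (at (\<phi> p))) (at (\<phi> p))"
    using assms(4) U by (intro diff_chain_at smooth_near_has_derivative[OF assms(2) U])
      (simp add: chart_inv has_field_derivative_def)
  then have "((\<lambda>q. a (h q)) \<circ> inv_into U \<phi> has_derivative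
      (*) a' \<circ> frechet_derivative (h \<circ> inv_into U \<phi>) (at (\<phi> p))) (at (\<phi> p))"
    by (simp add: o_def)
  from chart_vector_eqI[OF U assms(3) this] show ?thesis
    using assms(2) by (simp add: v chart_vector_def)
qed

lemma tangent_const:
  assumes "v \<in> tangent_space M p"
  shows "v (\<lambda>q. c) = 0"
  using tangent_chain[OF assms smooth_near_const smooth_near_const, of "\<lambda>x. c" 0 c]
    tangent_point[OF assms] by simp

section \<open>Local vector fields as a module over the smooth functions\<close>

lemma vector_fields_add:
  assumes "X \<in> vector_fields M W" "Y \<in> vector_fields M W"
  shows "X +\<^sub>v Y \<in> vector_fields M W"
  using assms tangent_lincomb[of "X p" p "Y p" 1 1 for p] smooth_functions_add
  unfolding vector_fields_def vf_add_def by simp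

lemma vector_fields_diff:
  assumes "X \<in> vector_fields M W" "Y \<in> vector_fields M W"
  shows "X -\<^sub>v Y \<in> vector_fields M W"
  using assms tangent_lincomb[of "X p" p "Y p" 1 "-1" for p] smooth_functions_diff
  unfolding vector_fields_def vf_diff_def by simp

lemma vector_fields_scale:
  assumes "X \<in> vector_fields M W" "k \<in> smooth_functions M W"
  shows "k *\<^sub>v X \<in> vector_fields M W"
  using assms smooth_functions_mult smooth_functions_subset[OF assms(2)] tangent_scale[of "X p" p "k p" for p]
  unfolding vector_fields_def vf_scale_def by auto

lemma vector_fields_zero: "openin (mtop M) W \<Longrightarrow> (\<lambda>p h. 0) \<in> vector_fields M W"
  unfolding vector_fields_def using tangent_zero smooth_functions_const openin_subset by blast

lemma vector_fields_sum:
  assumes "openin (mtop M) W" "\<And>i. i \<in> A \<Longrightarrow> X i \<in> vector_fields M W" "\<And>i. i \<in> A \<Longrightarrow> a i \<in> smooth_functions M W"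
  shows "(\<lambda>p h. \<Sum>i\<in>A. a i p * X i p h) \<in> vector_fields M W"
  using assms(2,3)
proof (induction A rule: infinite_finite_induct)
  case (insert i A)
  then show ?case
    using vector_fields_add[OF vector_fields_scale[of "X i" W "a i"], of "\<lambda>p h. \<Sum>i\<in>A. a i p * X i p h"]
    by (simp add: vf_add_def vf_scale_def)
qed (simp_all add: vector_fields_zero assms(1))

lemma vector_fields_cong:
  assumes "openin (mtop M) W" "\<And>p. p \<in> W \<Longrightarrow> X p = Y p"
  shows "X \<in> vector_fields M W \<longleftrightarrow> Y \<in> vector_fields M W"
proof -
  have "(\<lambda>p. X p h) \<in> smooth_functions M W' \<longleftrightarrow> (\<lambda>p. Y p h) \<in> smooth_functions M W'"
    if "openin (mtop M) W'" "W' \<subseteq> W" for W' h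
    by (rule smooth_functions_cong[OF that(1)]) (use assms(2) that(2) in auto)
  then show ?thesis
    unfolding vector_fields_def using assms(2) by auto
qed

text \<open>Lets a globally defined field, such as the time field or a lift, be recognised as smooth
  one chart at a time.\<close>

lemma vector_fields_local:
  assumes "openin (mtop M) W"
    and "\<And>p. p \<in> W \<Longrightarrow> \<exists>N. openin (mtop M) N \<and> p \<in> N \<and> X \<in> vector_fields M N"
  shows "X \<in> vector_fields M W"
proof -
  have "(\<lambda>p. X p h) \<in> smooth_functions M W'"
    if W': "openin (mtop M) W'" "W' \<subseteq> W" "h \<in> smooth_functions M W'" for W' h
  proof (rule smooth_functions_local[OF W'(1)])
    fix p assume "p \<in> W'"
    then obtain N where N: "openin (mtop M) N" "p \<in> N" "X \<in> vector_fields M N"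
      using assms(2) W' by blast
    have o: "openin (mtop M) (N \<inter> W')"
      using N W' by blast
    have "(\<lambda>p. X p h) \<in> smooth_functions M (N \<inter> W')"
      by (rule vector_fields_smooth[OF N(3) o _ smooth_functions_subset[OF W'(3)]]) auto
    then show "\<exists>N. openin (mtop M) N \<and> p \<in> N \<and> (\<lambda>p. X p h) \<in> smooth_functions M N"
      using o N \<open>p \<in> W'\<close> by blast
  qed
  moreover have "X p \<in> tangent_space M p" if "p \<in> W" for p
    using assms(2)[OF that] vector_fields_tangent[of X M _ p] by blast
  ultimately show ?thesis
    by (auto simp: vector_fields_def)
qed

lemma chart_vector_field:
  assumes U: "(U, \<phi>) \<in> atlas M"
  shows "chart_vector M U \<phi> u \<in> vector_fields M U"
proof -
  have "(\<lambda>p. chart_vector M U \<phi> u p h) \<in> smooth_functions M W"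
    if W: "openin (mtop M) W" "W \<subseteq> U" "h \<in> smooth_functions M W" for W h
  proof (rule smooth_functionsI)
    fix p assume p: "p \<in> W"
    have "smooth_on (\<phi> ` (U \<inter> W)) (\<lambda>x. frechet_derivative (h \<circ> inv_into U \<phi>) (at x) u)"
      by (rule smooth_on_frechet_derivative[OF smooth_functions_chart[OF W(3) U]])
    moreover have "chart_vector M U \<phi> u (inv_into U \<phi> x) h =
        frechet_derivative (h \<circ> inv_into U \<phi>) (at x) u" if "x \<in> \<phi> ` (U \<inter> W)" for x
      using that U W smooth_nearI[OF W(3,1)] by (auto simp: chart_vector_def chart_inv)
    ultimately have "smooth_on (\<phi> ` (U \<inter> W)) ((\<lambda>p. chart_vector M U \<phi> u p h) \<circ> inv_into U \<phi>)"
      by (subst smooth_on_cong[OF open_chart_image[OF U W(1)]]) auto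
    then show "\<exists>V \<psi> N. (V, \<psi>) \<in> atlas M \<and> p \<in> V \<and> openin (mtop M) N \<and> p \<in> N \<and>
        smooth_on (\<psi> ` (V \<inter> N)) ((\<lambda>p. chart_vector M U \<phi> u p h) \<circ> inv_into V \<psi>)"
      using U W p by blast
  qed
  then show ?thesis
    using chart_vector_tangent[OF U] by (auto simp: vector_fields_def)
qed

end


section \<open>Orthonormal frames\<close>

locale pseudo_riemannian = smooth_atlas M for M :: "('p, 'e::euclidean_space) manifold" +
  fixes g :: "'p metric"
  assumes metric: "pseudo_riemannian_metric M g"
begin

section \<open>Bilinear algebra of the metric\<close>

lemma metric_sym: "v \<in> tangent_space M p \<Longrightarrow> w \<in> tangent_space M p \<Longrightarrow> g p v w = g p w v"
  using metric tangent_point unfolding pseudo_riemannian_metric_def by blast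

lemma metric_lincomb_left:
  "v \<in> tangent_space M p \<Longrightarrow> v' \<in> tangent_space M p \<Longrightarrow> w \<in> tangent_space M p \<Longrightarrow>
    g p (\<lambda>h. a * v h + b * v' h) w = a * g p v w + b * g p v' w"
  using metric tangent_point[of v p] unfolding pseudo_riemannian_metric_def by blast

lemma metric_lincomb_right:
  "v \<in> tangent_space M p \<Longrightarrow> v' \<in> tangent_space M p \<Longrightarrow> w \<in> tangent_space M p \<Longrightarrow>
    g p w (\<lambda>h. a * v h + b * v' h) = a * g p w v + b * g p w v'"
  using metric_lincomb_left[of v p v' w a b] by (simp add: metric_sym tangent_lincomb)

lemma metric_nondegenerate:
  "v \<in> tangent_space M p \<Longrightarrow> (\<And>w. w \<in> tangent_space M p \<Longrightarrow> g p v w = 0) \<Longrightarrow> v = (\<lambda>h. 0)"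
  using metric tangent_point[of v p] unfolding pseudo_riemannian_metric_def by blast

lemma metric_smooth:
  "openin (mtop M) W \<Longrightarrow> X \<in> vector_fields M W \<Longrightarrow> Y \<in> vector_fields M W \<Longrightarrow>
    (\<lambda>p. g p (X p) (Y p)) \<in> smooth_functions M W"
  using metric unfolding pseudo_riemannian_metric_def by blast

lemma metric_zero_left: "w \<in> tangent_space M p \<Longrightarrow> g p (\<lambda>h. 0) w = 0"
  using metric_lincomb_left[of w p w w 0 0] by simp

lemma metric_scale_left:
  "v \<in> tangent_space M p \<Longrightarrow> w \<in> tangent_space M p \<Longrightarrow> g p (\<lambda>h. a * v h) w = a * g p v w"
  using metric_lincomb_left[of v p v w a 0] by simp

lemma metric_add_left:
  "v \<in> tangent_space M p \<Longrightarrow> v' \<in> tangent_space M p \<Longrightarrow> w \<in> tangent_space M p \<Longrightarrow>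
    g p (\<lambda>h. v h + v' h) w = g p v w + g p v' w"
  using metric_lincomb_left[of v p v' w 1 1] by simp

lemma metric_diff_left:
  "v \<in> tangent_space M p \<Longrightarrow> v' \<in> tangent_space M p \<Longrightarrow> w \<in> tangent_space M p \<Longrightarrow>
    g p (\<lambda>h. v h - v' h) w = g p v w - g p v' w"
  using metric_lincomb_left[of v p v' w 1 "-1"] by simp

lemma metric_scale_right:
  "v \<in> tangent_space M p \<Longrightarrow> w \<in> tangent_space M p \<Longrightarrow> g p w (\<lambda>h. a * v h) = a * g p w v"
  using metric_lincomb_right[of v p v w a 0] by simp

lemma metric_add_right:
  "v \<in> tangent_space M p \<Longrightarrow> v' \<in> tangent_space M p \<Longrightarrow> w \<in> tangent_space M p \<Longrightarrow>
    g p w (\<lambda>h. v h + v' h) = g p w v + g p w v'"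
  using metric_lincomb_right[of v p v' w 1 1] by simp

lemma metric_sum_left:
  assumes "\<And>i. i \<in> A \<Longrightarrow> v i \<in> tangent_space M p" "w \<in> tangent_space M p"
  shows "g p (\<lambda>h. \<Sum>i\<in>A. a i * v i h) w = (\<Sum>i\<in>A. a i * g p (v i) w)"
  using assms(1)
proof (induction A rule: infinite_finite_induct)
  case (insert i A)
  have "(\<lambda>h. \<Sum>i\<in>A. a i * v i h) \<in> tangent_space M p"
    using tangent_sum[OF tangent_point[OF assms(2)], of A v] insert by blast
  then show ?case
    using metric_lincomb_left[of "v i" p "\<lambda>h. \<Sum>i\<in>A. a i * v i h" w "a i" 1] insert assms(2) by simp
qed (simp_all add: metric_zero_left assms(2))

section \<open>Orthonormal systems in one tangent space\<close>

definition orthonormal_system :: "'p \<Rightarrow> 'i set \<Rightarrow> ('i \<Rightarrow> 'p tangent_vector) \<Rightarrow> ('i \<Rightarrow> real) \<Rightarrow> bool"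
  where "orthonormal_system p A v \<epsilon> \<longleftrightarrow> finite A \<and> p \<in> points M \<and>
    (\<forall>i\<in>A. v i \<in> tangent_space M p \<and> (\<epsilon> i = 1 \<or> \<epsilon> i = - 1)) \<and>
    (\<forall>i\<in>A. \<forall>j\<in>A. g p (v i) (v j) = (if i = j then \<epsilon> i else 0))"

lemma orthonormal_system_tangent:
  "orthonormal_system p A v \<epsilon> \<Longrightarrow> i \<in> A \<Longrightarrow> v i \<in> tangent_space M p"
  by (simp add: orthonormal_system_def)

lemma orthonormal_system_sign:
  "orthonormal_system p A v \<epsilon> \<Longrightarrow> i \<in> A \<Longrightarrow> \<epsilon> i * \<epsilon> i = 1"
  by (auto simp: orthonormal_system_def)

lemma orthonormal_system_coeff:
  assumes "orthonormal_system p A v \<epsilon>" "j \<in> A"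
  shows "g p (\<lambda>h. \<Sum>i\<in>A. a i * v i h) (v j) = a j * \<epsilon> j"
proof -
  have "g p (\<lambda>h. \<Sum>i\<in>A. a i * v i h) (v j) = (\<Sum>i\<in>A. a i * g p (v i) (v j))"
    using assms by (intro metric_sum_left) (auto simp: orthonormal_system_def)
  also have "\<dots> = (\<Sum>i\<in>A. if i = j then a j * \<epsilon> j else 0)"
    using assms by (intro sum.cong) (auto simp: orthonormal_system_def)
  also have "\<dots> = a j * \<epsilon> j"
    using assms by (simp add: orthonormal_system_def)
  finally show ?thesis .
qed

text \<open>Dimension count: pairing with the \<open>v i\<close> shows that the system is
  independent, so the linear map \<open>L\<close> of the model space, which sends coefficients to
  chart components, is injective and hence surjective. The coefficients are then read off by
  pairing, where \<open>\<epsilon> i\<close> is its own inverse.\<close>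

lemma orthonormal_system_expand:
  fixes v :: "'e \<Rightarrow> 'p tangent_vector"
  assumes v: "orthonormal_system p Basis v \<epsilon>" and w: "w \<in> tangent_space M p"
  shows "w h = (\<Sum>i\<in>Basis. \<epsilon> i * g p w (v i) * v i h)"
proof -
  obtain U \<phi> where U: "(U, \<phi>) \<in> atlas M" "p \<in> U"
    using chart_exists tangent_point w by blast
  have "\<exists>u. v i = chart_vector M U \<phi> u p" if "i \<in> Basis" for i
    using tangent_chart_vectorE[OF orthonormal_system_tangent[OF v that] U] by metis
  then obtain u where u: "\<And>i. i \<in> Basis \<Longrightarrow> v i = chart_vector M U \<phi> (u i) p"
    by metis
  define L where "L x = (\<Sum>b\<in>Basis. (x \<bullet> b) *\<^sub>R u b)" for x :: 'e
  have lin: "linear L"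
    unfolding L_def by (intro linear_compose_sum ballI linearI) (auto simp: inner_add_left scaleR_add_left)
  have L: "chart_vector M U \<phi> (L x) p = (\<lambda>h. \<Sum>b\<in>Basis. (x \<bullet> b) * v b h)" for x
  proof
    fix h
    interpret c: linear "\<lambda>u. chart_vector M U \<phi> u p h"
      by (rule chart_vector_linear[OF U])
    show "chart_vector M U \<phi> (L x) p h = (\<Sum>b\<in>Basis. (x \<bullet> b) * v b h)"
      unfolding L_def by (simp only: c.sum c.scaleR real_scaleR_def) (simp add: u)
  qed
  have "x = 0" if "L x = 0" for x
  proof (rule euclidean_eqI)
    fix b :: 'e assume b: "b \<in> Basis"
    have "(\<lambda>h. \<Sum>b\<in>Basis. (x \<bullet> b) * v b h) = (\<lambda>h. 0)"
      using L[of x] that linear_0[OF chart_vector_linear[OF U]] by (simp add: fun_eq_iff)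
    then have "(x \<bullet> b) * \<epsilon> b = 0"
      using orthonormal_system_coeff[OF v b, of "\<lambda>b. x \<bullet> b"]
        metric_zero_left[OF orthonormal_system_tangent[OF v b]] by simp
    then show "x \<bullet> b = 0 \<bullet> b"
      using orthonormal_system_sign[OF v b] by auto
  qed
  then have "inj L"
    using linear_injective_0[OF lin] by blast
  then have "surj L"
    using linear_injective_imp_surjective[OF lin] by blast
  moreover obtain u' where "w = chart_vector M U \<phi> u' p"
    using tangent_chart_vectorE[OF w U] .
  ultimately obtain x where x: "w = (\<lambda>h. \<Sum>b\<in>Basis. (x \<bullet> b) * v b h)"
    using L by (metis surjD)
  have "\<epsilon> b * g p w (v b) = x \<bullet> b" if "b \<in> Basis" for b
    unfolding x orthonormal_system_coeff[OF v that] using orthonormal_system_sign[OF v that]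
    by (simp add: mult.left_commute)
  then show ?thesis
    by (simp add: x)
qed

text \<open>A system indexed by a proper part of \<open>Basis\<close> cannot span: \<open>L\<close>
  kills the basis vector \<open>c\<close> outside \<open>A\<close>, so it is not surjective, and a
  tangent vector whose components miss its range differs from its projection onto the span.\<close>

lemma orthonormal_system_incomplete:
  fixes v :: "'e \<Rightarrow> 'p tangent_vector"
  assumes v: "orthonormal_system p A v \<epsilon>" and A: "A \<subset> Basis"
  obtains w where "w \<in> tangent_space M p" "w \<noteq> (\<lambda>h. \<Sum>i\<in>A. \<epsilon> i * g p w (v i) * v i h)"
proof -
  have "p \<in> points M"
    using v by (simp add: orthonormal_system_def)
  then obtain U \<phi> where U: "(U, \<phi>) \<in> atlas M" "p \<in> U"
    using chart_exists by blast
  have "\<exists>u. v i = chart_vector M U \<phi> u p" if "i \<in> A" for i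
    using tangent_chart_vectorE[OF orthonormal_system_tangent[OF v that] U] by metis
  then obtain u where u: "\<And>i. i \<in> A \<Longrightarrow> v i = chart_vector M U \<phi> (u i) p"
    by metis
  define L where "L x = (\<Sum>b\<in>A. (x \<bullet> b) *\<^sub>R u b)" for x :: 'e
  have lin: "linear L"
    unfolding L_def by (intro linear_compose_sum ballI linearI) (auto simp: inner_add_left scaleR_add_left)
  obtain c where c: "c \<in> Basis" "c \<notin> A"
    using A by blast
  have "c \<bullet> b = 0" if "b \<in> A" for b
    using that A c inner_not_same_Basis[OF c(1)] by blast
  then have "L c = 0"
    by (simp add: L_def)
  then have "\<not> inj L"
    using linear_injective_0[OF lin] nonzero_Basis[OF c(1)] by blast
  then have "\<not> surj L"
    using linear_surjective_imp_injective[OF lin] by blast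
  then obtain u' where u': "\<And>x. u' \<noteq> L x"
    by blast
  let ?w = "chart_vector M U \<phi> u' p"
  have "?w \<noteq> (\<lambda>h. \<Sum>i\<in>A. \<epsilon> i * g p ?w (v i) * v i h)"
  proof
    assume *: "?w = (\<lambda>h. \<Sum>i\<in>A. \<epsilon> i * g p ?w (v i) * v i h)"
    define x where "x = (\<Sum>b\<in>A. (\<epsilon> b * g p ?w (v b)) *\<^sub>R b)"
    have "x \<bullet> b = \<epsilon> b * g p ?w (v b)" if b: "b \<in> A" for b
    proof -
      have "x \<bullet> b = (\<Sum>i\<in>A. if i = b then \<epsilon> b * g p ?w (v b) else 0)"
        unfolding x_def inner_sum_left
        by (rule sum.cong) (use A b in \<open>auto simp: inner_Basis subset_iff\<close>)
      then show ?thesis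
        using b v by (simp add: orthonormal_system_def)
    qed
    then have "L x = (\<Sum>i\<in>A. (\<epsilon> i * g p ?w (v i)) *\<^sub>R u i)"
      by (simp add: L_def)
    moreover have "u' \<bullet> b = (\<Sum>i\<in>A. (\<epsilon> i * g p ?w (v i)) *\<^sub>R u i) \<bullet> b" for b
    proof -
      have "u' \<bullet> b = ?w (\<lambda>q. \<phi> q \<bullet> b)"
        by (simp add: chart_vector_coordinate[OF U])
      also have "\<dots> = (\<Sum>i\<in>A. \<epsilon> i * g p ?w (v i) * v i (\<lambda>q. \<phi> q \<bullet> b))"
        by (subst *) simp
      also have "\<dots> = (\<Sum>i\<in>A. \<epsilon> i * g p ?w (v i) * (u i \<bullet> b))"
        by (rule sum.cong) (simp_all add: u chart_vector_coordinate[OF U])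
      finally show ?thesis
        by (simp add: inner_sum_left)
    qed
    ultimately show False
      using u' by (metis euclidean_eqI)
  qed
  then show ?thesis
    using that chart_vector_tangent[OF U] by blast
qed

text \<open>The factor \<open>\<epsilon> i\<close> makes the projection correct along vectors of
  negative square as well, because \<open>\<epsilon> i * \<epsilon> i = 1\<close>.\<close>

lemma orthonormal_projection:
  assumes v: "orthonormal_system p A v \<epsilon>" and w: "w \<in> tangent_space M p"
  defines "w' \<equiv> \<lambda>h. w h - (\<Sum>i\<in>A. \<epsilon> i * g p w (v i) * v i h)"
  shows "w' \<in> tangent_space M p" and "j \<in> A \<Longrightarrow> g p w' (v j) = 0"
proof -
  have s: "(\<lambda>h. \<Sum>i\<in>A. \<epsilon> i * g p w (v i) * v i h) \<in> tangent_space M p"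
    by (rule tangent_sum[OF tangent_point[OF w] orthonormal_system_tangent[OF v]])
  show "w' \<in> tangent_space M p"
    using tangent_lincomb[OF w s, of 1 "-1"] by (simp add: w'_def)
  show "g p w' (v j) = 0" if "j \<in> A"
    using metric_diff_left[OF w s orthonormal_system_tangent[OF v that]] orthonormal_system_sign[OF v that]
    by (simp add: w'_def orthonormal_system_coeff[OF v that])
qed

text \<open>In an indefinite metric Gram-Schmidt could stop at null vectors. If the whole orthogonal
  complement \<open>?K\<close> were null, the metric would vanish on it by polarisation; a nonzero
  vector of \<open>?K\<close>, which exists because the system is incomplete, would be orthogonal to
  the complement and to the system, hence to everything, against nondegeneracy.\<close>

lemma orthonormal_complement_nonnull:
  fixes v :: "'e \<Rightarrow> 'p tangent_vector"
  assumes v: "orthonormal_system p A v \<epsilon>" and A: "A \<subset> Basis"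
  obtains x where "x \<in> tangent_space M p" "\<And>i. i \<in> A \<Longrightarrow> g p x (v i) = 0" "g p x x \<noteq> 0"
proof (rule ccontr)
  note witness = that
  assume *: "\<not> thesis"
  let ?K = "{x \<in> tangent_space M p. \<forall>i\<in>A. g p x (v i) = 0}"
  have null: "g p x x = 0" if "x \<in> ?K" for x
    using * witness[of x] that by auto
  have K: "g p x y = 0" if x: "x \<in> ?K" and y: "y \<in> ?K" for x y
  proof -
    have t: "x \<in> tangent_space M p" "y \<in> tangent_space M p"
      using x y by auto
    have xy: "(\<lambda>h. x h + y h) \<in> tangent_space M p"
      using tangent_lincomb[OF t, of 1 1] by simp
    moreover have "g p (\<lambda>h. x h + y h) (v i) = 0" if "i \<in> A" for i
      using metric_add_left[OF t orthonormal_system_tangent[OF v that]] x y that by simp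
    ultimately have "g p (\<lambda>h. x h + y h) (\<lambda>h. x h + y h) = 0"
      by (intro null) simp
    then have "g p x x + g p x y + (g p x y + g p y y) = 0"
      using metric_sym[OF t] by (simp add: metric_add_left[OF t xy] metric_add_right[OF t] t)
    then show ?thesis
      using null[OF x] null[OF y] by simp
  qed
  obtain w where w: "w \<in> tangent_space M p" "w \<noteq> (\<lambda>h. \<Sum>i\<in>A. \<epsilon> i * g p w (v i) * v i h)"
    using orthonormal_system_incomplete[OF v A] by blast
  let ?w = "\<lambda>h. w h - (\<Sum>i\<in>A. \<epsilon> i * g p w (v i) * v i h)"
  have wK: "?w \<in> ?K"
    using orthonormal_projection[OF v w(1)] by simp
  have "?w = (\<lambda>h. 0)"
  proof (rule metric_nondegenerate)
    show w_t: "?w \<in> tangent_space M p"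
      using wK by simp
    fix y assume y: "y \<in> tangent_space M p"
    let ?s = "\<lambda>h. \<Sum>i\<in>A. \<epsilon> i * g p y (v i) * v i h"
    let ?y = "\<lambda>h. y h - ?s h"
    have yK: "?y \<in> ?K"
      using orthonormal_projection[OF v y] by simp
    have s: "?s \<in> tangent_space M p"
      by (rule tangent_sum[OF tangent_point[OF y] orthonormal_system_tangent[OF v]])
    have "g p ?w (\<lambda>h. ?y h + ?s h) = g p ?w ?y + g p ?w ?s"
      using yK s w_t by (intro metric_add_right) auto
    moreover have "g p ?s ?w = (\<Sum>i\<in>A. \<epsilon> i * g p y (v i) * g p (v i) ?w)"
      by (rule metric_sum_left[OF orthonormal_system_tangent[OF v] w_t])
    moreover have "g p (v i) ?w = 0" if "i \<in> A" for i
      using metric_sym[OF w_t orthonormal_system_tangent[OF v that]] wK that by simp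
    ultimately have "g p ?w (\<lambda>h. ?y h + ?s h) = 0"
      using K[OF wK yK] metric_sym[OF s w_t] by simp
    then show "g p ?w y = 0"
      by simp
  qed
  then show False
    using w(2) by (simp add: fun_eq_iff)
qed

section \<open>Gram-Schmidt for local frames\<close>

definition orthonormal_fields :: "'p set \<Rightarrow> 'i set \<Rightarrow> ('i \<Rightarrow> 'p vector_field) \<Rightarrow> ('i \<Rightarrow> real) \<Rightarrow> bool"
  where "orthonormal_fields W A E \<epsilon> \<longleftrightarrow> openin (mtop M) W \<and>
    (\<forall>i\<in>A. E i \<in> vector_fields M W \<and> (\<epsilon> i = 1 \<or> \<epsilon> i = - 1)) \<and>
    (\<forall>i\<in>A. \<forall>j\<in>A. \<forall>p\<in>W. g p (E i p) (E j p) = (if i = j then \<epsilon> i else 0))"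

lemma orthonormal_frame_fields: "orthonormal_frame M g W E \<epsilon> \<longleftrightarrow> orthonormal_fields W Basis E \<epsilon>"
  by (simp add: orthonormal_frame_def orthonormal_fields_def)

lemma orthonormal_fields_system:
  "orthonormal_fields W A E \<epsilon> \<Longrightarrow> finite A \<Longrightarrow> p \<in> W \<Longrightarrow> orthonormal_system p A (\<lambda>i. E i p) \<epsilon>"
  unfolding orthonormal_fields_def orthonormal_system_def
  using openin_subset[of "mtop M" W] vector_fields_tangent[of _ M W p] by auto

lemma orthonormal_fields_subset:
  "orthonormal_fields W A E \<epsilon> \<Longrightarrow> openin (mtop M) W' \<Longrightarrow> W' \<subseteq> W \<Longrightarrow> orthonormal_fields W' A E \<epsilon>"
  unfolding orthonormal_fields_def using vector_fields_subset by blast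

text \<open>One Gram-Schmidt step. A non-null vector orthogonal to the system at \<open>p\<close> is
  extended with constant coordinates, projected off the given fields at every point, and normalised
  where it is still non-null.\<close>

lemma orthonormal_fields_extend:
  fixes E :: "'e \<Rightarrow> 'p vector_field"
  assumes E: "orthonormal_fields W A E \<epsilon>" and p: "p \<in> W" and A: "A \<subseteq> Basis" "k \<in> Basis" "k \<notin> A"
  shows "\<exists>W' E' \<epsilon>'. p \<in> W' \<and> orthonormal_fields W' (insert k A) E' \<epsilon>'"
proof -
  have fin: "finite A"
    using A(1) finite_Basis by (rule finite_subset)
  note sys = orthonormal_fields_system[OF E fin]
  have W: "openin (mtop M) W"
    using E by (simp add: orthonormal_fields_def)
  obtain x where x: "x \<in> tangent_space M p" "\<And>i. i \<in> A \<Longrightarrow> g p x (E i p) = 0" "g p x x \<noteq> 0"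
    using orthonormal_complement_nonnull[OF sys[OF p]] A by blast
  obtain U \<phi> where U: "(U, \<phi>) \<in> atlas M" "p \<in> U"
    using chart_exists tangent_point[OF x(1)] by blast
  obtain u where u: "x = chart_vector M U \<phi> u p"
    using tangent_chart_vectorE[OF x(1) U] .
  let ?X = "chart_vector M U \<phi> u"
  define W1 where "W1 = W \<inter> U"
  have W1: "openin (mtop M) W1" "W1 \<subseteq> W" "W1 \<subseteq> U" "p \<in> W1"
    using W chart_openin[OF U(1)] p U by (auto simp: W1_def)
  have X: "?X \<in> vector_fields M W1"
    using vector_fields_subset[OF chart_vector_field[OF U(1)] W1(3)] .
  have E1: "E i \<in> vector_fields M W1" if "i \<in> A" for i
    using that E vector_fields_subset[OF _ W1(2)] by (auto simp: orthonormal_fields_def)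
  define Y where "Y = ?X -\<^sub>v (\<lambda>q h. \<Sum>i\<in>A. (\<epsilon> i * g q (?X q) (E i q)) * E i q h)"
  have Y: "Y \<in> vector_fields M W1"
    unfolding Y_def using E1 X W1
    by (intro vector_fields_diff vector_fields_sum smooth_functions_mult smooth_functions_const metric_smooth)
  have Y_perp: "g q (Y q) (E i q) = 0" if "q \<in> W1" "i \<in> A" for q i
    using orthonormal_projection(2)[OF sys vector_fields_tangent[OF X that(1)] that(2)] that W1(2)
    by (auto simp: Y_def vf_diff_def)
  \<comment> \<open>At \<open>p\<close> the projection subtracts nothing, since \<open>x\<close> is
    already orthogonal to the system; so \<open>Y\<close> is non-null at \<open>p\<close> and, by
    continuity, nearby.\<close>
  have Yp: "Y p = x"
    by (simp add: Y_def vf_diff_def u[symmetric] x(2))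
  define \<sigma> where "\<sigma> = sgn (g p x x)"
  have \<sigma>: "\<sigma> = 1 \<or> \<sigma> = - 1"
    using x(3) by (auto simp: \<sigma>_def sgn_if)
  let ?G = "\<lambda>q. \<sigma> * g q (Y q) (Y q)"
  have G: "?G \<in> smooth_functions M W1"
    by (intro smooth_functions_mult smooth_functions_const metric_smooth W1 Y)
  define W2 where "W2 = {q \<in> W1. ?G q \<in> {0<..}}"
  have W2: "openin (mtop M) W2" "W2 \<subseteq> W1"
    unfolding W2_def using openin_smooth_vimage[OF W1(1) G open_greaterThan[of 0]] by auto
  have p2: "p \<in> W2"
    using W1(4) x(3) by (auto simp: W2_def Yp \<sigma>_def sgn_if)
  \<comment> \<open>On \<open>W2\<close> the function \<open>?G\<close> is the absolute value of
    \<open>g q (Y q) (Y q)\<close>, so \<open>N\<close> is the reciprocal length. Written with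
    \<open>powr\<close> it is smooth, as \<open>?G\<close> is positive there.\<close>
  define N where "N q = ?G q powr (- 1/2)" for q
  have N: "N \<in> smooth_functions M W2"
    unfolding N_def by (rule smooth_functions_compose[OF W2(1) smooth_functions_subset[OF G W2(2)] _ smooth_on_powr])
      (auto simp: W2_def)
  define Z where "Z = N *\<^sub>v Y"
  have Z: "Z \<in> vector_fields M W2"
    unfolding Z_def by (rule vector_fields_scale[OF vector_fields_subset[OF Y W2(2)] N])
  have Yt: "Y q \<in> tangent_space M q" and Et: "i \<in> A \<Longrightarrow> E i q \<in> tangent_space M q" if "q \<in> W2" for q i
    using that W2(2) vector_fields_tangent[OF Y] vector_fields_tangent[OF E1] by blast+
  have ZE: "g q (Z q) (E i q) = 0" "g q (E i q) (Z q) = 0" if "q \<in> W2" "i \<in> A" for q i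
  proof -
    show "g q (Z q) (E i q) = 0"
      using that W2(2) Y_perp by (auto simp: Z_def vf_scale_def metric_scale_left Yt Et)
    then show "g q (E i q) (Z q) = 0"
      using metric_sym[of "Z q" q "E i q"] vector_fields_tangent[OF Z that(1)] Et[OF that] by simp
  qed
  have ZZ: "g q (Z q) (Z q) = \<sigma>" if q: "q \<in> W2" for q
  proof -
    have "g q (Z q) (Z q) = N q * (N q * g q (Y q) (Y q))"
      using tangent_scale[OF Yt[OF q], of "N q"]
      by (simp add: Z_def vf_scale_def metric_scale_left metric_scale_right Yt[OF q])
    also have "\<dots> = \<sigma> * (N q * N q * ?G q)"
      using \<sigma> by auto
    also have "N q * N q = ?G q powr (- 1)"
      unfolding N_def by (simp flip: powr_add)
    also have "?G q powr (- 1) * ?G q = 1"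
    proof -
      have "?G q > 0"
        using q by (simp add: W2_def)
      then show ?thesis
        by (metis left_inverse less_irrefl order_less_imp_le powr_minus powr_one)
    qed
    finally show ?thesis by simp
  qed
  have "orthonormal_fields W2 (insert k A) (E(k := Z)) (\<epsilon>(k := \<sigma>))"
    unfolding orthonormal_fields_def
    using W2 Z \<sigma> ZZ ZE E A(3) W1(2) vector_fields_subset[OF E1 W2(2)]
    by (auto simp: orthonormal_fields_def subset_iff)
  then show ?thesis
    using p2 by blast
qed

lemma orthonormal_frame_exists:
  assumes "p \<in> points M"
  shows "\<exists>W E \<epsilon>. p \<in> W \<and> orthonormal_frame M g W E \<epsilon>"
proof -
  have "\<exists>W E \<epsilon>. p \<in> W \<and> orthonormal_fields W A E \<epsilon>" if "A \<subseteq> Basis" for A :: "'e set"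
    using finite_subset[OF that finite_Basis] that
  proof (induction A)
    case empty
    then show ?case
      using assms by (auto simp: orthonormal_fields_def)
  next
    case (insert k A)
    then obtain W E \<epsilon> where "p \<in> W" "orthonormal_fields W A E \<epsilon>"
      by auto
    then show ?case
      using orthonormal_fields_extend insert.hyps insert.prems by simp
  qed
  then show ?thesis
    unfolding orthonormal_frame_fields by blast
qed

lemma frame_system:
  assumes "orthonormal_frame M g W E \<epsilon>" "p \<in> W"
  shows "orthonormal_system p Basis (\<lambda>i. E i p) \<epsilon>"
  using orthonormal_fields_system[OF _ finite_Basis assms(2)] assms(1) by (simp add: orthonormal_frame_fields)

lemma frame_subset:
  "orthonormal_frame M g W E \<epsilon> \<Longrightarrow> openin (mtop M) W' \<Longrightarrow> W' \<subseteq> W \<Longrightarrow> orthonormal_frame M g W' E \<epsilon>"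
  unfolding orthonormal_frame_fields by (rule orthonormal_fields_subset)

text \<open>
  The sum is the trace of \<open>B\<close> with respect to the metric; the frames are related by a matrix of
  smooth functions, so only bilinearity of \<open>B\<close> over the smooth functions enters.
\<close>

lemma frame_trace_invariant:
  assumes E: "orthonormal_frame M g W E \<epsilon>" and E': "orthonormal_frame M g W E' \<epsilon>'" and p: "p \<in> W"
    and left: "\<And>a Y. (\<And>i. i \<in> Basis \<Longrightarrow> a i \<in> smooth_functions M W) \<Longrightarrow> Y \<in> vector_fields M W \<Longrightarrow>
      B (\<lambda>p h. \<Sum>i\<in>Basis. a i p * E i p h) Y = (\<Sum>i\<in>Basis. a i p * B (E i) Y)"
    and right: "\<And>a X. (\<And>i. i \<in> Basis \<Longrightarrow> a i \<in> smooth_functions M W) \<Longrightarrow> X \<in> vector_fields M W \<Longrightarrow>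
      B X (\<lambda>p h. \<Sum>i\<in>Basis. a i p * E i p h) = (\<Sum>i\<in>Basis. a i p * B X (E i))"
    and cong: "\<And>X Y X' Y'. X \<in> vector_fields M W \<Longrightarrow> Y \<in> vector_fields M W \<Longrightarrow>
      (\<And>q. q \<in> W \<Longrightarrow> X' q = X q \<and> Y' q = Y q) \<Longrightarrow> B X' Y' = B X Y"
  shows "(\<Sum>k\<in>Basis. \<epsilon>' k * B (E' k) (E' k)) = (\<Sum>k\<in>Basis. \<epsilon> k * B (E k) (E k))"
proof -
  have W: "openin (mtop M) W" and Ef: "\<And>i. i \<in> Basis \<Longrightarrow> E i \<in> vector_fields M W"
    and Ef': "\<And>i. i \<in> Basis \<Longrightarrow> E' i \<in> vector_fields M W"
    using E E' by (auto simp: orthonormal_frame_def)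
  define a where "a k i q = \<epsilon> i * g q (E' k q) (E i q)" for k i q
  have a: "a k i \<in> smooth_functions M W" if "k \<in> Basis" "i \<in> Basis" for k i
    unfolding a_def using that
    by (intro smooth_functions_mult smooth_functions_const metric_smooth W Ef Ef')
  \<comment> \<open>\<open>F k\<close> agrees with \<open>E' k\<close> only on \<open>W\<close>, but
    it is literally a combination of the \<open>E i\<close>, the form that \<open>left\<close> and
    \<open>right\<close> accept; \<open>cong\<close> passes between the two.\<close>
  define F where "F k = (\<lambda>q h. \<Sum>i\<in>Basis. a k i q * E i q h)" for k
  have F: "F k q = E' k q" if "k \<in> Basis" "q \<in> W" for k q
    using orthonormal_system_expand[OF frame_system[OF E that(2)] vector_fields_tangent[OF Ef'[OF that(1)] that(2)]]
    by (simp add: F_def a_def fun_eq_iff)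
  have Ff: "F k \<in> vector_fields M W" if "k \<in> Basis" for k
    unfolding F_def by (intro vector_fields_sum W Ef a that)
  have "B (E' k) (E' k) = (\<Sum>i\<in>Basis. \<Sum>j\<in>Basis. a k i p * a k j p * B (E i) (E j))" if k: "k \<in> Basis" for k
  proof -
    have "B (E' k) (E' k) = B (F k) (F k)"
      using cong[OF Ff[OF k] Ff[OF k], of "E' k" "E' k"] F[OF k] by simp
    also have "\<dots> = (\<Sum>i\<in>Basis. a k i p * B (E i) (F k))"
      by (subst (1) F_def) (intro left a k Ff)
    also have "\<dots> = (\<Sum>i\<in>Basis. a k i p * (\<Sum>j\<in>Basis. a k j p * B (E i) (E j)))"
      unfolding F_def by (intro sum.cong refl arg_cong[where f="(*) _"] right a k Ef)
    finally show ?thesis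
      by (simp add: sum_distrib_left mult.assoc)
  qed
  then have "(\<Sum>k\<in>Basis. \<epsilon>' k * B (E' k) (E' k)) =
      (\<Sum>k\<in>Basis. \<Sum>i\<in>Basis. \<Sum>j\<in>Basis. \<epsilon>' k * (a k i p * a k j p) * B (E i) (E j))"
    by (simp add: sum_distrib_left mult.assoc)
  also have "\<dots> = (\<Sum>i\<in>Basis. \<Sum>j\<in>Basis. \<Sum>k\<in>Basis. \<epsilon>' k * (a k i p * a k j p) * B (E i) (E j))"
    by (subst sum.swap) (intro sum.cong refl sum.swap)
  also have "\<dots> = (\<Sum>i\<in>Basis. \<Sum>j\<in>Basis. (if i = j then \<epsilon> i else 0) * B (E i) (E j))"
  proof (intro sum.cong refl)
    fix i j :: 'e assume ij: "i \<in> Basis" "j \<in> Basis"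
    have t: "E j p \<in> tangent_space M p" "E i p \<in> tangent_space M p" "\<And>k. k \<in> Basis \<Longrightarrow> E' k p \<in> tangent_space M p"
      using vector_fields_tangent[OF Ef p] vector_fields_tangent[OF Ef' p] ij by auto
    \<comment> \<open>Expanding \<open>E i\<close> in the frame \<open>E'\<close> turns the
      orthonormality of \<open>E\<close> into the relation by which the sum over \<open>k\<close>
      contracts to the sign matrix of \<open>E\<close>.\<close>
    have "g p (E i p) (E j p) = (\<Sum>k\<in>Basis. \<epsilon>' k * g p (E i p) (E' k p) * g p (E' k p) (E j p))"
    proof -
      have "E i p = (\<lambda>h. \<Sum>k\<in>Basis. \<epsilon>' k * g p (E i p) (E' k p) * E' k p h)"
        by (rule ext) (rule orthonormal_system_expand[OF frame_system[OF E' p] t(2)])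
      then show ?thesis
        using metric_sum_left[of Basis "\<lambda>k. E' k p" p "E j p" "\<lambda>k. \<epsilon>' k * g p (E i p) (E' k p)"] t
        by simp
    qed
    then have "(\<Sum>k\<in>Basis. \<epsilon>' k * (a k i p * a k j p)) = \<epsilon> i * \<epsilon> j * g p (E i p) (E j p)"
      by (simp add: a_def sum_distrib_left metric_sym[OF t(2) t(3)] ac_simps)
    also have "\<dots> = (if i = j then \<epsilon> i else 0)"
      using E p ij orthonormal_system_sign[OF frame_system[OF E p] ij(1)] by (auto simp: orthonormal_frame_def)
    finally show "(\<Sum>k\<in>Basis. \<epsilon>' k * (a k i p * a k j p) * B (E i) (E j)) = (if i = j then \<epsilon> i else 0) * B (E i) (E j)"
      by (simp flip: sum_distrib_right)
  qed
  also have "\<dots> = (\<Sum>k\<in>Basis. \<epsilon> k * B (E k) (E k))"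
    by (simp add: if_distrib[of "\<lambda>x. x * _"] cong: if_cong)
  finally show ?thesis .
qed

end


section \<open>Tensoriality of the curvature\<close>

lemma lie_bracket_skew: "lie_bracket M X Y p h = - lie_bracket M Y X p h"
  by (simp add: lie_bracket_def)

text \<open>
  Every torsion-free connection makes the bracket of two vector fields a vector field again.  Assuming
  this closure property here avoids proving the symmetry of second derivatives.
\<close>

locale affine = smooth_atlas M for M :: "('p, 'e::euclidean_space) manifold" +
  fixes nab :: "'p connection"
  assumes connection: "affine_connection M nab"
    and lie_bracket_field: "openin (mtop M) W \<Longrightarrow> X \<in> vector_fields M W \<Longrightarrow> Y \<in> vector_fields M W \<Longrightarrow>
      lie_bracket M X Y \<in> vector_fields M W"

section \<open>Locality and linearity of the Lie bracket\<close>

context smooth_atlas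
begin

lemma smooth_near_field:
  assumes "X \<in> vector_fields M W" "openin (mtop M) W" "p \<in> W" "smooth_near M p h"
  shows "smooth_near M p (\<lambda>q. X q h)"
proof -
  obtain V where V: "openin (mtop M) V" "p \<in> V" "h \<in> smooth_functions M V"
    using assms(4) by (auto simp: smooth_near_def)
  have o: "openin (mtop M) (W \<inter> V)"
    using assms(2) V(1) by blast
  have "(\<lambda>q. X q h) \<in> smooth_functions M (W \<inter> V)"
    by (rule vector_fields_smooth[OF assms(1) o _ smooth_functions_subset[OF V(3)]]) auto
  then show ?thesis
    using o V(2) assms(3) by (auto intro: smooth_nearI)
qed

lemma lie_bracket_cong:
  assumes "openin (mtop M) W" "p \<in> W" "X \<in> vector_fields M W" "Y \<in> vector_fields M W"
    and "\<And>q. q \<in> W \<Longrightarrow> X' q = X q" "\<And>q. q \<in> W \<Longrightarrow> Y' q = Y q"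
  shows "lie_bracket M X' Y' p = lie_bracket M X Y p"
  using tangent_cong[OF vector_fields_tangent[OF assms(3,2)] assms(1,2), of "\<lambda>q. Y' q h" "\<lambda>q. Y q h" for h]
    tangent_cong[OF vector_fields_tangent[OF assms(4,2)] assms(1,2), of "\<lambda>q. X' q h" "\<lambda>q. X q h" for h]
    assms(2,5,6)
  by (simp add: lie_bracket_def fun_eq_iff)

lemma lie_bracket_add_left:
  assumes "openin (mtop M) W" "p \<in> W"
    and "X \<in> vector_fields M W" "X' \<in> vector_fields M W" "Y \<in> vector_fields M W"
  shows "lie_bracket M (X +\<^sub>v X') Y p = (lie_bracket M X Y +\<^sub>v lie_bracket M X' Y) p"
proof
  fix h
  show "lie_bracket M (X +\<^sub>v X') Y p h = (lie_bracket M X Y +\<^sub>v lie_bracket M X' Y) p h"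
    using tangent_add[OF vector_fields_tangent[OF assms(5,2)]
        smooth_near_field[OF assms(3,1,2)] smooth_near_field[OF assms(4,1,2)]]
    by (simp add: lie_bracket_def vf_add_def)
qed

lemma lie_bracket_scale_left:
  assumes "openin (mtop M) W" "p \<in> W" "k \<in> smooth_functions M W"
    and "X \<in> vector_fields M W" "Y \<in> vector_fields M W"
  shows "lie_bracket M (k *\<^sub>v X) Y p = (k *\<^sub>v lie_bracket M X Y -\<^sub>v (\<lambda>q. Y q k) *\<^sub>v X) p"
proof
  fix h
  show "lie_bracket M (k *\<^sub>v X) Y p h = (k *\<^sub>v lie_bracket M X Y -\<^sub>v (\<lambda>q. Y q k) *\<^sub>v X) p h"
  proof (cases "smooth_near M p h")
    case True
    then show ?thesis
      using tangent_mult[OF vector_fields_tangent[OF assms(5,2)]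
          smooth_nearI[OF assms(3,1,2)] smooth_near_field[OF assms(4,1,2) True]]
      by (simp add: lie_bracket_def vf_scale_def vf_diff_def algebra_simps)
  next
    case False
    then show ?thesis
      using tangent_not_smooth[OF vector_fields_tangent[OF assms(4,2)]]
      by (simp add: lie_bracket_def vf_scale_def vf_diff_def)
  qed
qed

lemma lie_bracket_apply:
  "smooth_near M p h \<Longrightarrow> lie_bracket M X Y p h = X p (\<lambda>q. Y q h) - Y p (\<lambda>q. X q h)"
  by (simp add: lie_bracket_def)

text \<open>Isolates the passage from two-term laws to finite sums, to be used for each of the four
  arguments of the lowered curvature. The value on the zero field comes from scaling by the zero
  function.\<close>

lemma field_linear_sum:
  fixes \<Phi> :: "'p vector_field \<Rightarrow> real"
  assumes W: "openin (mtop M) W"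
    and add: "\<And>X Y. X \<in> vector_fields M W \<Longrightarrow> Y \<in> vector_fields M W \<Longrightarrow> \<Phi> (X +\<^sub>v Y) = \<Phi> X + \<Phi> Y"
    and scale: "\<And>k X. k \<in> smooth_functions M W \<Longrightarrow> X \<in> vector_fields M W \<Longrightarrow> \<Phi> (k *\<^sub>v X) = k p * \<Phi> X"
    and fields: "\<And>i. i \<in> A \<Longrightarrow> X i \<in> vector_fields M W" "\<And>i. i \<in> A \<Longrightarrow> a i \<in> smooth_functions M W"
  shows "\<Phi> (\<lambda>p h. \<Sum>i\<in>A. a i p * X i p h) = (\<Sum>i\<in>A. a i p * \<Phi> (X i))"
proof -
  have zero: "\<Phi> (\<lambda>p h. 0) = 0"
    using scale[OF smooth_functions_const[OF W, of 0] vector_fields_zero[OF W]]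
    by (simp add: vf_scale_def)
  show ?thesis
    using fields
  proof (induction A rule: infinite_finite_induct)
    case (insert i A)
    have "(\<lambda>p h. \<Sum>i\<in>insert i A. a i p * X i p h) = a i *\<^sub>v X i +\<^sub>v (\<lambda>p h. \<Sum>i\<in>A. a i p * X i p h)"
      using insert by (simp add: vf_add_def vf_scale_def)
    moreover have "(\<lambda>p h. \<Sum>i\<in>A. a i p * X i p h) \<in> vector_fields M W"
      by (rule vector_fields_sum[OF W]) (use insert in auto)
    moreover have "a i *\<^sub>v X i \<in> vector_fields M W"
      by (rule vector_fields_scale) (use insert in auto)
    ultimately show ?case
      using insert by (simp add: add scale)
  qed (simp_all add: zero)
qed

end

section \<open>Locality and linearity of a connection and of its curvature\<close>

context affine
begin

lemma nab_laws:
  assumes "openin (mtop M) W" "X \<in> vector_fields M W" "Y \<in> vector_fields M W"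
  shows "\<forall>X' Y'. (\<forall>p\<in>W. X' p = X p \<and> Y' p = Y p) \<longrightarrow> (\<forall>p\<in>W. nab X' Y' p = nab X Y p)"
    and "nab X Y \<in> vector_fields M W"
    and "\<forall>Z \<in> vector_fields M W. \<forall>p\<in>W.
      nab (X +\<^sub>v Z) Y p = (nab X Y +\<^sub>v nab Z Y) p \<and> nab X (Y +\<^sub>v Z) p = (nab X Y +\<^sub>v nab X Z) p"
    and "\<forall>k \<in> smooth_functions M W. \<forall>p\<in>W. nab (k *\<^sub>v X) Y p = (k *\<^sub>v nab X Y) p \<and>
      nab X (k *\<^sub>v Y) p = ((\<lambda>q. X q k) *\<^sub>v Y +\<^sub>v k *\<^sub>v nab X Y) p"
proof -
  note laws = connection[unfolded affine_connection_def, THEN spec, THEN mp, OF assms(1),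
      THEN bspec, OF assms(2), THEN bspec, OF assms(3)]
  show "\<forall>X' Y'. (\<forall>p\<in>W. X' p = X p \<and> Y' p = Y p) \<longrightarrow> (\<forall>p\<in>W. nab X' Y' p = nab X Y p)"
    by (rule laws[THEN conjunct1])
  show "nab X Y \<in> vector_fields M W"
    by (rule laws[THEN conjunct2, THEN conjunct1])
  show "\<forall>Z \<in> vector_fields M W. \<forall>p\<in>W.
      nab (X +\<^sub>v Z) Y p = (nab X Y +\<^sub>v nab Z Y) p \<and> nab X (Y +\<^sub>v Z) p = (nab X Y +\<^sub>v nab X Z) p"
    by (rule laws[THEN conjunct2, THEN conjunct2, THEN conjunct1])
  show "\<forall>k \<in> smooth_functions M W. \<forall>p\<in>W. nab (k *\<^sub>v X) Y p = (k *\<^sub>v nab X Y) p \<and>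
      nab X (k *\<^sub>v Y) p = ((\<lambda>q. X q k) *\<^sub>v Y +\<^sub>v k *\<^sub>v nab X Y) p"
    by (rule laws[THEN conjunct2, THEN conjunct2, THEN conjunct2])
qed

text \<open>This is what allows a formula for an inner covariant derivative, valid on
  \<open>W\<close> only, to be inserted into an outer one.\<close>

lemma nab_cong:
  "openin (mtop M) W \<Longrightarrow> X \<in> vector_fields M W \<Longrightarrow> Y \<in> vector_fields M W \<Longrightarrow> p \<in> W \<Longrightarrow>
    (\<And>q. q \<in> W \<Longrightarrow> X' q = X q) \<Longrightarrow> (\<And>q. q \<in> W \<Longrightarrow> Y' q = Y q) \<Longrightarrow> nab X' Y' p = nab X Y p"
  by (rule nab_laws(1)[THEN spec, THEN spec, THEN mp, THEN bspec]) simp_all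

lemma nab_field:
  "openin (mtop M) W \<Longrightarrow> X \<in> vector_fields M W \<Longrightarrow> Y \<in> vector_fields M W \<Longrightarrow> nab X Y \<in> vector_fields M W"
  by (rule nab_laws(2))

lemma nab_add_left:
  "openin (mtop M) W \<Longrightarrow> X \<in> vector_fields M W \<Longrightarrow> Y \<in> vector_fields M W \<Longrightarrow> Z \<in> vector_fields M W \<Longrightarrow>
    p \<in> W \<Longrightarrow> nab (X +\<^sub>v Z) Y p = (nab X Y +\<^sub>v nab Z Y) p"
  by (rule nab_laws(3)[THEN bspec, THEN bspec, THEN conjunct1])

lemma nab_add_right:
  "openin (mtop M) W \<Longrightarrow> X \<in> vector_fields M W \<Longrightarrow> Y \<in> vector_fields M W \<Longrightarrow> Z \<in> vector_fields M W \<Longrightarrow>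
    p \<in> W \<Longrightarrow> nab X (Y +\<^sub>v Z) p = (nab X Y +\<^sub>v nab X Z) p"
  by (rule nab_laws(3)[THEN bspec, THEN bspec, THEN conjunct2])

lemma nab_scale_left:
  "openin (mtop M) W \<Longrightarrow> X \<in> vector_fields M W \<Longrightarrow> Y \<in> vector_fields M W \<Longrightarrow> k \<in> smooth_functions M W \<Longrightarrow>
    p \<in> W \<Longrightarrow> nab (k *\<^sub>v X) Y p = (k *\<^sub>v nab X Y) p"
  by (rule nab_laws(4)[THEN bspec, THEN bspec, THEN conjunct1])

lemma nab_scale_right:
  "openin (mtop M) W \<Longrightarrow> X \<in> vector_fields M W \<Longrightarrow> Y \<in> vector_fields M W \<Longrightarrow> k \<in> smooth_functions M W \<Longrightarrow>
    p \<in> W \<Longrightarrow> nab X (k *\<^sub>v Y) p = ((\<lambda>q. X q k) *\<^sub>v Y +\<^sub>v k *\<^sub>v nab X Y) p"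
  by (rule nab_laws(4)[THEN bspec, THEN bspec, THEN conjunct2])

lemma nab_diff_left:
  assumes "openin (mtop M) W" "X \<in> vector_fields M W" "Z \<in> vector_fields M W" "Y \<in> vector_fields M W" "p \<in> W"
  shows "nab (X -\<^sub>v Z) Y p = (nab X Y -\<^sub>v nab Z Y) p"
proof -
  have c: "(\<lambda>q. - 1) \<in> smooth_functions M W"
    by (rule smooth_functions_const[OF assms(1)])
  have "X -\<^sub>v Z = X +\<^sub>v (\<lambda>q. - 1) *\<^sub>v Z"
    by (simp add: vf_add_def vf_diff_def vf_scale_def)
  then have "nab (X -\<^sub>v Z) Y p = (nab X Y +\<^sub>v nab ((\<lambda>q. - 1) *\<^sub>v Z) Y) p"
    using nab_add_left[OF assms(1,2,4) vector_fields_scale[OF assms(3) c] assms(5)] by simp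
  then show ?thesis
    using nab_scale_left[OF assms(1,3,4) c assms(5)] by (simp add: vf_add_def vf_diff_def vf_scale_def)
qed

lemma nab_zero_left:
  assumes "openin (mtop M) W" "Y \<in> vector_fields M W" "p \<in> W"
  shows "nab (\<lambda>q h. 0) Y p h = 0"
  using nab_scale_left[OF assms(1) vector_fields_zero[OF assms(1)] assms(2) smooth_functions_const[OF assms(1), of 0] assms(3)]
  by (simp add: vf_scale_def fun_eq_iff)

lemma curvature_field:
  assumes "openin (mtop M) W" "X \<in> vector_fields M W" "Y \<in> vector_fields M W" "Z \<in> vector_fields M W"
  shows "curvature M nab X Y Z \<in> vector_fields M W"
  unfolding curvature_def
  by (intro vector_fields_diff nab_field assms lie_bracket_field)

lemma curvature_cong:
  assumes "openin (mtop M) W" "p \<in> W"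
    and "X \<in> vector_fields M W" "Y \<in> vector_fields M W" "Z \<in> vector_fields M W"
    and "\<And>q. q \<in> W \<Longrightarrow> X' q = X q" "\<And>q. q \<in> W \<Longrightarrow> Y' q = Y q" "\<And>q. q \<in> W \<Longrightarrow> Z' q = Z q"
  shows "curvature M nab X' Y' Z' p = curvature M nab X Y Z p"
proof -
  note f = assms(3-5) nab_field[OF assms(1)] lie_bracket_field[OF assms(1)]
  have n: "nab X' Z' q = nab X Z q" "nab Y' Z' q = nab Y Z q"
    "lie_bracket M X' Y' q = lie_bracket M X Y q" if "q \<in> W" for q
    using nab_cong[OF assms(1,3,5) that assms(6,8)] nab_cong[OF assms(1,4,5) that assms(7,8)]
      lie_bracket_cong[OF assms(1) that assms(3,4,6,7)] by auto
  have "nab X' (nab Y' Z') p = nab X (nab Y Z) p"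
    by (rule nab_cong[OF assms(1,3) f(4)[OF assms(4,5)] assms(2)]) (simp_all add: assms(6) n)
  moreover have "nab Y' (nab X' Z') p = nab Y (nab X Z) p"
    by (rule nab_cong[OF assms(1,4) f(4)[OF assms(3,5)] assms(2)]) (simp_all add: assms(7) n)
  moreover have "nab (lie_bracket M X' Y') Z' p = nab (lie_bracket M X Y) Z p"
    by (rule nab_cong[OF assms(1) f(5)[OF assms(3,4)] assms(5,2)]) (simp_all add: assms(8) n)
  ultimately show ?thesis
    by (simp add: curvature_def vf_diff_def)
qed

text \<open>Carries linearity from the first argument of the curvature to the second, so that only
  one of them has to be treated.\<close>

lemma curvature_skew:
  assumes "openin (mtop M) W" "p \<in> W"
    and "X \<in> vector_fields M W" "Y \<in> vector_fields M W" "Z \<in> vector_fields M W"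
  shows "curvature M nab X Y Z p h = - curvature M nab Y X Z p h"
proof -
  have "lie_bracket M X Y = (\<lambda>q h. 0) -\<^sub>v lie_bracket M Y X"
    using lie_bracket_skew[of M X Y] by (simp add: vf_diff_def fun_eq_iff)
  then have "nab (lie_bracket M X Y) Z p = (nab (\<lambda>q h. 0) Z -\<^sub>v nab (lie_bracket M Y X) Z) p"
    using nab_diff_left[OF assms(1) vector_fields_zero[OF assms(1)] lie_bracket_field[OF assms(1,4,3)] assms(5,2)]
    by simp
  then show ?thesis
    by (simp add: curvature_def vf_diff_def nab_zero_left[OF assms(1,5,2)])
qed

lemma curvature_add_left:
  assumes W: "openin (mtop M) W" "p \<in> W" and X: "X \<in> vector_fields M W" "X' \<in> vector_fields M W"
    and Y: "Y \<in> vector_fields M W" and Z: "Z \<in> vector_fields M W"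
  shows "curvature M nab (X +\<^sub>v X') Y Z p h = curvature M nab X Y Z p h + curvature M nab X' Y Z p h"
proof -
  note f = X Y Z nab_field[OF W(1)] lie_bracket_field[OF W(1)] vector_fields_add
  have 1: "nab (X +\<^sub>v X') (nab Y Z) p = (nab X (nab Y Z) +\<^sub>v nab X' (nab Y Z)) p"
    by (intro nab_add_left[OF W(1)] f W(2))
  have "nab Y (nab (X +\<^sub>v X') Z) p = nab Y (nab X Z +\<^sub>v nab X' Z) p"
    by (intro nab_cong[OF W(1)] f W(2) refl nab_add_left[OF W(1)])
  also have "\<dots> = (nab Y (nab X Z) +\<^sub>v nab Y (nab X' Z)) p"
    by (intro nab_add_right[OF W(1)] f W(2))
  finally have 2: "nab Y (nab (X +\<^sub>v X') Z) p = \<dots>" .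
  have "nab (lie_bracket M (X +\<^sub>v X') Y) Z p = nab (lie_bracket M X Y +\<^sub>v lie_bracket M X' Y) Z p"
    by (intro nab_cong[OF W(1)] f W(2) refl lie_bracket_add_left[OF W(1)])
  also have "\<dots> = (nab (lie_bracket M X Y) Z +\<^sub>v nab (lie_bracket M X' Y) Z) p"
    by (intro nab_add_left[OF W(1)] f W(2))
  finally show ?thesis
    using 1 2 by (simp add: curvature_def vf_diff_def vf_add_def)
qed

text \<open>The derivative \<open>Y q k\<close> appears twice, from the Leibniz rule for
  \<open>nab Y (k *\<^sub>v nab X Z)\<close> and from the bracket of \<open>k *\<^sub>v X\<close>
  with \<open>Y\<close>, and the two contributions cancel.\<close>

lemma curvature_scale_left:
  assumes W: "openin (mtop M) W" "p \<in> W" and k: "k \<in> smooth_functions M W" and X: "X \<in> vector_fields M W"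
    and Y: "Y \<in> vector_fields M W" and Z: "Z \<in> vector_fields M W"
  shows "curvature M nab (k *\<^sub>v X) Y Z p h = k p * curvature M nab X Y Z p h"
proof -
  have Yk: "(\<lambda>q. Y q k) \<in> smooth_functions M W"
    by (rule vector_fields_smooth[OF Y W(1) subset_refl k])
  note f = X Y Z nab_field[OF W(1)] lie_bracket_field[OF W(1)] vector_fields_diff vector_fields_scale k Yk
  have 1: "nab (k *\<^sub>v X) (nab Y Z) p = (k *\<^sub>v nab X (nab Y Z)) p"
    by (intro nab_scale_left[OF W(1)] f W(2))
  have "nab Y (nab (k *\<^sub>v X) Z) p = nab Y (k *\<^sub>v nab X Z) p"
    by (intro nab_cong[OF W(1)] f W(2) refl nab_scale_left[OF W(1)])
  also have "\<dots> = ((\<lambda>q. Y q k) *\<^sub>v nab X Z +\<^sub>v k *\<^sub>v nab Y (nab X Z)) p"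
    by (intro nab_scale_right[OF W(1)] f W(2))
  finally have 2: "nab Y (nab (k *\<^sub>v X) Z) p = \<dots>" .
  have "nab (lie_bracket M (k *\<^sub>v X) Y) Z p = nab (k *\<^sub>v lie_bracket M X Y -\<^sub>v (\<lambda>q. Y q k) *\<^sub>v X) Z p"
    by (intro nab_cong[OF W(1)] f W(2) refl lie_bracket_scale_left[OF W(1)])
  also have "\<dots> = (nab (k *\<^sub>v lie_bracket M X Y) Z -\<^sub>v nab ((\<lambda>q. Y q k) *\<^sub>v X) Z) p"
    by (intro nab_diff_left[OF W(1)] f W(2))
  also have "\<dots> = (k *\<^sub>v nab (lie_bracket M X Y) Z -\<^sub>v (\<lambda>q. Y q k) *\<^sub>v nab X Z) p"
    using nab_scale_left[OF W(1) lie_bracket_field[OF W(1) X Y] Z k W(2)] nab_scale_left[OF W(1) X Z Yk W(2)]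
    by (simp add: vf_diff_def)
  finally show ?thesis
    using 1 2 by (simp add: curvature_def vf_diff_def vf_add_def vf_scale_def algebra_simps)
qed

lemma curvature_add_right:
  assumes W: "openin (mtop M) W" "p \<in> W" and X: "X \<in> vector_fields M W"
    and Y: "Y \<in> vector_fields M W" and Z: "Z \<in> vector_fields M W" "Z' \<in> vector_fields M W"
  shows "curvature M nab X Y (Z +\<^sub>v Z') p h = curvature M nab X Y Z p h + curvature M nab X Y Z' p h"
proof -
  note f = X Y Z nab_field[OF W(1)] lie_bracket_field[OF W(1)] vector_fields_add
  have *: "nab A (nab B (Z +\<^sub>v Z')) p = (nab A (nab B Z) +\<^sub>v nab A (nab B Z')) p"
    if A: "A \<in> vector_fields M W" and B: "B \<in> vector_fields M W" for A B
  proof -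
    have "nab A (nab B (Z +\<^sub>v Z')) p = nab A (nab B Z +\<^sub>v nab B Z') p"
      by (intro nab_cong[OF W(1)] f A B W(2) refl nab_add_right[OF W(1)])
    also have "\<dots> = (nab A (nab B Z) +\<^sub>v nab A (nab B Z')) p"
      by (intro nab_add_right[OF W(1)] f A B W(2))
    finally show ?thesis .
  qed
  have "nab (lie_bracket M X Y) (Z +\<^sub>v Z') p = (nab (lie_bracket M X Y) Z +\<^sub>v nab (lie_bracket M X Y) Z') p"
    by (intro nab_add_right[OF W(1)] f W(2))
  then show ?thesis
    using *[OF X Y] *[OF Y X] by (simp add: curvature_def vf_diff_def vf_add_def)
qed

text \<open>The mixed terms with first derivatives of \<open>k\<close> are symmetric in
  \<open>X\<close> and \<open>Y\<close> and drop out of the commutator; the second derivatives form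
  the bracket applied to \<open>k\<close>, which the last term of the curvature removes.\<close>

lemma curvature_scale_right:
  assumes W: "openin (mtop M) W" "p \<in> W" and k: "k \<in> smooth_functions M W" and X: "X \<in> vector_fields M W"
    and Y: "Y \<in> vector_fields M W" and Z: "Z \<in> vector_fields M W"
  shows "curvature M nab X Y (k *\<^sub>v Z) p h = k p * curvature M nab X Y Z p h"
proof -
  note f = X Y Z nab_field[OF W(1)] lie_bracket_field[OF W(1)] vector_fields_add vector_fields_scale k
  have *: "nab A (nab B (k *\<^sub>v Z)) p h = A p (\<lambda>q. B q k) * Z p h + B p k * nab A Z p h
      + A p k * nab B Z p h + k p * nab A (nab B Z) p h"
    if A: "A \<in> vector_fields M W" and B: "B \<in> vector_fields M W" for A B
  proof -
    note Bk = vector_fields_smooth[OF B W(1) subset_refl k]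
    have "nab A (nab B (k *\<^sub>v Z)) p = nab A ((\<lambda>q. B q k) *\<^sub>v Z +\<^sub>v k *\<^sub>v nab B Z) p"
      by (intro nab_cong[OF W(1)] f A B Bk W(2) refl nab_scale_right[OF W(1)])
    also have "\<dots> = (nab A ((\<lambda>q. B q k) *\<^sub>v Z) +\<^sub>v nab A (k *\<^sub>v nab B Z)) p"
      by (intro nab_add_right[OF W(1)] f A B Bk W(2))
    finally show ?thesis
      using nab_scale_right[OF W(1) A Z Bk W(2)]
        nab_scale_right[OF W(1) A nab_field[OF W(1) B Z] k W(2)]
      by (simp add: vf_add_def vf_scale_def)
  qed
  have "nab (lie_bracket M X Y) (k *\<^sub>v Z) p =
      ((\<lambda>q. lie_bracket M X Y q k) *\<^sub>v Z +\<^sub>v k *\<^sub>v nab (lie_bracket M X Y) Z) p"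
    by (intro nab_scale_right[OF W(1)] f W(2))
  then show ?thesis
    using *[OF X Y] *[OF Y X] lie_bracket_apply[OF smooth_nearI[OF k W]]
    by (simp add: curvature_def vf_diff_def vf_add_def vf_scale_def algebra_simps)
qed

end

section \<open>Traces of the curvature\<close>

locale metric_affine = pseudo_riemannian M g + affine M nab
  for M :: "('p, 'e::euclidean_space) manifold" and g :: "'p metric" and nab :: "'p connection"
begin

definition curvature4 where "curvature4 p X Y Z V = g p (curvature M nab X Y Z p) (V p)"

context
  fixes W p
  assumes W: "openin (mtop M) W" and p: "p \<in> W"
begin

lemma curvature4_cong:
  assumes "X \<in> vector_fields M W" "Y \<in> vector_fields M W" "Z \<in> vector_fields M W" "V \<in> vector_fields M W"
    and "\<And>q. q \<in> W \<Longrightarrow> X' q = X q" "\<And>q. q \<in> W \<Longrightarrow> Y' q = Y q" "\<And>q. q \<in> W \<Longrightarrow> Z' q = Z q"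
      "\<And>q. q \<in> W \<Longrightarrow> V' q = V q"
  shows "curvature4 p X' Y' Z' V' = curvature4 p X Y Z V"
  using curvature_cong[OF W p assms(1-3,5-7)] assms(8) p by (simp add: curvature4_def)

lemma curvature4_add:
  assumes "X \<in> vector_fields M W" "Y \<in> vector_fields M W" "Z \<in> vector_fields M W" "V \<in> vector_fields M W"
    and "X' \<in> vector_fields M W"
  shows "curvature4 p (X +\<^sub>v X') Y Z V = curvature4 p X Y Z V + curvature4 p X' Y Z V"
    and "curvature4 p Y (X +\<^sub>v X') Z V = curvature4 p Y X Z V + curvature4 p Y X' Z V"
    and "curvature4 p Y Z (X +\<^sub>v X') V = curvature4 p Y Z X V + curvature4 p Y Z X' V"
    and "curvature4 p Y Z V (X +\<^sub>v X') = curvature4 p Y Z V X + curvature4 p Y Z V X'"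
proof -
  note t = vector_fields_tangent[OF curvature_field[OF W] p] assms[THEN vector_fields_tangent, OF p]
  have "curvature M nab (X +\<^sub>v X') Y Z p = (\<lambda>h. curvature M nab X Y Z p h + curvature M nab X' Y Z p h)"
    using curvature_add_left[OF W p assms(1,5,2,3)] by (rule ext)
  then show 1: "curvature4 p (X +\<^sub>v X') Y Z V = curvature4 p X Y Z V + curvature4 p X' Y Z V"
    by (simp add: curvature4_def metric_add_left t assms)
  have "curvature M nab Y (X +\<^sub>v X') Z p = (\<lambda>h. curvature M nab Y X Z p h + curvature M nab Y X' Z p h)"
    using curvature_add_left[OF W p assms(1,5,2,3)] curvature_skew[OF W p assms(2) _ assms(3)] assms vector_fields_add
    by (simp add: fun_eq_iff)
  then show "curvature4 p Y (X +\<^sub>v X') Z V = curvature4 p Y X Z V + curvature4 p Y X' Z V"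
    by (simp add: curvature4_def metric_add_left t assms)
  have "curvature M nab Y Z (X +\<^sub>v X') p = (\<lambda>h. curvature M nab Y Z X p h + curvature M nab Y Z X' p h)"
    using curvature_add_right[OF W p assms(2,3,1,5)] by (rule ext)
  then show "curvature4 p Y Z (X +\<^sub>v X') V = curvature4 p Y Z X V + curvature4 p Y Z X' V"
    by (simp add: curvature4_def metric_add_left t assms)
  show "curvature4 p Y Z V (X +\<^sub>v X') = curvature4 p Y Z V X + curvature4 p Y Z V X'"
    by (simp add: curvature4_def vf_add_def metric_add_right t assms)
qed

lemma curvature4_scale:
  assumes "X \<in> vector_fields M W" "Y \<in> vector_fields M W" "Z \<in> vector_fields M W" "V \<in> vector_fields M W"
    and "k \<in> smooth_functions M W"
  shows "curvature4 p (k *\<^sub>v X) Y Z V = k p * curvature4 p X Y Z V"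
    and "curvature4 p Y (k *\<^sub>v X) Z V = k p * curvature4 p Y X Z V"
    and "curvature4 p Y Z (k *\<^sub>v X) V = k p * curvature4 p Y Z X V"
    and "curvature4 p Y Z V (k *\<^sub>v X) = k p * curvature4 p Y Z V X"
proof -
  note t = vector_fields_tangent[OF curvature_field[OF W] p] assms(1-4)[THEN vector_fields_tangent, OF p]
  have "curvature M nab (k *\<^sub>v X) Y Z p = (\<lambda>h. k p * curvature M nab X Y Z p h)"
    using curvature_scale_left[OF W p assms(5,1,2,3)] by (rule ext)
  then show 1: "curvature4 p (k *\<^sub>v X) Y Z V = k p * curvature4 p X Y Z V"
    by (simp add: curvature4_def metric_scale_left t assms)
  have "curvature M nab Y (k *\<^sub>v X) Z p = (\<lambda>h. k p * curvature M nab Y X Z p h)"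
    using curvature_scale_left[OF W p assms(5,1,2,3)] curvature_skew[OF W p assms(2) _ assms(3)] assms vector_fields_scale
    by (simp add: fun_eq_iff)
  then show "curvature4 p Y (k *\<^sub>v X) Z V = k p * curvature4 p Y X Z V"
    by (simp add: curvature4_def metric_scale_left t assms)
  have "curvature M nab Y Z (k *\<^sub>v X) p = (\<lambda>h. k p * curvature M nab Y Z X p h)"
    using curvature_scale_right[OF W p assms(5,2,3,1)] by (rule ext)
  then show "curvature4 p Y Z (k *\<^sub>v X) V = k p * curvature4 p Y Z X V"
    by (simp add: curvature4_def metric_scale_left t assms)
  show "curvature4 p Y Z V (k *\<^sub>v X) = k p * curvature4 p Y Z V X"
    by (simp add: curvature4_def vf_scale_def metric_scale_right t assms)
qed

lemma curvature4_sum: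
  assumes "\<And>i. i \<in> A \<Longrightarrow> X i \<in> vector_fields M W" "\<And>i. i \<in> A \<Longrightarrow> a i \<in> smooth_functions M W"
    and "Y \<in> vector_fields M W" "Z \<in> vector_fields M W" "V \<in> vector_fields M W"
  shows "curvature4 p (\<lambda>p h. \<Sum>i\<in>A. a i p * X i p h) Y Z V = (\<Sum>i\<in>A. a i p * curvature4 p (X i) Y Z V)"
    and "curvature4 p Y (\<lambda>p h. \<Sum>i\<in>A. a i p * X i p h) Z V = (\<Sum>i\<in>A. a i p * curvature4 p Y (X i) Z V)"
    and "curvature4 p Y Z (\<lambda>p h. \<Sum>i\<in>A. a i p * X i p h) V = (\<Sum>i\<in>A. a i p * curvature4 p Y Z (X i) V)"
    and "curvature4 p Y Z V (\<lambda>p h. \<Sum>i\<in>A. a i p * X i p h) = (\<Sum>i\<in>A. a i p * curvature4 p Y Z V (X i))"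
  by (rule field_linear_sum[OF W, where \<Phi>="\<lambda>X. curvature4 p X Y Z V"];
      simp add: curvature4_add curvature4_scale assms)
     (rule field_linear_sum[OF W, where \<Phi>="\<lambda>X. curvature4 p Y X Z V"]
       field_linear_sum[OF W, where \<Phi>="\<lambda>X. curvature4 p Y Z X V"]
       field_linear_sum[OF W, where \<Phi>="\<lambda>X. curvature4 p Y Z V X"];
      simp add: curvature4_add curvature4_scale assms)+

end

text \<open>The given frame witnesses existence in the definite description; for uniqueness both
  frames are restricted to a common neighbourhood, where the trace lemma applies. The separate
  domain \<open>V\<close> is there because the arguments may be vectors of another frame, defined on
  another set.\<close>

lemma ricci_frame:
  assumes E: "orthonormal_frame M g W E \<epsilon>" and p: "p \<in> W"
    and V: "openin (mtop M) V" "p \<in> V" and X: "X \<in> vector_fields M V" and Y: "Y \<in> vector_fields M V"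
  shows "ricci M g nab X Y p = (\<Sum>k\<in>Basis. \<epsilon> k * curvature4 p X (E k) Y (E k))"
  unfolding ricci_def
proof (rule the_equality)
  show "\<exists>W E' \<epsilon>'. p \<in> W \<and> orthonormal_frame M g W E' \<epsilon>' \<and>
      (\<Sum>k\<in>Basis. \<epsilon> k * curvature4 p X (E k) Y (E k)) =
      (\<Sum>k\<in>Basis. \<epsilon>' k * g p (curvature M nab X (E' k) Y p) (E' k p))"
    using E p unfolding curvature4_def by blast
next
  fix r assume "\<exists>W E \<epsilon>. p \<in> W \<and> orthonormal_frame M g W E \<epsilon> \<and>
      r = (\<Sum>k\<in>Basis. \<epsilon> k * g p (curvature M nab X (E k) Y p) (E k p))"
  then obtain W' E' \<epsilon>' where p': "p \<in> W'" and E': "orthonormal_frame M g W' E' \<epsilon>'"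
    and r: "r = (\<Sum>k\<in>Basis. \<epsilon>' k * curvature4 p X (E' k) Y (E' k))"
    by (auto simp: curvature4_def)
  define N where "N = W \<inter> W' \<inter> V"
  have N: "openin (mtop M) N" "p \<in> N" "N \<subseteq> W" "N \<subseteq> W'" "N \<subseteq> V"
    using E E' V p p' by (auto simp: N_def orthonormal_frame_def)
  note XY = vector_fields_subset[OF X N(5)] vector_fields_subset[OF Y N(5)]
  note EN = frame_subset[OF E N(1,3)]
  then have Ef: "\<And>i. i \<in> Basis \<Longrightarrow> E i \<in> vector_fields M N"
    by (simp add: orthonormal_frame_def)
  show "r = (\<Sum>k\<in>Basis. \<epsilon> k * curvature4 p X (E k) Y (E k))"
    unfolding r
  proof (rule frame_trace_invariant[OF EN frame_subset[OF E' N(1,4)] N(2), where B="\<lambda>U V. curvature4 p X U Y V"])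
  qed (auto intro!: curvature4_sum[OF N(1,2)] curvature4_cong[OF N(1,2)] XY Ef)
qed

text \<open>The inner trace may be taken in the fixed frame \<open>E\<close> whatever outer frame is
  tried. The Ricci tensor thus becomes the form \<open>R\<close>, bilinear over the smooth
  functions, and the outer trace is again independent of the frame.\<close>

lemma scalar_curvature_frame:
  assumes E: "orthonormal_frame M g W E \<epsilon>" and p: "p \<in> W"
  shows "scalar_curvature M g nab p =
    (\<Sum>i\<in>Basis. \<Sum>j\<in>Basis. \<epsilon> i * \<epsilon> j * curvature4 p (E i) (E j) (E i) (E j))"
proof -
  have W: "openin (mtop M) W" and Ef: "\<And>i. i \<in> Basis \<Longrightarrow> E i \<in> vector_fields M W"
    using E by (auto simp: orthonormal_frame_def)
  define R where "R X Y = (\<Sum>k\<in>Basis. \<epsilon> k * curvature4 p X (E k) Y (E k))" for X Y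
  have "scalar_curvature M g nab p = (\<Sum>k\<in>Basis. \<epsilon> k * R (E k) (E k))"
    unfolding scalar_curvature_def
  proof (rule the_equality)
    show "\<exists>W E' \<epsilon>'. p \<in> W \<and> orthonormal_frame M g W E' \<epsilon>' \<and>
        (\<Sum>k\<in>Basis. \<epsilon> k * R (E k) (E k)) = (\<Sum>k\<in>Basis. \<epsilon>' k * ricci M g nab (E' k) (E' k) p)"
      using E p ricci_frame[OF E p W p Ef Ef] unfolding R_def
      by (intro exI[of _ W] exI[of _ E] exI[of _ \<epsilon>]) simp
  next
    fix s assume "\<exists>W E \<epsilon>. p \<in> W \<and> orthonormal_frame M g W E \<epsilon> \<and>
        s = (\<Sum>k\<in>Basis. \<epsilon> k * ricci M g nab (E k) (E k) p)"
    then obtain W' E' \<epsilon>' where p': "p \<in> W'" and E': "orthonormal_frame M g W' E' \<epsilon>'"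
      and s: "s = (\<Sum>k\<in>Basis. \<epsilon>' k * ricci M g nab (E' k) (E' k) p)"
      by blast
    have W': "openin (mtop M) W'" and Ef': "\<And>i. i \<in> Basis \<Longrightarrow> E' i \<in> vector_fields M W'"
      using E' by (auto simp: orthonormal_frame_def)
    define N where "N = W \<inter> W'"
    have N: "openin (mtop M) N" "p \<in> N" "N \<subseteq> W" "N \<subseteq> W'"
      using W W' p p' by (auto simp: N_def)
    note EN = vector_fields_subset[OF Ef N(3)]
    note sum4 = curvature4_sum[OF N(1,2)]
    have "s = (\<Sum>k\<in>Basis. \<epsilon>' k * R (E' k) (E' k))"
      unfolding s R_def using ricci_frame[OF E p W' p' Ef' Ef'] by simp
    also have "\<dots> = (\<Sum>k\<in>Basis. \<epsilon> k * R (E k) (E k))"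
    proof (rule frame_trace_invariant[OF frame_subset[OF E N(1,3)] frame_subset[OF E' N(1,4)] N(2),
          where B=R])
      fix a :: "'e \<Rightarrow> 'p \<Rightarrow> real" and Y
      assume a: "\<And>i. i \<in> Basis \<Longrightarrow> a i \<in> smooth_functions M N" and Y: "Y \<in> vector_fields M N"
      show "R (\<lambda>p h. \<Sum>i\<in>Basis. a i p * E i p h) Y = (\<Sum>i\<in>Basis. a i p * R (E i) Y)"
      proof -
        have "R (\<lambda>p h. \<Sum>i\<in>Basis. a i p * E i p h) Y =
            (\<Sum>k\<in>Basis. \<Sum>i\<in>Basis. a i p * (\<epsilon> k * curvature4 p (E i) (E k) Y (E k)))"
          by (simp add: R_def sum4(1) a Y EN sum_distrib_left mult.left_commute)
        also have "\<dots> = (\<Sum>i\<in>Basis. \<Sum>k\<in>Basis. a i p * (\<epsilon> k * curvature4 p (E i) (E k) Y (E k)))"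
          by (rule sum.swap)
        finally show ?thesis
          by (simp add: R_def sum_distrib_left)
      qed
      show "R Y (\<lambda>p h. \<Sum>i\<in>Basis. a i p * E i p h) = (\<Sum>i\<in>Basis. a i p * R Y (E i))"
      proof -
        have "R Y (\<lambda>p h. \<Sum>i\<in>Basis. a i p * E i p h) =
            (\<Sum>k\<in>Basis. \<Sum>i\<in>Basis. a i p * (\<epsilon> k * curvature4 p Y (E k) (E i) (E k)))"
          by (simp add: R_def sum4(3) a Y EN sum_distrib_left mult.left_commute)
        also have "\<dots> = (\<Sum>i\<in>Basis. \<Sum>k\<in>Basis. a i p * (\<epsilon> k * curvature4 p Y (E k) (E i) (E k)))"
          by (rule sum.swap)
        finally show ?thesis
          by (simp add: R_def sum_distrib_left)
      qed
    next
      fix X Y X' Y' assume *: "X \<in> vector_fields M N" "Y \<in> vector_fields M N"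
        "\<And>q. q \<in> N \<Longrightarrow> X' q = X q \<and> Y' q = Y q"
      have "curvature4 p X' (E k) Y' (E k) = curvature4 p X (E k) Y (E k)" if "k \<in> Basis" for k
        by (rule curvature4_cong[OF N(1,2) *(1) EN[OF that] *(2) EN[OF that]]) (use *(3) in auto)
      then show "R X' Y' = R X Y"
        unfolding R_def by simp
    qed
    finally show "s = (\<Sum>k\<in>Basis. \<epsilon> k * R (E k) (E k))" .
  qed
  then show ?thesis
    by (simp add: R_def sum_distrib_left mult.assoc)
qed

end


section \<open>Products with an interval\<close>

definition product_chart :: "('p \<Rightarrow> 'e) \<Rightarrow> real \<times> 'p \<Rightarrow> real \<times> 'e"
  where "product_chart \<phi> = (\<lambda>(t, p). (t, \<phi> p))"

lemma product_chart_apply [simp]: "product_chart \<phi> (t, p) = (t, \<phi> p)"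
  by (simp add: product_chart_def)

lemma product_chart_image: "product_chart \<phi> ` (A \<times> B) = A \<times> \<phi> ` B"
  by (force simp: product_chart_def)

lemma product_chart_image_Int: "product_chart \<phi> ` (A \<times> B \<inter> A \<times> C) = A \<times> \<phi> ` (B \<inter> C)"
proof -
  have "A \<times> B \<inter> A \<times> C = A \<times> (B \<inter> C)"
    by auto
  then show ?thesis
    by (simp only: product_chart_image)
qed

lemma atlas_interval_product:
  "(V, \<psi>) \<in> atlas (interval_product I F) \<longleftrightarrow> (\<exists>U \<phi>. (U, \<phi>) \<in> atlas F \<and> V = I \<times> U \<and> \<psi> = product_chart \<phi>)"
  by (auto simp: interval_product_def product_chart_def image_iff split: prod.splits)

lemma mtop_interval_product: "mtop (interval_product I F) = prod_topology (top_of_set I) (mtop F)"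
  by (simp add: interval_product_def)

lemma points_interval_product: "points (interval_product I F) = I \<times> points F"
  by (simp add: mtop_interval_product)

section \<open>The product atlas\<close>

locale interval_manifold = F: smooth_atlas F for F :: "('p, 'e::euclidean_space) manifold" +
  fixes I :: "real set"
  assumes open_I: "open I"
begin

abbreviation "M \<equiv> interval_product I F"

lemma inv_product_chart:
  assumes "(U, \<phi>) \<in> atlas F" "t \<in> I" "p \<in> U"
  shows "inv_into (I \<times> U) (product_chart \<phi>) (t, \<phi> p) = (t, p)"
proof -
  have "inj_on (product_chart \<phi>) (I \<times> U)"
    using F.chart_inj[OF assms(1)] by (auto simp: inj_on_def)
  from inv_into_f_f[OF this, of "(t, p)"] show ?thesis
    using assms by simp
qed

lemma openin_Times: "openin (mtop F) B \<Longrightarrow> openin (mtop M) (I \<times> B)"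
  by (simp add: mtop_interval_product openin_prod_Times_iff)

sublocale M: smooth_atlas M
proof
  fix V \<psi> assume "(V, \<psi>) \<in> atlas M"
  then obtain U \<phi> where U: "(U, \<phi>) \<in> atlas F" and V: "V = I \<times> U" "\<psi> = product_chart \<phi>"
    by (auto simp: atlas_interval_product)
  show "openin (mtop M) V"
    unfolding V by (rule openin_Times[OF F.chart_openin[OF U]])
  show "open (\<psi> ` V)"
    unfolding V product_chart_image by (intro open_Times open_I F.chart_open_image[OF U])
  obtain \<phi>' where "homeomorphic_maps (subtopology (mtop F) U) (top_of_set (\<phi> ` U)) \<phi> \<phi>'"
    using F.chart_homeomorphic[OF U] by (auto simp: homeomorphic_map_maps)
  moreover have "homeomorphic_maps (top_of_set I) (top_of_set I) (\<lambda>t. t) (\<lambda>t. t)"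
    by (simp add: homeomorphic_maps_def)
  ultimately have "homeomorphic_maps (prod_topology (top_of_set I) (subtopology (mtop F) U))
      (prod_topology (top_of_set I) (top_of_set (\<phi> ` U))) (\<lambda>(t, p). (t, \<phi> p)) (\<lambda>(t, x). (t, \<phi>' x))"
    unfolding homeomorphic_maps_prod by blast
  moreover have "prod_topology (top_of_set I) (subtopology (mtop F) U) = subtopology (mtop M) V"
    by (simp add: V mtop_interval_product subtopology_Times subtopology_subtopology)
  moreover have "prod_topology (top_of_set I) (top_of_set (\<phi> ` U)) = top_of_set (\<psi> ` V)"
    unfolding V product_chart_image by (metis prod_topology_euclidean subtopology_Times)
  ultimately show "homeomorphic_map (subtopology (mtop M) V) (top_of_set (\<psi> ` V)) \<psi>"
    unfolding homeomorphic_map_maps V product_chart_def by auto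
  fix V' \<psi>' assume "(V', \<psi>') \<in> atlas M"
  then obtain U' \<phi>' where U': "(U', \<phi>') \<in> atlas F" and V': "V' = I \<times> U'" "\<psi>' = product_chart \<phi>'"
    by (auto simp: atlas_interval_product)
  have o: "open (\<phi> ` (U \<inter> U'))"
    by (rule F.open_chart_image[OF U F.chart_openin[OF U']])
  have image: "\<psi> ` (V \<inter> V') = I \<times> \<phi> ` (U \<inter> U')"
    unfolding V V' by (rule product_chart_image_Int)
  have oI: "open (I \<times> \<phi> ` (U \<inter> U'))"
    by (intro open_Times open_I o)
  have "smooth_on (I \<times> \<phi> ` (U \<inter> U')) ((\<phi>' \<circ> inv_into U \<phi>) \<circ> snd)"
    by (rule smooth_on_compose[OF oI o _ smooth_on_bounded_linear[OF oI bounded_linear_snd] F.chart_transition[OF U U']])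
       auto
  from smooth_on_Pair[OF oI smooth_on_bounded_linear[OF oI bounded_linear_fst] this]
  show "smooth_on (\<psi> ` (V \<inter> V')) (\<psi>' \<circ> inv_into V \<psi>)"
    unfolding image
    by (subst smooth_on_cong[OF oI]) (auto simp: V V' inv_product_chart[OF U] F.chart_inv[OF U])
next
  fix q assume "q \<in> points M"
  then have "fst q \<in> I" "snd q \<in> points F"
    by (auto simp: points_interval_product)
  then obtain U \<phi> where "(U, \<phi>) \<in> atlas F" "q \<in> I \<times> U"
    using F.chart_exists[of "snd q"] by (auto simp: mem_Times_iff)
  then show "\<exists>V \<psi>. (V, \<psi>) \<in> atlas M \<and> q \<in> V"
    by (intro exI[of _ "I \<times> U"] exI[of _ "product_chart \<phi>"]) (auto simp: atlas_interval_product)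
qed

lemma product_atlas: "(U, \<phi>) \<in> atlas F \<Longrightarrow> (I \<times> U, product_chart \<phi>) \<in> atlas M"
  by (auto simp: atlas_interval_product)

section \<open>Functions of time, functions of space and slices\<close>

lemma smooth_fst:
  assumes "openin (mtop M) N"
  shows "fst \<in> smooth_functions M N"
proof (rule M.smooth_functions_local[OF assms])
  fix q assume "q \<in> N"
  then have "q \<in> points M"
    using assms openin_subset by blast
  then obtain V \<psi> where V: "(V, \<psi>) \<in> atlas M" "q \<in> V"
    using M.chart_exists by blast
  have "(\<lambda>r. \<psi> r \<bullet> (1, 0)) = fst"
    using V(1) by (auto simp: atlas_interval_product product_chart_def fun_eq_iff)
  then show "\<exists>N. openin (mtop M) N \<and> q \<in> N \<and> fst \<in> smooth_functions M N"
    using M.smooth_functions_coordinate[OF V(1), of "(1, 0)"] M.chart_openin[OF V(1)] V(2) by auto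
qed

lemma subset_interval: "openin (mtop M) N \<Longrightarrow> q \<in> N \<Longrightarrow> fst q \<in> I"
  using openin_subset[of "mtop M" N] by (auto simp: points_interval_product)

lemma smooth_time_function:
  assumes "openin (mtop M) N" "smooth_on I a"
  shows "(\<lambda>q. a (fst q)) \<in> smooth_functions M N"
  by (rule M.smooth_functions_compose[OF assms(1) smooth_fst[OF assms(1)] open_I assms(2)])
     (use subset_interval[OF assms(1)] in auto)

lemma smooth_space_function:
  assumes "openin (mtop F) W" "h \<in> smooth_functions F W"
  shows "(\<lambda>q. h (snd q)) \<in> smooth_functions M (I \<times> W)"
proof (rule M.smooth_functionsI)
  fix q assume q: "q \<in> I \<times> W"
  then have "snd q \<in> points F"
    using openin_subset[OF assms(1)] by auto
  then obtain U \<phi> where U: "(U, \<phi>) \<in> atlas F" "snd q \<in> U"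
    using F.chart_exists by blast
  have o: "open (\<phi> ` (U \<inter> W))" "open (I \<times> \<phi> ` (U \<inter> W))"
    using F.open_chart_image[OF U(1) assms(1)] by (auto intro!: open_Times open_I)
  have image: "product_chart \<phi> ` (I \<times> U \<inter> I \<times> W) = I \<times> \<phi> ` (U \<inter> W)"
    by (rule product_chart_image_Int)
  have "smooth_on (I \<times> \<phi> ` (U \<inter> W)) ((h \<circ> inv_into U \<phi>) \<circ> snd)"
    by (rule smooth_on_compose[OF o(2,1) _ smooth_on_bounded_linear[OF o(2) bounded_linear_snd]
          F.smooth_functions_chart[OF assms(2) U(1)]]) auto
  then have "smooth_on (product_chart \<phi> ` (I \<times> U \<inter> I \<times> W)) ((\<lambda>q. h (snd q)) \<circ> inv_into (I \<times> U) (product_chart \<phi>))"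
    unfolding image
    by (subst smooth_on_cong[OF o(2)]) (auto simp: inv_product_chart[OF U(1)] F.chart_inv[OF U(1)])
  then show "\<exists>V \<psi> N. (V, \<psi>) \<in> atlas M \<and> q \<in> V \<and> openin (mtop M) N \<and> q \<in> N \<and>
      smooth_on (\<psi> ` (V \<inter> N)) ((\<lambda>q. h (snd q)) \<circ> inv_into V \<psi>)"
    using product_atlas[OF U(1)] q U(2) openin_Times[OF assms(1)] by (force simp: mem_Times_iff)
qed

lemma openin_slice:
  assumes "openin (mtop M) N" "t \<in> I"
  shows "openin (mtop F) {p. (t, p) \<in> N}"
proof -
  have "continuous_map (mtop F) (mtop M) (\<lambda>p. (t, p))"
    unfolding mtop_interval_product using assms(2) by (intro continuous_map_pairedI) auto
  from openin_continuous_map_preimage[OF this assms(1)]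
  have "openin (mtop F) {p \<in> points F. (t, p) \<in> N}" .
  moreover have "{p \<in> points F. (t, p) \<in> N} = {p. (t, p) \<in> N}"
    using openin_subset[OF assms(1)] by (auto simp: points_interval_product)
  ultimately show ?thesis
    by simp
qed

lemma smooth_slice:
  assumes N: "openin (mtop M) N" "t \<in> I" and h: "h \<in> smooth_functions M N"
  shows "(\<lambda>p. h (t, p)) \<in> smooth_functions F {p. (t, p) \<in> N}"
proof (rule F.smooth_functionsI)
  fix p assume p: "p \<in> {p. (t, p) \<in> N}"
  then have "p \<in> points F"
    using openin_subset[OF N(1)] by (auto simp: points_interval_product)
  then obtain U \<phi> where U: "(U, \<phi>) \<in> atlas F" "p \<in> U"
    using F.chart_exists by blast
  let ?W = "{p. (t, p) \<in> N}"
  have o: "open (\<phi> ` (U \<inter> ?W))"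
    by (rule F.open_chart_image[OF U(1) openin_slice[OF N]])
  have "smooth_on (\<phi> ` (U \<inter> ?W)) (\<lambda>x. (t, x))"
    by (intro smooth_on_Pair smooth_on_const smooth_on_bounded_linear o bounded_linear_ident)
  then have "smooth_on (\<phi> ` (U \<inter> ?W)) ((h \<circ> inv_into (I \<times> U) (product_chart \<phi>)) \<circ> (\<lambda>x. (t, x)))"
    by (rule smooth_on_compose[OF o M.open_chart_image[OF product_atlas[OF U(1)] N(1)] _ _
          M.smooth_functions_chart[OF h product_atlas[OF U(1)]], rotated])
       (use N(2) in \<open>force simp: image_iff\<close>)
  then have "smooth_on (\<phi> ` (U \<inter> ?W)) ((\<lambda>p. h (t, p)) \<circ> inv_into U \<phi>)"
    by (subst smooth_on_cong[OF o]) (use N(2) in \<open>auto simp: inv_product_chart[OF U(1)] F.chart_inv[OF U(1)]\<close>)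
  then show "\<exists>V \<psi> N. (V, \<psi>) \<in> atlas F \<and> p \<in> V \<and> openin (mtop F) N \<and> p \<in> N \<and>
      smooth_on (\<psi> ` (V \<inter> N)) ((\<lambda>p. h (t, p)) \<circ> inv_into V \<psi>)"
    using U p openin_slice[OF N] by blast
qed

lemma smooth_near_slice:
  assumes "t \<in> I" "smooth_near M (t, p) h"
  shows "smooth_near F p (\<lambda>p. h (t, p))"
proof -
  obtain N where N: "openin (mtop M) N" "(t, p) \<in> N" "h \<in> smooth_functions M N"
    using assms(2) by (auto simp: smooth_near_def)
  show ?thesis
    using smooth_nearI[OF smooth_slice[OF N(1) assms(1) N(3)] openin_slice[OF N(1) assms(1)]] N(2) by simp
qed

text \<open>The equivalence makes the default value 0 of a tangent vector of \<open>M\<close> on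
  \<open>h \<circ> snd\<close> match that of its push-forward to \<open>F\<close> on
  \<open>h\<close>. The direction from \<open>M\<close> to \<open>F\<close> restricts to a
  slice.\<close>

lemma smooth_near_space:
  assumes "t \<in> I"
  shows "smooth_near M (t, p) (h \<circ> snd) \<longleftrightarrow> smooth_near F p h"
proof
  assume "smooth_near M (t, p) (h \<circ> snd)"
  from smooth_near_slice[OF assms this] show "smooth_near F p h"
    by simp
next
  assume "smooth_near F p h"
  then obtain W where W: "openin (mtop F) W" "p \<in> W" "h \<in> smooth_functions F W"
    by (auto simp: smooth_near_def)
  show "smooth_near M (t, p) (h \<circ> snd)"
    using smooth_nearI[OF smooth_space_function[OF W(1,3)] openin_Times[OF W(1)]] W(2) assms
    by (simp add: o_def)
qed

section \<open>Tangent vectors of the product\<close>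

lemma chart_vector_fst:
  assumes "(U, \<phi>) \<in> atlas F" "t \<in> I" "p \<in> U"
  shows "chart_vector M (I \<times> U) (product_chart \<phi>) (s, u) (t, p) fst = s"
proof -
  have "(\<lambda>r. product_chart \<phi> r \<bullet> (1, 0)) = fst"
    by (auto simp: product_chart_def)
  then show ?thesis
    using M.chart_vector_coordinate[OF product_atlas[OF assms(1)], of "(t, p)" "(s, u)" "(1, 0)"] assms by simp
qed

lemma chart_vector_snd:
  assumes U: "(U, \<phi>) \<in> atlas F" "p \<in> U" and t: "t \<in> I"
  shows "chart_vector M (I \<times> U) (product_chart \<phi>) (s, u) (t, p) (h \<circ> snd) = chart_vector F U \<phi> u p h"
proof (cases "smooth_near F p h")
  case True
  let ?D = "frechet_derivative (h \<circ> inv_into U \<phi>) (at (\<phi> p))"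
  have "(snd has_derivative snd) (at (t, \<phi> p))"
    by (rule bounded_linear_imp_has_derivative[OF bounded_linear_snd])
  from diff_chain_at[OF this, of "h \<circ> inv_into U \<phi>" ?D] F.smooth_near_has_derivative[OF True U]
  have "((h \<circ> inv_into U \<phi>) \<circ> snd has_derivative ?D \<circ> snd) (at (t, \<phi> p))"
    by simp
  then have "((h \<circ> snd) \<circ> inv_into (I \<times> U) (product_chart \<phi>) has_derivative ?D \<circ> snd) (at (product_chart \<phi> (t, p)))"
    unfolding product_chart_apply
    by (rule has_derivative_transform_within_open[where s="I \<times> \<phi> ` U"])
       (use U t open_I F.chart_open_image[OF U(1)] in \<open>auto simp: inv_product_chart F.chart_inv intro!: open_Times\<close>)
  from M.chart_vector_eqI[OF product_atlas[OF U(1)] _ _ this] show ?thesis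
    using True U t by (simp add: smooth_near_space chart_vector_def)
next
  case False
  then show ?thesis
    using t by (simp add: smooth_near_space chart_vector_def)
qed

lemma tangent_M_chart:
  assumes "v \<in> tangent_space M (t, p)" "(U, \<phi>) \<in> atlas F" "p \<in> U"
  obtains s u where "v = chart_vector M (I \<times> U) (product_chart \<phi>) (s, u) (t, p)"
proof -
  have "t \<in> I"
    using M.tangent_point[OF assms(1)] by (simp add: points_interval_product)
  then show ?thesis
    using M.tangent_chart_vectorE[OF assms(1) product_atlas[OF assms(2)]] assms(3) that
    by (metis SigmaI surj_pair)
qed

lemma tangent_M_snd:
  assumes "v \<in> tangent_space M (t, p)"
  shows "(\<lambda>h. v (h \<circ> snd)) \<in> tangent_space F p"
proof -
  have tp: "t \<in> I" "p \<in> points F"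
    using M.tangent_point[OF assms] by (auto simp: points_interval_product)
  obtain U \<phi> where U: "(U, \<phi>) \<in> atlas F" "p \<in> U"
    using F.chart_exists[OF tp(2)] by blast
  obtain s u where v: "v = chart_vector M (I \<times> U) (product_chart \<phi>) (s, u) (t, p)"
    using tangent_M_chart[OF assms U] .
  have "(\<lambda>h. v (h \<circ> snd)) = chart_vector F U \<phi> u p"
    unfolding v chart_vector_snd[OF U tp(1)] by simp
  then show ?thesis
    using F.chart_vector_tangent[OF U] by simp
qed

text \<open>The coordinates of a product chart are \<open>fst\<close> and functions factoring
  through \<open>snd\<close>, so a tangent vector is determined by these two kinds of test
  functions. Brackets of lifted fields are computed with this criterion.\<close>

lemma tangent_M_eqI:
  assumes "v \<in> tangent_space M (t, p)" "w \<in> tangent_space M (t, p)"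
    and "v fst = w fst" "(\<lambda>h. v (h \<circ> snd)) = (\<lambda>h. w (h \<circ> snd))"
  shows "v = w"
proof -
  have tp: "t \<in> I" "p \<in> points F"
    using M.tangent_point[OF assms(1)] by (auto simp: points_interval_product)
  obtain U \<phi> where U: "(U, \<phi>) \<in> atlas F" "p \<in> U"
    using F.chart_exists[OF tp(2)] by blast
  obtain s u where v: "v = chart_vector M (I \<times> U) (product_chart \<phi>) (s, u) (t, p)"
    using tangent_M_chart[OF assms(1) U] .
  obtain s' u' where w: "w = chart_vector M (I \<times> U) (product_chart \<phi>) (s', u') (t, p)"
    using tangent_M_chart[OF assms(2) U] .
  have "s = s'"
    using assms(3) by (simp add: v w chart_vector_fst[OF U(1) tp(1) U(2)])
  moreover have eq: "chart_vector F U \<phi> u p h = chart_vector F U \<phi> u' p h" for h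
    using fun_cong[OF assms(4), of h] by (simp add: v w chart_vector_snd[OF U tp(1)])
  have "u = u'"
  proof (rule euclidean_eqI)
    fix b :: 'e assume "b \<in> Basis"
    show "u \<bullet> b = u' \<bullet> b"
      using eq[of "\<lambda>q. \<phi> q \<bullet> b"] by (simp add: F.chart_vector_coordinate[OF U])
  qed
  ultimately show ?thesis
    by (simp add: v w)
qed

section \<open>The time field and horizontal lifts\<close>

abbreviation T :: "(real \<times> 'p) vector_field" where "T \<equiv> time_field I F"

text \<open>Every product chart has the same time coordinate, so the time derivative is the
  coordinate field along \<open>(1, 0)\<close> whichever chart of \<open>F\<close> is used;
  smoothness of \<open>T\<close> follows.\<close>

lemma T_chart_vector:
  assumes U: "(U, \<phi>) \<in> atlas F" "p \<in> U" and t: "t \<in> I"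
  shows "T (t, p) = chart_vector M (I \<times> U) (product_chart \<phi>) (1, 0) (t, p)"
proof
  fix h
  show "T (t, p) h = chart_vector M (I \<times> U) (product_chart \<phi>) (1, 0) (t, p) h"
  proof (cases "smooth_near M (t, p) h")
    case True
    let ?k = "h \<circ> inv_into (I \<times> U) (product_chart \<phi>)"
    let ?D = "frechet_derivative ?k (at (t, \<phi> p))"
    have "(?k has_derivative ?D) (at (t, \<phi> p))"
      using M.smooth_near_has_derivative[OF True product_atlas[OF U(1)]] U t by simp
    moreover have "((\<lambda>s. (s, \<phi> p)) has_derivative (\<lambda>s. (s, 0))) (at t)"
      by (auto intro!: derivative_eq_intros)
    ultimately have "(?k \<circ> (\<lambda>s. (s, \<phi> p)) has_derivative ?D \<circ> (\<lambda>s. (s, 0))) (at t)"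
      by (intro diff_chain_at) auto
    then have d: "((\<lambda>s. h (s, p)) has_derivative ?D \<circ> (\<lambda>s. (s, 0))) (at t)"
      by (rule has_derivative_transform_within_open[OF _ open_I t])
         (use U in \<open>auto simp: inv_product_chart\<close>)
    have "linear ?D"
      using \<open>(?k has_derivative ?D) (at (t, \<phi> p))\<close> by (rule has_derivative_linear)
    then have "?D \<circ> (\<lambda>s. (s, 0)) = (*) (?D (1, 0))"
    proof (intro ext)
      fix s
      show "(?D \<circ> (\<lambda>s. (s, 0))) s = ?D (1, 0) * s"
        using linear_scale[OF \<open>linear ?D\<close>, of s "(1, 0)"] by simp
    qed
    then have "DERIV (\<lambda>s. h (s, p)) t :> ?D (1, 0)"
      using d by (simp only: has_field_derivative_def)
    then show ?thesis
      using True by (simp add: time_field_def chart_vector_def DERIV_imp_deriv)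
  next
    case False
    then show ?thesis
      by (simp add: time_field_def chart_vector_def)
  qed
qed

lemma T_field: "openin (mtop M) N \<Longrightarrow> T \<in> vector_fields M N"
proof (rule M.vector_fields_local)
  fix q assume N: "openin (mtop M) N" and "q \<in> N"
  then have q: "fst q \<in> I" "snd q \<in> points F"
    using openin_subset[OF N] by (auto simp: points_interval_product)
  then obtain U \<phi> where U: "(U, \<phi>) \<in> atlas F" "snd q \<in> U"
    using F.chart_exists by blast
  have o: "openin (mtop M) (I \<times> U)"
    by (rule openin_Times[OF F.chart_openin[OF U(1)]])
  have "T r = chart_vector M (I \<times> U) (product_chart \<phi>) (1, 0) r" if "r \<in> I \<times> U" for r
    using that T_chart_vector[OF U(1)] by (cases r) auto
  from iffD2[OF M.vector_fields_cong[OF o this] M.chart_vector_field[OF product_atlas[OF U(1)]]]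
  have "T \<in> vector_fields M (I \<times> U)" .
  then show "\<exists>N. openin (mtop M) N \<and> q \<in> N \<and> T \<in> vector_fields M N"
    using o U q by (metis mem_Times_iff)
qed

lemma T_fst: "t \<in> I \<Longrightarrow> p \<in> points F \<Longrightarrow> T (t, p) fst = 1"
  using F.chart_exists[of p] T_chart_vector chart_vector_fst by metis

lemma T_snd: "T (t, p) (h \<circ> snd) = 0"
  by (simp add: time_field_def)

text \<open>The lift differentiates along the slice of constant time. The guard cannot be left to
  \<open>X\<close>: a function that is not smooth near \<open>(t, p)\<close> may have a smooth
  slice, and a tangent vector has to vanish on it.\<close>

definition lift :: "'p vector_field \<Rightarrow> (real \<times> 'p) vector_field"
  where "lift X = (\<lambda>(t, p) h. if smooth_near M (t, p) h then X p (\<lambda>q. h (t, q)) else 0)"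

lemma lift_chart_vector:
  assumes U: "(U, \<phi>) \<in> atlas F" "p \<in> U" and t: "t \<in> I" and X: "X p = chart_vector F U \<phi> u p"
  shows "lift X (t, p) = chart_vector M (I \<times> U) (product_chart \<phi>) (0, u) (t, p)"
proof
  fix h
  show "lift X (t, p) h = chart_vector M (I \<times> U) (product_chart \<phi>) (0, u) (t, p) h"
  proof (cases "smooth_near M (t, p) h")
    case True
    let ?k = "h \<circ> inv_into (I \<times> U) (product_chart \<phi>)"
    let ?D = "frechet_derivative ?k (at (t, \<phi> p))"
    have "(?k has_derivative ?D) (at (t, \<phi> p))"
      using M.smooth_near_has_derivative[OF True product_atlas[OF U(1)]] U t by simp
    moreover have "((\<lambda>x. (t, x)) has_derivative (\<lambda>x. (0, x))) (at (\<phi> p))"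
      by (auto intro!: derivative_eq_intros)
    ultimately have "(?k \<circ> (\<lambda>x. (t, x)) has_derivative ?D \<circ> (\<lambda>x. (0, x))) (at (\<phi> p))"
      by (intro diff_chain_at) auto
    then have "((\<lambda>q. h (t, q)) \<circ> inv_into U \<phi> has_derivative ?D \<circ> (\<lambda>x. (0, x))) (at (\<phi> p))"
      by (rule has_derivative_transform_within_open[OF _ F.chart_open_image[OF U(1)]])
         (use U t in \<open>auto simp: inv_product_chart F.chart_inv\<close>)
    from F.chart_vector_eqI[OF U smooth_near_slice[OF t True] this]
    show ?thesis
      using True by (simp add: lift_def X chart_vector_def)
  next
    case False
    then show ?thesis
      by (simp add: lift_def chart_vector_def)
  qed
qed

lemma lift_tangent:
  assumes "X p \<in> tangent_space F p" "t \<in> I"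
  shows "lift X (t, p) \<in> tangent_space M (t, p)"
proof -
  obtain U \<phi> u where U: "(U, \<phi>) \<in> atlas F" "p \<in> U" and u: "X p = chart_vector F U \<phi> u p"
    using assms(1) unfolding tangent_space_chart_vector by blast
  show ?thesis
    unfolding lift_chart_vector[where X=X and p=p, OF U assms(2) u]
    using M.chart_vector_tangent[OF product_atlas[OF U(1)]] U assms(2) by blast
qed

lemma lift_fst:
  assumes "X p \<in> tangent_space F p" "t \<in> I"
  shows "lift X (t, p) fst = 0"
proof -
  obtain U \<phi> u where U: "(U, \<phi>) \<in> atlas F" "p \<in> U" and u: "X p = chart_vector F U \<phi> u p"
    using assms(1) unfolding tangent_space_chart_vector by blast
  show ?thesis
    unfolding lift_chart_vector[where X=X and p=p, OF U assms(2) u] by (rule chart_vector_fst[OF U(1) assms(2) U(2)])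
qed

lemma lift_snd:
  assumes "X p \<in> tangent_space F p" "t \<in> I"
  shows "lift X (t, p) (h \<circ> snd) = X p h"
  using F.tangent_not_smooth[OF assms(1), of h] by (simp add: lift_def smooth_near_space[OF assms(2)])

text \<open>Near each point the lift is the combination of the coordinate fields along
  \<open>(0, b)\<close> whose coefficients are those of \<open>X\<close> on \<open>F\<close>, read
  as functions on the product, and these are smooth.\<close>

lemma lift_field:
  assumes W: "openin (mtop F) W" and X: "X \<in> vector_fields F W"
  shows "lift X \<in> vector_fields M (I \<times> W)"
proof (rule M.vector_fields_local[OF openin_Times[OF W]])
  fix q assume q: "q \<in> I \<times> W"
  then have "snd q \<in> points F"
    using openin_subset[OF W] by auto
  then obtain U \<phi> where U: "(U, \<phi>) \<in> atlas F" "snd q \<in> U"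
    using F.chart_exists by blast
  have oW: "openin (mtop F) (W \<inter> U)"
    using W F.chart_openin[OF U(1)] by blast
  note o = openin_Times[OF oW]
  let ?c = "\<lambda>b p. X p (\<lambda>q. \<phi> q \<bullet> b)"
  have c: "?c b \<in> smooth_functions F (W \<inter> U)" for b
    by (rule vector_fields_smooth[OF X oW _ smooth_functions_subset[OF F.smooth_functions_coordinate[OF U(1)]]]) auto
  let ?Y = "\<lambda>r h. \<Sum>b\<in>Basis. ?c b (snd r) * chart_vector M (I \<times> U) (product_chart \<phi>) (0, b) r h"
  have Y: "?Y \<in> vector_fields M (I \<times> (W \<inter> U))"
    by (rule M.vector_fields_sum[OF o vector_fields_subset[OF M.chart_vector_field[OF product_atlas[OF U(1)]]]
          smooth_space_function[OF oW c]]) auto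
  have "lift X r = ?Y r" if r_in: "r \<in> I \<times> (W \<inter> U)" for r
  proof -
    obtain t p where r: "r = (t, p)" "t \<in> I" "p \<in> W" "p \<in> U"
      using r_in by auto
    obtain u where u: "X p = chart_vector F U \<phi> u p"
      using F.tangent_chart_vectorE[OF vector_fields_tangent[OF X r(3)] U(1) r(4)] .
    have lin: "linear (\<lambda>u. chart_vector M (I \<times> U) (product_chart \<phi>) (0, u) (t, p) h)" for h
    proof -
      have "linear (\<lambda>u::'e. (0::real, u))"
        by (auto intro: linearI)
      from linear_compose[OF this M.chart_vector_linear[OF product_atlas[OF U(1)], of "(t, p)" h]] r
      show ?thesis
        by (simp add: o_def)
    qed
    have "chart_vector M (I \<times> U) (product_chart \<phi>) (0, u) (t, p) h =
        (\<Sum>b\<in>Basis. (u \<bullet> b) * chart_vector M (I \<times> U) (product_chart \<phi>) (0, b) (t, p) h)" for h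
    proof -
      interpret linear "\<lambda>u. chart_vector M (I \<times> U) (product_chart \<phi>) (0, u) (t, p) h"
        by (rule lin)
      have "chart_vector M (I \<times> U) (product_chart \<phi>) (0, \<Sum>b\<in>Basis. (u \<bullet> b) *\<^sub>R b) (t, p) h =
          (\<Sum>b\<in>Basis. (u \<bullet> b) * chart_vector M (I \<times> U) (product_chart \<phi>) (0, b) (t, p) h)"
        by (simp only: sum scaleR real_scaleR_def)
      then show ?thesis
        by (simp only: euclidean_representation)
    qed
    then show ?thesis
      unfolding r(1) lift_chart_vector[where X=X and p=p, OF U(1) r(4,2) u]
      by (simp add: u F.chart_vector_coordinate[OF U(1) r(4)] fun_eq_iff)
  qed
  from iffD2[OF M.vector_fields_cong[OF o this] Y]
  have "lift X \<in> vector_fields M (I \<times> (W \<inter> U))" .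
  then show "\<exists>N. openin (mtop M) N \<and> q \<in> N \<and> lift X \<in> vector_fields M N"
    using o U(2) q by (metis IntI mem_Times_iff)
qed

lemma tangent_M_const:
  assumes "v \<in> tangent_space M q" "openin (mtop M) N" "q \<in> N" "\<And>r. r \<in> N \<Longrightarrow> h r = c"
  shows "v h = 0"
  using M.tangent_cong[OF assms(1-3), of h "\<lambda>r. c"] assms(4) M.tangent_const[OF assms(1)] by simp

lemma time_derivative:
  assumes v: "v \<in> tangent_space M q" and a: "smooth_on I a"
  shows "v (\<lambda>r. a (fst r)) = deriv a (fst q) * v fst"
proof -
  have q: "q \<in> points M"
    by (rule M.tangent_point[OF v])
  then have t: "fst q \<in> I"
    by (auto simp: points_interval_product)
  have "a differentiable (at (fst q))"
    using smooth_on_differentiable[OF a t] .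
  then have "(a has_real_derivative deriv a (fst q)) (at (fst q))"
    by (simp add: DERIV_deriv_iff_real_differentiable)
  then show ?thesis
    by (rule M.tangent_chain[OF v smooth_nearI[OF smooth_fst[OF openin_topspace] openin_topspace q]
          smooth_nearI[OF smooth_time_function[OF openin_topspace a] openin_topspace q]])
qed

end


section \<open>Levi-Civita connection of a warped product\<close>

lemma (in pseudo_riemannian) metric_sum_right:
  assumes "\<And>i. i \<in> A \<Longrightarrow> v i \<in> tangent_space M p" "w \<in> tangent_space M p"
  shows "g p w (\<lambda>h. \<Sum>i\<in>A. a i * v i h) = (\<Sum>i\<in>A. a i * g p w (v i))"
proof -
  have "g p w (\<lambda>h. \<Sum>i\<in>A. a i * v i h) = g p (\<lambda>h. \<Sum>i\<in>A. a i * v i h) w"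
    by (rule metric_sym[OF assms(2) tangent_sum[OF tangent_point[OF assms(2)] assms(1)]])
  also have "\<dots> = (\<Sum>i\<in>A. a i * g p (v i) w)"
    by (rule metric_sum_left[OF assms])
  also have "\<dots> = (\<Sum>i\<in>A. a i * g p w (v i))"
    by (intro sum.cong refl) (simp add: metric_sym[OF assms(1) assms(2)])
  finally show ?thesis .
qed

section \<open>The Koszul formula\<close>

locale levi_civita = pseudo_riemannian M g
  for M :: "('p, 'e::euclidean_space) manifold" and g :: "'p metric" +
  fixes nab :: "'p connection"
  assumes levi_civita: "levi_civita_connection M g nab"
begin

lemma torsion_free:
  assumes "openin (mtop M) W" "X \<in> vector_fields M W" "Y \<in> vector_fields M W" "p \<in> W"
  shows "lie_bracket M X Y p = (\<lambda>h. nab X Y p h - nab Y X p h)"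
  using levi_civita[unfolded levi_civita_connection_def, THEN conjunct2, THEN spec, THEN mp, OF assms(1),
      THEN bspec, OF assms(2), THEN bspec, OF assms(3), THEN bspec, OF assms(4), THEN conjunct1]
  by (simp add: vf_diff_def)

lemma compatible:
  assumes "openin (mtop M) W" "X \<in> vector_fields M W" "Y \<in> vector_fields M W" "Z \<in> vector_fields M W" "p \<in> W"
  shows "X p (\<lambda>q. g q (Y q) (Z q)) = g p (nab X Y p) (Z p) + g p (Y p) (nab X Z p)"
  by (rule levi_civita[unfolded levi_civita_connection_def, THEN conjunct2, THEN spec, THEN mp, OF assms(1),
      THEN bspec, OF assms(2), THEN bspec, OF assms(3), THEN bspec, OF assms(5), THEN conjunct2,
      THEN bspec, OF assms(4)])

sublocale metric_affine M g nab
proof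
  show aff: "affine_connection M nab"
    using levi_civita unfolding levi_civita_connection_def by (rule conjunct1)
  fix W X Y assume W: "openin (mtop M) W" and X: "X \<in> vector_fields M W" and Y: "Y \<in> vector_fields M W"
  have f: "nab A B \<in> vector_fields M W" if "A \<in> vector_fields M W" "B \<in> vector_fields M W" for A B
    by (rule aff[unfolded affine_connection_def, THEN spec, THEN mp, OF W, THEN bspec, OF that(1),
        THEN bspec, OF that(2), THEN conjunct2, THEN conjunct1])
  have "lie_bracket M X Y q = (nab X Y -\<^sub>v nab Y X) q" if "q \<in> W" for q
    using torsion_free[OF W X Y that] by (simp add: vf_diff_def)
  from iffD2[OF vector_fields_cong[OF W this] vector_fields_diff[OF f[OF X Y] f[OF Y X]]]
  show "lie_bracket M X Y \<in> vector_fields M W" .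
qed

text \<open>Metric compatibility is used in three orders and the brackets are expressed by
  torsion-freeness; all but one term cancels. The connection is thereby known from metric and
  brackets alone, which is how that of the warped product is identified.\<close>

lemma koszul:
  assumes W: "openin (mtop M) W" and X: "X \<in> vector_fields M W" and Y: "Y \<in> vector_fields M W"
    and Z: "Z \<in> vector_fields M W" and p: "p \<in> W"
  shows "2 * g p (nab X Y p) (Z p) =
    X p (\<lambda>q. g q (Y q) (Z q)) + Y p (\<lambda>q. g q (X q) (Z q)) - Z p (\<lambda>q. g q (X q) (Y q))
    + g p (lie_bracket M X Y p) (Z p) - g p (lie_bracket M X Z p) (Y p) - g p (lie_bracket M Y Z p) (X p)"
proof -
  have t: "A p \<in> tangent_space M p" "nab A B p \<in> tangent_space M p"
    if "A \<in> vector_fields M W" "B \<in> vector_fields M W" for A B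
    using vector_fields_tangent[OF that(1) p] vector_fields_tangent[OF nab_field[OF W that] p] .
  have b: "g p (lie_bracket M A B p) (C p) = g p (nab A B p) (C p) - g p (nab B A p) (C p)"
    if "A \<in> vector_fields M W" "B \<in> vector_fields M W" "C \<in> vector_fields M W" for A B C
    unfolding torsion_free[OF W that(1,2) p]
    by (rule metric_diff_left[OF t(2)[OF that(1,2)] t(2)[OF that(2,1)] t(1)[OF that(3,3)]])
  have s: "g p (A p) (nab B C p) = g p (nab B C p) (A p)"
    if "A \<in> vector_fields M W" "B \<in> vector_fields M W" "C \<in> vector_fields M W" for A B C
    by (rule metric_sym[OF t(1)[OF that(1,1)] t(2)[OF that(2,3)]])
  show ?thesis
    unfolding compatible[OF W X Y Z p] compatible[OF W Y X Z p] compatible[OF W Z X Y p]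
      b[OF X Y Z] b[OF X Z Y] b[OF Y Z X] s[OF Y X Z] s[OF X Y Z] s[OF X Z Y]
    by simp
qed

end

section \<open>The warped metric\<close>

locale warped_product = interval_manifold F I + F: pseudo_riemannian F gF
  for F :: "('p, 'e::euclidean_space) manifold" and gF :: "'p metric" and I :: "real set" +
  fixes f :: "real \<Rightarrow> real"
  assumes smooth_f: "smooth_on I f" and pos_f: "t \<in> I \<Longrightarrow> f t > 0"
begin

abbreviation "G \<equiv> warped_metric f gF"

lemma G_apply:
  "G (t, p) v w = - (v fst * w fst) + (f t)\<^sup>2 * gF p (\<lambda>h. v (h \<circ> snd)) (\<lambda>h. w (h \<circ> snd))"
  by (simp add: warped_metric_def)

lemma T_tangent: "t \<in> I \<Longrightarrow> p \<in> points F \<Longrightarrow> T (t, p) \<in> tangent_space M (t, p)"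
  using vector_fields_tangent[OF T_field[OF openin_topspace]] by (simp add: points_interval_product)

lemma G_tangent_T:
  assumes "v \<in> tangent_space M (t, p)"
  shows "G (t, p) v (T (t, p)) = - v fst"
proof -
  have "t \<in> I" "p \<in> points F"
    using M.tangent_point[OF assms] by (auto simp: points_interval_product)
  moreover have "gF p (\<lambda>h. v (h \<circ> snd)) (\<lambda>h. 0) = 0"
    using F.metric_sym[OF tangent_M_snd[OF assms] F.tangent_zero[OF \<open>p \<in> points F\<close>]]
      F.metric_zero_left[OF tangent_M_snd[OF assms]] by simp
  ultimately show ?thesis
    by (simp add: G_apply T_snd T_fst)
qed

lemma G_tangent_lift:
  assumes "v \<in> tangent_space M (t, p)" "X p \<in> tangent_space F p"
  shows "G (t, p) v (lift X (t, p)) = (f t)\<^sup>2 * gF p (\<lambda>h. v (h \<circ> snd)) (X p)"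
proof -
  have "t \<in> I"
    using M.tangent_point[OF assms(1)] by (auto simp: points_interval_product)
  then show ?thesis
    by (simp add: G_apply lift_fst[where X=X, OF assms(2)] lift_snd[where X=X, OF assms(2)])
qed

lemma metric_M: "pseudo_riemannian_metric M G"
  unfolding pseudo_riemannian_metric_def
proof (intro conjI ballI allI impI)
  fix q v w assume q: "q \<in> points M" and v: "v \<in> tangent_space M q" and w: "w \<in> tangent_space M q"
  show "G q v w = G q w v"
    using v w F.metric_sym[OF tangent_M_snd tangent_M_snd, of v "fst q" "snd q" w "fst q"]
    by (cases q) (simp add: G_apply)
next
  fix q v v' w a b
  assume v: "v \<in> tangent_space M q" "v' \<in> tangent_space M q" and w: "w \<in> tangent_space M q"
  obtain t p where q: "q = (t, p)"
    by fastforce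
  note s = v[unfolded q, THEN tangent_M_snd] w[unfolded q, THEN tangent_M_snd]
  show "G q (\<lambda>h. a * v h + b * v' h) w = a * G q v w + b * G q v' w"
    using F.metric_lincomb_left[OF s] by (simp add: q G_apply algebra_simps)
next
  fix q v assume q: "q \<in> points M" and v: "v \<in> tangent_space M q" and null: "\<forall>w\<in>tangent_space M q. G q v w = 0"
  obtain t p where tp: "q = (t, p)"
    by fastforce
  note v = v[unfolded tp]
  have I: "t \<in> I" "p \<in> points F"
    using q by (auto simp: tp points_interval_product)
  show "v = (\<lambda>h. 0)"
  proof (rule tangent_M_eqI[OF v M.tangent_zero])
    show "(t, p) \<in> points M"
      using q by (simp add: tp)
    show "v fst = 0"
      using null T_tangent[OF I] G_tangent_T[OF v] by (simp add: tp)
    \<comment> \<open>The constant function \<open>\<lambda>_. y\<close> serves as a field on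
      \<open>F\<close> with value \<open>y\<close> at \<open>p\<close>: the value of
      \<open>lift\<close> at \<open>(t, p)\<close> depends on no other point.\<close>
    have "gF p (\<lambda>h. v (h \<circ> snd)) y = 0" if y: "y \<in> tangent_space F p" for y
      using null lift_tangent[where X="\<lambda>_. y", OF y I(1)] G_tangent_lift[where X="\<lambda>_. y", OF v y] pos_f[OF I(1)]
      by (simp add: tp)
    then show "(\<lambda>h. v (h \<circ> snd)) = (\<lambda>h. 0)"
      by (rule F.metric_nondegenerate[OF tangent_M_snd[OF v]])
  qed
next
  fix N X Y assume N: "openin (mtop M) N" and X: "X \<in> vector_fields M N" and Y: "Y \<in> vector_fields M N"
  show "(\<lambda>q. G q (X q) (Y q)) \<in> smooth_functions M N"
  proof (rule M.smooth_functions_local[OF N])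
    fix q assume q: "q \<in> N"
    then have "q \<in> points M"
      using openin_subset[OF N] by blast
    then have q_in: "fst q \<in> I" "snd q \<in> points F"
      by (auto simp: points_interval_product)
    then obtain U \<phi> where U: "(U, \<phi>) \<in> atlas F" "snd q \<in> U"
      using F.chart_exists by blast
    note oU = F.chart_openin[OF U(1)]
    define N' where "N' = N \<inter> (I \<times> U)"
    have N': "openin (mtop M) N'" "N' \<subseteq> N" "N' \<subseteq> I \<times> U" "q \<in> N'"
      using N openin_Times[OF oU] q q_in U(2) by (auto simp: N'_def mem_Times_iff)
    let ?x = "\<lambda>b p. \<phi> p \<bullet> b"
    \<comment> \<open>The push-forward of a field on \<open>M\<close> depends on time and is not a
      field on \<open>F\<close>. Expanding it in coordinate fields leaves \<open>gF\<close> only on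
      fields of \<open>F\<close>, so \<open>?k\<close> is built from functions already known to be
      smooth.\<close>
    let ?k = "\<lambda>r. - 1 * (X r fst * Y r fst) + (f (fst r))\<^sup>2 * (\<Sum>b\<in>Basis. \<Sum>c\<in>Basis.
        X r (?x b \<circ> snd) * Y r (?x c \<circ> snd) * gF (snd r) (chart_vector F U \<phi> b (snd r)) (chart_vector F U \<phi> c (snd r)))"
    have x: "?x b \<circ> snd \<in> smooth_functions M N'" for b
      using smooth_functions_subset[OF smooth_space_function[OF oU F.smooth_functions_coordinate[OF U(1)]] N'(3)]
      by (simp add: o_def)
    have XY: "(\<lambda>r. X r h) \<in> smooth_functions M N'" "(\<lambda>r. Y r h) \<in> smooth_functions M N'"
      if "h \<in> smooth_functions M N'" for h
      using vector_fields_smooth[OF X N'(1,2) that] vector_fields_smooth[OF Y N'(1,2) that] .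
    have g: "(\<lambda>r. gF (snd r) (chart_vector F U \<phi> b (snd r)) (chart_vector F U \<phi> c (snd r))) \<in> smooth_functions M N'" for b c
      by (rule smooth_functions_subset[OF smooth_space_function[OF oU F.metric_smooth[OF oU
              F.chart_vector_field[OF U(1)] F.chart_vector_field[OF U(1)]]] N'(3)])
    have k: "?k \<in> smooth_functions M N'"
      unfolding power2_eq_square
      by (intro M.smooth_functions_add M.smooth_functions_mult M.smooth_functions_sum N'(1) XY x g
          smooth_fst smooth_time_function[OF N'(1) smooth_f] M.smooth_functions_const)
    have eq: "G r (X r) (Y r) = ?k r" if r: "r \<in> N'" for r
    proof -
      obtain t p where tp: "r = (t, p)" "t \<in> I" "p \<in> U"
        using r N'(3) by auto
      have dX: "(\<lambda>h. X r (h \<circ> snd)) \<in> tangent_space F p" "(\<lambda>h. Y r (h \<circ> snd)) \<in> tangent_space F p"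
        using vector_fields_tangent[OF X, of r] vector_fields_tangent[OF Y, of r] r N'(2)
        by (auto simp: tp intro: tangent_M_snd)
      note c = F.chart_vector_tangent[OF U(1) tp(3)]
      have e: "(\<lambda>h. X r (h \<circ> snd)) = (\<lambda>h. \<Sum>b\<in>Basis. X r (?x b \<circ> snd) * chart_vector F U \<phi> b p h)"
        "(\<lambda>h. Y r (h \<circ> snd)) = (\<lambda>h. \<Sum>b\<in>Basis. Y r (?x b \<circ> snd) * chart_vector F U \<phi> b p h)"
        by (rule ext, rule F.tangent_expand[OF dX(1) U(1) tp(3)])
           (rule ext, rule F.tangent_expand[OF dX(2) U(1) tp(3)])
      have "gF p (\<lambda>h. X r (h \<circ> snd)) (\<lambda>h. Y r (h \<circ> snd)) =
          (\<Sum>b\<in>Basis. X r (?x b \<circ> snd) * gF p (chart_vector F U \<phi> b p) (\<lambda>h. Y r (h \<circ> snd)))"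
        by (subst e(1)) (rule F.metric_sum_left[OF c dX(2)])
      also have "\<dots> = (\<Sum>b\<in>Basis. X r (?x b \<circ> snd) * (\<Sum>c\<in>Basis. Y r (?x c \<circ> snd) *
          gF p (chart_vector F U \<phi> b p) (chart_vector F U \<phi> c p)))"
        by (subst e(2)) (simp only: F.metric_sum_right[OF c c])
      finally show ?thesis
        by (simp add: tp G_apply sum_distrib_left mult.assoc)
    qed
    from iffD2[OF M.smooth_functions_cong[OF N'(1) eq] k]
    have "(\<lambda>r. G r (X r) (Y r)) \<in> smooth_functions M N'" .
    then show "\<exists>N. openin (mtop M) N \<and> q \<in> N \<and> (\<lambda>r. G r (X r) (Y r)) \<in> smooth_functions M N"
      using N'(1,4) by blast
  qed
qed

sublocale M: pseudo_riemannian M G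
  by unfold_locales (rule metric_M)

lemma has_derivative_f: "t \<in> I \<Longrightarrow> (f has_real_derivative deriv f t) (at t)"
  using smooth_on_differentiable[OF smooth_f] by (simp add: DERIV_deriv_iff_real_differentiable)

lemma deriv_f_square: "t \<in> I \<Longrightarrow> deriv (\<lambda>t. (f t)\<^sup>2) t = 2 * f t * deriv f t"
  by (rule DERIV_imp_deriv) (auto intro!: derivative_eq_intros has_derivative_f)

lemma smooth_f_square: "smooth_on I (\<lambda>t. (f t)\<^sup>2)"
  unfolding power2_eq_square by (rule smooth_on_mult[OF open_I smooth_f smooth_f])

lemma tangent_M_product:
  assumes v: "v \<in> tangent_space M (t, p)" and a: "smooth_on I a"
    and W: "openin (mtop F) W" "p \<in> W" and k: "k \<in> smooth_functions F W"
  shows "v (\<lambda>r. a (fst r) * k (snd r)) = deriv a t * v fst * k p + a t * v (k \<circ> snd)"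
proof -
  have q: "(t, p) \<in> points M"
    by (rule M.tangent_point[OF v])
  have "smooth_near M (t, p) (\<lambda>r. a (fst r))"
    by (rule smooth_nearI[OF smooth_time_function[OF openin_topspace a] openin_topspace q])
  moreover have "smooth_near M (t, p) (\<lambda>r. k (snd r))"
    using smooth_nearI[OF smooth_space_function[OF W(1) k] openin_Times[OF W(1)]] q W(2)
    by (simp add: points_interval_product)
  ultimately show ?thesis
    using M.tangent_mult[OF v, of "\<lambda>r. a (fst r)" "\<lambda>r. k (snd r)"] time_derivative[OF v a]
    by (simp add: o_def)
qed

context
  fixes W t p
  assumes W: "openin (mtop F) W" and p: "p \<in> W" and t: "t \<in> I"
begin

lemma point_F: "p \<in> points F"
  using openin_subset[OF W] p by blast

lemma point_M: "(t, p) \<in> I \<times> W"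
  using t p by simp

lemma lift_at:
  assumes "X \<in> vector_fields F W"
  shows "lift X (t, p) \<in> tangent_space M (t, p)" "lift X (t, p) fst = 0" "lift X (t, p) (h \<circ> snd) = X p h"
  using vector_fields_tangent[OF assms p] lift_tangent[of X] lift_fst[of X] lift_snd[of X] t by blast+

lemma T_at: "T (t, p) \<in> tangent_space M (t, p)" "T (t, p) fst = 1"
  using T_tangent[OF t point_F] T_fst[OF t point_F] .

lemma G_T_T: "G (t, p) (T (t, p)) (T (t, p)) = - 1"
  using G_tangent_T[OF T_at(1)] T_at(2) by simp

lemma G_lift_T:
  assumes "X \<in> vector_fields F W"
  shows "G (t, p) (lift X (t, p)) (T (t, p)) = 0" "G (t, p) (T (t, p)) (lift X (t, p)) = 0"
  using G_tangent_T[OF lift_at(1)[OF assms]] lift_at(2)[OF assms] M.metric_sym[OF lift_at(1)[OF assms] T_at(1)]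
  by simp_all

lemma G_lift_lift:
  assumes "X \<in> vector_fields F W" "Y \<in> vector_fields F W"
  shows "G (t, p) (lift X (t, p)) (lift Y (t, p)) = (f t)\<^sup>2 * gF p (X p) (Y p)"
  using G_tangent_lift[where X=Y, OF lift_at(1)[OF assms(1)] vector_fields_tangent[OF assms(2) p]]
  by (simp add: lift_at(3)[OF assms(1)])

end

text \<open>By nondegeneracy a vector is known from its pairings with \<open>T\<close> and with
  lifts. The test fields \<open>Z\<close> live on smaller sets \<open>V\<close>, since an arbitrary
  tangent vector of \<open>F\<close> is extended by a coordinate field of a chart, which need not
  cover \<open>W\<close>.\<close>

lemma tangent_M_eq_metricI:
  assumes v: "v \<in> tangent_space M (t, p)" and w: "w \<in> tangent_space M (t, p)"
    and T: "G (t, p) v (T (t, p)) = G (t, p) w (T (t, p))"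
    and W: "openin (mtop F) W" "p \<in> W"
    and lift: "\<And>V Z. openin (mtop F) V \<Longrightarrow> p \<in> V \<Longrightarrow> V \<subseteq> W \<Longrightarrow> Z \<in> vector_fields F V \<Longrightarrow>
      G (t, p) v (lift Z (t, p)) = G (t, p) w (lift Z (t, p))"
  shows "v = w"
proof (rule tangent_M_eqI[OF v w])
  show "v fst = w fst"
    using T by (simp add: G_tangent_T[OF v] G_tangent_T[OF w])
  have tp: "t \<in> I" "p \<in> points F"
    using M.tangent_point[OF v] by (auto simp: points_interval_product)
  obtain U \<phi> where U: "(U, \<phi>) \<in> atlas F" "p \<in> U"
    using F.chart_exists[OF tp(2)] by blast
  have V: "openin (mtop F) (W \<inter> U)" "p \<in> W \<inter> U"
    using W U F.chart_openin by auto
  note s = tangent_M_snd[OF v] tangent_M_snd[OF w]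
  have d: "(\<lambda>h. v (h \<circ> snd) - w (h \<circ> snd)) \<in> tangent_space F p"
    using F.tangent_lincomb[OF s, of 1 "-1"] by simp
  have "(\<lambda>h. v (h \<circ> snd) - w (h \<circ> snd)) = (\<lambda>h. 0)"
  proof (rule F.metric_nondegenerate[OF d])
    fix y assume y: "y \<in> tangent_space F p"
    obtain u where u: "y = chart_vector F U \<phi> u p"
      using F.tangent_chart_vectorE[OF y U] .
    have Z: "chart_vector F U \<phi> u \<in> vector_fields F (W \<inter> U)"
      by (rule vector_fields_subset[OF F.chart_vector_field[OF U(1)]]) simp
    have "(f t)\<^sup>2 * gF p (\<lambda>h. v (h \<circ> snd)) y = (f t)\<^sup>2 * gF p (\<lambda>h. w (h \<circ> snd)) y"
      using lift[OF V _ Z] G_tangent_lift[where X="chart_vector F U \<phi> u", OF v] y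
        G_tangent_lift[where X="chart_vector F U \<phi> u", OF w] by (auto simp: u)
    then show "gF p (\<lambda>h. v (h \<circ> snd) - w (h \<circ> snd)) y = 0"
      using pos_f[OF tp(1)] F.metric_diff_left[OF s y] by simp
  qed
  then show "(\<lambda>h. v (h \<circ> snd)) = (\<lambda>h. w (h \<circ> snd))"
    by (simp add: fun_eq_iff)
qed

end

section \<open>Brackets and covariant derivatives of lifted fields\<close>

locale warped_levi_civita = warped_product F gF I f + F: levi_civita F gF nabF + M: levi_civita M G nab
  for F :: "('p, 'e::euclidean_space) manifold" and gF :: "'p metric" and nabF :: "'p connection"
    and I :: "real set" and f :: "real \<Rightarrow> real" and nab :: "(real \<times> 'p) connection"
begin

definition H :: "real \<Rightarrow> real" where "H t = deriv f t / f t"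

context
  fixes W t p
  assumes W: "openin (mtop F) W" and p: "p \<in> W" and t: "t \<in> I"
begin


private lemmas W' = openin_Times[OF W]
private lemmas q = point_M[OF W p t]
private lemmas Tf = T_field[OF W']
private lemmas lf = lift_field[OF W]
private lemmas Ta = T_at[OF W p t]
private lemmas la = lift_at[OF W p t]

text \<open>Lifted fields do not depend on time. Since the bracket is already known to be a tangent
  vector, it is enough to test it on \<open>fst\<close> and on functions from \<open>F\<close>,
  where the inner derivatives are constant or independent of time and no mixed second derivative
  arises.\<close>

lemma bracket_T_lift:
  assumes X: "X \<in> vector_fields F W"
  shows "lie_bracket M T (lift X) (t, p) = (\<lambda>h. 0)"
proof (rule tangent_M_eqI)
  show b: "lie_bracket M T (lift X) (t, p) \<in> tangent_space M (t, p)"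
    by (rule vector_fields_tangent[OF M.lie_bracket_field[OF W' Tf lf[OF X]] q])
  show "(\<lambda>h. 0) \<in> tangent_space M (t, p)"
    by (rule M.tangent_zero[OF M.tangent_point[OF b]])
  have "T (t, p) (\<lambda>r. lift X r fst) = 0"
    by (rule tangent_M_const[OF Ta(1) W' q]) (use lift_at(2)[OF W _ _ X] in auto)
  moreover have "lift X (t, p) (\<lambda>r. T r fst) = 0"
    by (rule tangent_M_const[OF la(1)[OF X] W' q]) (use T_at(2)[OF W] in auto)
  ultimately show "lie_bracket M T (lift X) (t, p) fst = 0"
    by (simp add: lie_bracket_def)
  show "(\<lambda>h. lie_bracket M T (lift X) (t, p) (h \<circ> snd)) = (\<lambda>h. 0)"
  proof
    fix h
    have "T (t, p) (\<lambda>r. lift X r (h \<circ> snd)) = T (t, p) ((\<lambda>p. X p h) \<circ> snd)"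
      by (rule M.tangent_cong[OF Ta(1) W' q]) (use lift_at(3)[OF W _ _ X] in auto)
    moreover have "lift X (t, p) (\<lambda>r. T r (h \<circ> snd)) = 0"
      by (rule tangent_M_const[OF la(1)[OF X] W' q]) (auto simp: T_snd)
    ultimately show "lie_bracket M T (lift X) (t, p) (h \<circ> snd) = 0"
      by (simp add: lie_bracket_def T_snd)
  qed
qed

lemma bracket_T_T: "lie_bracket M T T (t, p) = (\<lambda>h. 0)"
  by (intro ext) (simp add: lie_bracket_def)

lemma bracket_lift_T:
  assumes X: "X \<in> vector_fields F W"
  shows "lie_bracket M (lift X) T (t, p) = (\<lambda>h. 0)"
  using bracket_T_lift[OF X] lie_bracket_skew[of M "lift X" T "(t, p)"] by (simp add: fun_eq_iff)

lemma bracket_lift_lift: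
  assumes X: "X \<in> vector_fields F W" and Y: "Y \<in> vector_fields F W"
  shows "lie_bracket M (lift X) (lift Y) (t, p) = lift (lie_bracket F X Y) (t, p)"
proof (rule tangent_M_eqI)
  note b = F.lie_bracket_field[OF W X Y]
  show "lie_bracket M (lift X) (lift Y) (t, p) \<in> tangent_space M (t, p)"
    by (rule vector_fields_tangent[OF M.lie_bracket_field[OF W' lf[OF X] lf[OF Y]] q])
  show "lift (lie_bracket F X Y) (t, p) \<in> tangent_space M (t, p)"
    by (rule la(1)[OF b])
  have z: "lift A (t, p) (\<lambda>r. lift B r fst) = 0" if A: "A \<in> vector_fields F W" and B: "B \<in> vector_fields F W" for A B
    by (rule tangent_M_const[OF la(1)[OF A] W' q]) (use lift_at(2)[OF W _ _ B] in auto)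
  show "lie_bracket M (lift X) (lift Y) (t, p) fst = lift (lie_bracket F X Y) (t, p) fst"
    by (simp add: lie_bracket_def[of M] z[OF X Y] z[OF Y X] la(2)[OF b])
  have s: "lift A (t, p) (\<lambda>r. lift B r (h \<circ> snd)) = A p (\<lambda>q. B q h)"
    if A: "A \<in> vector_fields F W" and B: "B \<in> vector_fields F W" for A B h
  proof -
    have "lift A (t, p) (\<lambda>r. lift B r (h \<circ> snd)) = lift A (t, p) ((\<lambda>q. B q h) \<circ> snd)"
      by (rule M.tangent_cong[OF la(1)[OF A] W' q]) (use lift_at(3)[OF W _ _ B] in auto)
    then show ?thesis
      by (simp add: la(3)[OF A])
  qed
  show "(\<lambda>h. lie_bracket M (lift X) (lift Y) (t, p) (h \<circ> snd)) = (\<lambda>h. lift (lie_bracket F X Y) (t, p) (h \<circ> snd))"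
    unfolding la(3)[OF b]
    by (intro ext) (simp add: lie_bracket_def smooth_near_space[OF t] s[OF X Y] s[OF Y X])
qed

text \<open>Supplies the derivative terms that vanish in the Koszul formula: pairings involving
  \<open>T\<close> are constant on \<open>T\<close> and lifts.\<close>

lemma derivative_G_const:
  assumes v: "v \<in> tangent_space M (t, p)" and X: "X \<in> vector_fields F W"
  shows "v (\<lambda>r. G r (T r) (T r)) = 0" "v (\<lambda>r. G r (T r) (lift X r)) = 0" "v (\<lambda>r. G r (lift X r) (T r)) = 0"
proof -
  show "v (\<lambda>r. G r (T r) (T r)) = 0"
    by (rule tangent_M_const[OF v W' q]) (use G_T_T[OF W] in auto)
  show "v (\<lambda>r. G r (T r) (lift X r)) = 0"
    by (rule tangent_M_const[OF v W' q]) (use G_lift_T[OF W _ _ X] in auto)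
  show "v (\<lambda>r. G r (lift X r) (T r)) = 0"
    by (rule tangent_M_const[OF v W' q]) (use G_lift_T[OF W _ _ X] in auto)
qed

lemma derivative_G_lift:
  assumes v: "v \<in> tangent_space M (t, p)" and X: "X \<in> vector_fields F W" and Y: "Y \<in> vector_fields F W"
  shows "v (\<lambda>r. G r (lift X r) (lift Y r)) =
    2 * f t * deriv f t * v fst * gF p (X p) (Y p) + (f t)\<^sup>2 * v ((\<lambda>p. gF p (X p) (Y p)) \<circ> snd)"
proof -
  have "v (\<lambda>r. G r (lift X r) (lift Y r)) = v (\<lambda>r. (f (fst r))\<^sup>2 * gF (snd r) (X (snd r)) (Y (snd r)))"
    by (rule M.tangent_cong[OF v W' q]) (use G_lift_lift[OF W _ _ X Y] in auto)
  also have "\<dots> = deriv (\<lambda>t. (f t)\<^sup>2) t * v fst * gF p (X p) (Y p) + (f t)\<^sup>2 * v ((\<lambda>p. gF p (X p) (Y p)) \<circ> snd)"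
    by (rule tangent_M_product[OF v smooth_f_square W p F.metric_smooth[OF W X Y]])
  finally show ?thesis
    by (simp add: deriv_f_square[OF t])
qed

end

context
  fixes W t p
  assumes W: "openin (mtop F) W" and p: "p \<in> W" and t: "t \<in> I"
begin

private lemmas oW = openin_Times[OF W]
private lemmas qW = point_M[OF W p t]
private lemmas TW = T_field[OF oW]
private lemmas lW = lift_field[OF W]
private lemmas T_p = T_at[OF W p t]
private lemmas l_p = lift_at[OF W p t]

lemma G_scale_left:
  assumes "v \<in> tangent_space M (t, p)" "w \<in> tangent_space M (t, p)"
  shows "G (t, p) (\<lambda>h. a * v h) w = a * G (t, p) v w"
  by (rule M.metric_scale_left[OF assms])

lemma nab_T_T: "nab T T (t, p) = (\<lambda>h. 0)"
proof (rule tangent_M_eq_metricI[OF _ _ _ W p])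
  show n: "nab T T (t, p) \<in> tangent_space M (t, p)"
    by (rule vector_fields_tangent[OF M.nab_field[OF oW TW TW] qW])
  show "(\<lambda>h. 0) \<in> tangent_space M (t, p)"
    by (rule M.tangent_zero[OF M.tangent_point[OF n]])
  show "G (t, p) (nab T T (t, p)) (T (t, p)) = G (t, p) (\<lambda>h. 0) (T (t, p))"
    using M.koszul[OF oW TW TW TW qW] bracket_T_T[OF W p t] M.metric_zero_left[OF T_p(1)]
      derivative_G_const(1)[OF W p t T_p(1) F.vector_fields_zero[OF W]] by simp
  fix V Z assume V: "openin (mtop F) V" "p \<in> V" "V \<subseteq> W" and Z: "Z \<in> vector_fields F V"
  note c = derivative_G_const[OF V(1,2) t _ Z]
  note lZ = lift_at(1)[OF V(1,2) t Z]
  show "G (t, p) (nab T T (t, p)) (lift Z (t, p)) = G (t, p) (\<lambda>h. 0) (lift Z (t, p))"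
    using M.koszul[OF openin_Times[OF V(1)] T_field[OF openin_Times[OF V(1)]] T_field[OF openin_Times[OF V(1)]]
        lift_field[OF V(1) Z] point_M[OF V(1,2) t]]
    by (simp add: c(2)[OF T_p(1)] c(1)[OF lZ] bracket_T_T[OF W p t] bracket_T_lift[OF V(1,2) t Z]
        M.metric_zero_left[OF T_p(1)] M.metric_zero_left[OF lZ])
qed

text \<open>In the Koszul formula tested against a lift only the time derivative of
  \<open>f^2\<close> survives; dividing by the factor \<open>f^2\<close> of the metric leaves
  \<open>H\<close>.\<close>

lemma nab_T_lift:
  assumes X: "X \<in> vector_fields F W"
  shows "nab T (lift X) (t, p) = (\<lambda>h. H t * lift X (t, p) h)"
proof (rule tangent_M_eq_metricI[OF _ _ _ W p])
  show n: "nab T (lift X) (t, p) \<in> tangent_space M (t, p)"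
    by (rule vector_fields_tangent[OF M.nab_field[OF oW TW lW[OF X]] qW])
  show "(\<lambda>h. H t * lift X (t, p) h) \<in> tangent_space M (t, p)"
    by (rule M.tangent_scale[OF l_p(1)[OF X]])
  note c = derivative_G_const[OF W p t _ X]
  show "G (t, p) (nab T (lift X) (t, p)) (T (t, p)) = G (t, p) (\<lambda>h. H t * lift X (t, p) h) (T (t, p))"
    using M.koszul[OF oW TW lW[OF X] TW qW]
    by (simp add: c(3)[OF T_p(1)] c(1)[OF l_p(1)[OF X]] c(2)[OF T_p(1)] bracket_T_T[OF W p t] bracket_T_lift[OF W p t X]
        bracket_lift_T[OF W p t X] M.metric_zero_left[OF T_p(1)] M.metric_zero_left[OF l_p(1)[OF X]]
        G_scale_left[OF l_p(1)[OF X] T_p(1)] G_lift_T[OF W p t X])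
  fix V Z assume V: "openin (mtop F) V" "p \<in> V" "V \<subseteq> W" and Z: "Z \<in> vector_fields F V"
  note XV = vector_fields_subset[OF X V(3)]
  note V' = openin_Times[OF V(1)]
  note lX = lift_at(1)[OF V(1,2) t XV] and lZ = lift_at(1)[OF V(1,2) t Z]
  note cX = derivative_G_const[OF V(1,2) t _ XV] and cZ = derivative_G_const[OF V(1,2) t _ Z]
  have "2 * G (t, p) (nab T (lift X) (t, p)) (lift Z (t, p)) = 2 * f t * deriv f t * gF p (X p) (Z p)"
    using M.koszul[OF V' T_field[OF V'] lift_field[OF V(1) XV] lift_field[OF V(1) Z] point_M[OF V(1,2) t]]
    by (simp add: derivative_G_lift[OF V(1,2) t T_p(1) XV Z] cZ(2)[OF lX] cX(2)[OF lZ] T_p(2) T_snd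
        bracket_T_lift[OF V(1,2) t Z] bracket_T_lift[OF V(1,2) t XV] bracket_lift_lift[OF V(1,2) t XV Z]
        G_lift_T[OF V(1,2) t F.lie_bracket_field[OF V(1) XV Z]] M.metric_zero_left[OF lX] M.metric_zero_left[OF lZ])
  then show "G (t, p) (nab T (lift X) (t, p)) (lift Z (t, p)) = G (t, p) (\<lambda>h. H t * lift X (t, p) h) (lift Z (t, p))"
    using pos_f[OF t]
    by (simp only: G_scale_left[OF l_p(1)[OF X] lZ] G_lift_lift[OF V(1,2) t XV Z])
       (simp add: H_def power2_eq_square)
qed

lemma nab_lift_T:
  assumes X: "X \<in> vector_fields F W"
  shows "nab (lift X) T (t, p) = (\<lambda>h. H t * lift X (t, p) h)"
  using M.torsion_free[OF oW TW lW[OF X] qW] bracket_T_lift[OF W p t X] nab_T_lift[OF X]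
  by (simp add: fun_eq_iff)

text \<open>
  The factor \<open>1\<close> makes the right-hand side an instance of \<open>metric_lincomb_left\<close>, here and below.
\<close>

lemma nab_lift_lift:
  assumes X: "X \<in> vector_fields F W" and Y: "Y \<in> vector_fields F W"
  shows "nab (lift X) (lift Y) (t, p) =
    (\<lambda>h. 1 * lift (nabF X Y) (t, p) h + (f t * deriv f t * gF p (X p) (Y p)) * T (t, p) h)"
proof (rule tangent_M_eq_metricI[OF _ _ _ W p])
  note nF = F.nab_field[OF W X Y]
  let ?w = "\<lambda>h. 1 * lift (nabF X Y) (t, p) h + (f t * deriv f t * gF p (X p) (Y p)) * T (t, p) h"
  show n: "nab (lift X) (lift Y) (t, p) \<in> tangent_space M (t, p)"
    by (rule vector_fields_tangent[OF M.nab_field[OF oW lW[OF X] lW[OF Y]] qW])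
  show "?w \<in> tangent_space M (t, p)"
    by (rule M.tangent_lincomb[OF l_p(1)[OF nF] T_p(1)])
  note cX = derivative_G_const[OF W p t _ X] and cY = derivative_G_const[OF W p t _ Y]
  \<comment> \<open>The Koszul formula subtracts the derivative along \<open>T\<close>, and
    \<open>T\<close> has square -1; the two signs combine to the positive coefficient of
    \<open>T\<close> in the claim.\<close>
  have "2 * G (t, p) (nab (lift X) (lift Y) (t, p)) (T (t, p)) = - (2 * f t * deriv f t * gF p (X p) (Y p))"
    using M.koszul[OF oW lW[OF X] lW[OF Y] TW qW]
    by (simp add: cY(3)[OF l_p(1)[OF X]] cX(3)[OF l_p(1)[OF Y]] derivative_G_lift[OF W p t T_p(1) X Y] T_p(2) T_snd
        bracket_lift_lift[OF W p t X Y] G_lift_T[OF W p t F.lie_bracket_field[OF W X Y]]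
        bracket_lift_T[OF W p t X] bracket_lift_T[OF W p t Y]
        M.metric_zero_left[OF l_p(1)[OF X]] M.metric_zero_left[OF l_p(1)[OF Y]])
  then show "G (t, p) (nab (lift X) (lift Y) (t, p)) (T (t, p)) = G (t, p) ?w (T (t, p))"
    by (simp only: M.metric_lincomb_left[OF l_p(1)[OF nF] T_p(1) T_p(1)] G_lift_T[OF W p t nF] G_T_T[OF W p t])
  fix V Z assume V: "openin (mtop F) V" "p \<in> V" "V \<subseteq> W" and Z: "Z \<in> vector_fields F V"
  note XV = vector_fields_subset[OF X V(3)] and YV = vector_fields_subset[OF Y V(3)]
  note V' = openin_Times[OF V(1)]
  note lX = lift_at[OF V(1,2) t XV] and lY = lift_at[OF V(1,2) t YV] and lZ = lift_at[OF V(1,2) t Z]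
  note D = derivative_G_lift[OF V(1,2) t]
  note B = bracket_lift_lift[OF V(1,2) t]
  note GL = G_lift_lift[OF V(1,2) t]
  note bF = F.lie_bracket_field[OF V(1)]
  \<comment> \<open>Lifts annihilate functions of time, so against a lift the formula is
    \<open>f^2\<close> times the Koszul formula of \<open>F\<close>.\<close>
  have "2 * G (t, p) (nab (lift X) (lift Y) (t, p)) (lift Z (t, p)) = (f t)\<^sup>2 * (2 * gF p (nabF X Y p) (Z p))"
    unfolding M.koszul[OF V' lift_field[OF V(1) XV] lift_field[OF V(1) YV] lift_field[OF V(1) Z] point_M[OF V(1,2) t]]
      F.koszul[OF V(1) XV YV Z V(2)]
      D[OF lX(1) YV Z] D[OF lY(1) XV Z] D[OF lZ(1) XV YV] lX(2,3) lY(2,3) lZ(2,3)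
      B[OF XV YV] B[OF XV Z] B[OF YV Z] GL[OF bF[OF XV YV] Z] GL[OF bF[OF XV Z] YV] GL[OF bF[OF YV Z] XV]
    by (simp add: algebra_simps)
  moreover have "G (t, p) ?w (lift Z (t, p)) = (f t)\<^sup>2 * gF p (nabF X Y p) (Z p)"
    by (simp only: M.metric_lincomb_left[OF l_p(1)[OF nF] T_p(1) lZ(1)] G_lift_T(2)[OF V(1,2) t Z]
        GL[OF vector_fields_subset[OF nF V(3)] Z])
  ultimately show "G (t, p) (nab (lift X) (lift Y) (t, p)) (lift Z (t, p)) = G (t, p) ?w (lift Z (t, p))"
    by simp
qed

end

end


section \<open>Scalar curvature of the quarter-symmetric connection\<close>

lemma sum_Basis_real_prod:
  fixes h :: "real \<times> 'e::euclidean_space \<Rightarrow> real"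
  shows "(\<Sum>i\<in>Basis. h i) = h (1, 0) + (\<Sum>b\<in>Basis. h (0, b))"
proof -
  have B: "Basis = insert (1, 0) ((\<lambda>b::'e. (0::real, b)) ` Basis)"
    by (auto simp: Basis_prod_def)
  have "inj_on (\<lambda>b::'e. (0::real, b)) Basis"
    by (auto simp: inj_on_def)
  then have "(\<Sum>i\<in>(\<lambda>b. (0, b)) ` Basis. h i) = (\<Sum>b\<in>Basis. h (0, b))"
    by (simp add: sum.reindex)
  moreover have "(\<Sum>i\<in>Basis. h i) = h (1, 0) + (\<Sum>i\<in>(\<lambda>b. (0, b)) ` Basis. h i)"
    unfolding B by (rule sum.insert) auto
  ultimately show ?thesis
    by simp
qed

lemma Basis_real_prod_cases:
  assumes "i \<in> (Basis :: (real \<times> 'e::euclidean_space) set)"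
  obtains "i = (1, 0)" | b where "b \<in> Basis" "i = (0, b)"
  using assms by (auto simp: Basis_prod_def)

section \<open>The quarter-symmetric connection on lifted fields\<close>

locale warped_quarter_symmetric = warped_levi_civita F gF nabF I f nab
  for F :: "('p, 'e::euclidean_space) manifold" and gF :: "'p metric" and nabF :: "'p connection"
    and I :: "real set" and f :: "real \<Rightarrow> real" and nab :: "(real \<times> 'p) connection" +
  fixes l1 l2 :: real
begin

abbreviation nb where "nb \<equiv> quarter_symmetric_connection G nab T l1 l2"

lemma nb_eq: "nb X Y = nab X Y +\<^sub>v (\<lambda>p. l1 * G p (Y p) (T p)) *\<^sub>v X -\<^sub>v (\<lambda>p. l2 * G p (X p) (Y p)) *\<^sub>v T"
  by (simp add: quarter_symmetric_connection_def)

lemma nb_apply: "nb X Y q h = nab X Y q h + l1 * G q (Y q) (T q) * X q h - l2 * G q (X q) (Y q) * T q h"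
  by (simp add: nb_eq vf_add_def vf_diff_def vf_scale_def)

text \<open>The two added terms are linear over the smooth functions in both arguments, so the
  Leibniz rule of \<open>nab\<close> is untouched.\<close>

lemma affine_nb: "affine_connection M nb"
  unfolding affine_connection_def
proof (intro allI impI ballI conjI)
  fix N X Y X' Y' q
  assume N: "openin (mtop M) N" and X: "X \<in> vector_fields M N" and Y: "Y \<in> vector_fields M N"
    and eq: "\<forall>q\<in>N. X' q = X q \<and> Y' q = Y q" and q: "q \<in> N"
  have "nab X' Y' q = nab X Y q"
    by (rule M.nab_cong[OF N X Y q]) (use eq in auto)
  then show "nb X' Y' q = nb X Y q"
    using eq q by (intro ext) (simp add: nb_apply)
next
  fix N X Y assume N: "openin (mtop M) N" and X: "X \<in> vector_fields M N" and Y: "Y \<in> vector_fields M N"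
  show "nb X Y \<in> vector_fields M N"
    unfolding nb_eq
    by (intro M.vector_fields_diff M.vector_fields_add M.vector_fields_scale M.nab_field M.smooth_functions_mult
        M.smooth_functions_const M.metric_smooth N X Y T_field)
next
  fix N X Y Z q
  assume N: "openin (mtop M) N" and X: "X \<in> vector_fields M N" and Y: "Y \<in> vector_fields M N"
    and Z: "Z \<in> vector_fields M N" and q: "q \<in> N"
  note t = vector_fields_tangent[OF X q] vector_fields_tangent[OF Y q] vector_fields_tangent[OF Z q]
    vector_fields_tangent[OF T_field[OF N] q]
  show "nb (X +\<^sub>v Z) Y q = (nb X Y +\<^sub>v nb Z Y) q"
    using M.nab_add_left[OF N X Y Z q]
    by (simp add: vf_add_def nb_apply M.metric_add_left[OF t(1,3,2)] fun_eq_iff algebra_simps)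
  show "nb X (Y +\<^sub>v Z) q = (nb X Y +\<^sub>v nb X Z) q"
    using M.nab_add_right[OF N X Y Z q]
    by (simp add: vf_add_def nb_apply M.metric_add_left[OF t(2,3,4)] M.metric_add_right[OF t(2,3,1)]
        fun_eq_iff algebra_simps)
next
  fix N X Y k q
  assume N: "openin (mtop M) N" and X: "X \<in> vector_fields M N" and Y: "Y \<in> vector_fields M N"
    and k: "k \<in> smooth_functions M N" and q: "q \<in> N"
  note t = vector_fields_tangent[OF X q] vector_fields_tangent[OF Y q]
    vector_fields_tangent[OF T_field[OF N] q]
  show "nb (k *\<^sub>v X) Y q = (k *\<^sub>v nb X Y) q"
    using M.nab_scale_left[OF N X Y k q]
    by (simp add: vf_scale_def nb_apply M.metric_scale_left[OF t(1,2)] fun_eq_iff algebra_simps)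
  show "nb X (k *\<^sub>v Y) q = ((\<lambda>q. X q k) *\<^sub>v Y +\<^sub>v k *\<^sub>v nb X Y) q"
    using M.nab_scale_right[OF N X Y k q]
    by (simp add: vf_scale_def vf_add_def nb_apply M.metric_scale_left[OF t(2,3)] M.metric_scale_right[OF t(2,1)]
        fun_eq_iff algebra_simps)
qed

text \<open>In general \<open>nb\<close> has torsion, so closure of the fields under brackets is
  inherited from the Levi-Civita connection.\<close>

sublocale B: metric_affine M G nb
  by unfold_locales (rule affine_nb, rule M.lie_bracket_field)

lemma smooth_deriv_f: "smooth_on I (deriv f)"
proof -
  have "deriv f t = frechet_derivative f (at t) 1" if "t \<in> I" for t
    using frechet_derivative_at[OF has_derivative_f[OF that, unfolded has_field_derivative_def]]
    by (metis mult.right_neutral)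
  from iffD2[OF smooth_on_cong[OF open_I this] smooth_on_frechet_derivative[OF smooth_f]] show ?thesis .
qed

lemma smooth_inverse_f: "smooth_on I (\<lambda>t. inverse (f t))"
proof -
  have "smooth_on I ((\<lambda>x. x powr - 1) \<circ> f)"
    by (rule smooth_on_compose[OF open_I open_greaterThan _ smooth_f smooth_on_powr]) (use pos_f in auto)
  moreover have "inverse (f t) = ((\<lambda>x. x powr - 1) \<circ> f) t" if "t \<in> I" for t
    using pos_f[OF that] by (simp add: powr_minus)
  ultimately show ?thesis
    using smooth_on_cong[OF open_I, of "\<lambda>t. inverse (f t)" "(\<lambda>x. x powr - 1) \<circ> f"] by blast
qed

lemma smooth_H: "smooth_on I H"
proof -
  have "smooth_on I (\<lambda>t. deriv f t * inverse (f t))"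
    by (rule smooth_on_mult[OF open_I smooth_deriv_f smooth_inverse_f])
  then show ?thesis
    by (simp add: H_def[abs_def] divide_inverse)
qed

lemma smooth_H_diff: "smooth_on I (\<lambda>t. H t - c)"
  using smooth_on_add[OF open_I smooth_H smooth_on_const[OF open_I, of "- c"]] by simp

lemma has_derivative_H: "t \<in> I \<Longrightarrow> (H has_real_derivative deriv H t) (at t)"
  using smooth_on_differentiable[OF smooth_H] by (simp add: DERIV_deriv_iff_real_differentiable)

lemma deriv_H_diff: "t \<in> I \<Longrightarrow> deriv (\<lambda>t. H t - c) t = deriv H t"
  by (rule DERIV_imp_deriv) (auto intro!: derivative_eq_intros has_derivative_H)

text \<open>Coefficient of \<open>gF p (X p) (Y p)\<close> in the \<open>T\<close> component of
  \<open>nb (lift X) (lift Y)\<close>: the Levi-Civita part gives \<open>f * f' = H * f^2\<close>,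
  the quarter-symmetric part \<open>- l2 * f^2\<close>.\<close>

definition A :: "real \<Rightarrow> real" where "A t = (H t - l2) * (f t)\<^sup>2"

lemma smooth_A: "smooth_on I A"
  unfolding A_def[abs_def] by (rule smooth_on_mult[OF open_I smooth_H_diff smooth_f_square])

lemma deriv_A:
  assumes "t \<in> I"
  shows "deriv A t = (f t)\<^sup>2 * (deriv H t + 2 * H t * (H t - l2))"
proof (rule DERIV_imp_deriv)
  have "deriv f t = H t * f t"
    using pos_f[OF assms] by (simp add: H_def)
  then show "(A has_real_derivative (f t)\<^sup>2 * (deriv H t + 2 * H t * (H t - l2))) (at t)"
    unfolding A_def[abs_def]
    by (auto intro!: derivative_eq_intros has_derivative_H[OF assms] has_derivative_f[OF assms]
        simp: power2_eq_square algebra_simps)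
qed

context
  fixes W t p
  assumes W: "openin (mtop F) W" and p: "p \<in> W" and t: "t \<in> I"
begin

private lemmas tT = T_at[OF W p t]
private lemmas tl = lift_at[OF W p t]

text \<open>\<open>T\<close> has square -1, so the added terms contribute \<open>- l1\<close> and
  \<open>+ l2\<close> times \<open>T\<close>.\<close>

lemma nb_T_T: "nb T T (t, p) = (\<lambda>h. (l2 - l1) * T (t, p) h)"
  by (simp add: nb_apply fun_eq_iff nab_T_T[OF W p t] G_T_T[OF W p t] algebra_simps)

lemma nb_T_lift:
  assumes X: "X \<in> vector_fields F W"
  shows "nb T (lift X) (t, p) = (\<lambda>h. H t * lift X (t, p) h)"
  by (simp add: nb_apply fun_eq_iff nab_T_lift[OF W p t X] G_lift_T[OF W p t X])

lemma nb_lift_T: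
  assumes X: "X \<in> vector_fields F W"
  shows "nb (lift X) T (t, p) = (\<lambda>h. (H t - l1) * lift X (t, p) h)"
  by (simp add: nb_apply fun_eq_iff nab_lift_T[OF W p t X] G_lift_T[OF W p t X] G_T_T[OF W p t] algebra_simps)

lemma nb_lift_lift:
  assumes X: "X \<in> vector_fields F W" and Y: "Y \<in> vector_fields F W"
  shows "nb (lift X) (lift Y) (t, p) = (\<lambda>h. lift (nabF X Y) (t, p) h + A t * gF p (X p) (Y p) * T (t, p) h)"
proof -
  have "f t * deriv f t = H t * (f t)\<^sup>2"
    using pos_f[OF t] by (simp add: H_def power2_eq_square)
  then show ?thesis
    by (simp add: nb_apply fun_eq_iff nab_lift_lift[OF W p t X Y] G_lift_T[OF W p t Y] G_lift_lift[OF W p t X Y]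
        A_def algebra_simps)
qed

end

context
  fixes W t p
  assumes W: "openin (mtop F) W" and p: "p \<in> W" and t: "t \<in> I"
begin

private lemmas oM = openin_Times[OF W]
private lemmas qM = point_M[OF W p t]
private lemmas fT = T_field[OF oM]
private lemmas fl = lift_field[OF W]
private lemmas tT' = T_at[OF W p t]
private lemmas tl' = lift_at[OF W p t]

lemma T_time: "smooth_on I a \<Longrightarrow> T (t, p) (\<lambda>r. a (fst r)) = deriv a t"
  using time_derivative[OF tT'(1)] tT'(2) by simp

lemma lift_time: "smooth_on I a \<Longrightarrow> X \<in> vector_fields F W \<Longrightarrow> lift X (t, p) (\<lambda>r. a (fst r)) = 0"
  using time_derivative[OF tl'(1)] tl'(2) by simp

lemma smooth_A_metric:
  assumes "X \<in> vector_fields F W" "Y \<in> vector_fields F W"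
  shows "(\<lambda>r. A (fst r) * gF (snd r) (X (snd r)) (Y (snd r))) \<in> smooth_functions M (I \<times> W)"
  by (intro M.smooth_functions_mult oM smooth_time_function[OF oM smooth_A]
      smooth_space_function[OF W F.metric_smooth[OF W assms]])

lemma T_A_metric:
  assumes "X \<in> vector_fields F W" "Y \<in> vector_fields F W"
  shows "T (t, p) (\<lambda>r. A (fst r) * gF (snd r) (X (snd r)) (Y (snd r))) = deriv A t * gF p (X p) (Y p)"
  using tangent_M_product[OF tT'(1) smooth_A W p F.metric_smooth[OF W assms]] tT'(2) by (simp add: T_snd)

text \<open>The formula for the inner derivative holds on all of \<open>I \<times> W\<close>, so it
  may be differentiated once more. The direction \<open>Z\<close> stays general because both
  \<open>T\<close> and lifts occur.\<close>

lemma nb_right_T: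
  assumes X: "X \<in> vector_fields F W" and Y: "Y \<in> vector_fields F W" and Z: "Z \<in> vector_fields M (I \<times> W)"
  shows "nb Z (nb (lift X) (lift Y)) (t, p) = (\<lambda>h. nb Z (lift (nabF X Y)) (t, p) h
      + Z (t, p) (\<lambda>r. A (fst r) * gF (snd r) (X (snd r)) (Y (snd r))) * T (t, p) h
      + A t * gF p (X p) (Y p) * nb Z T (t, p) h)"
proof -
  let ?k = "\<lambda>r. A (fst r) * gF (snd r) (X (snd r)) (Y (snd r))"
  note lXY = fl[OF F.nab_field[OF W X Y]]
  note k = smooth_A_metric[OF X Y]
  have "nb Z (nb (lift X) (lift Y)) (t, p) = nb Z (lift (nabF X Y) +\<^sub>v ?k *\<^sub>v T) (t, p)"
  proof (rule B.nab_cong[OF oM Z M.vector_fields_add[OF lXY M.vector_fields_scale[OF fT k]] qM refl])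
    fix r assume "r \<in> I \<times> W"
    then show "nb (lift X) (lift Y) r = (lift (nabF X Y) +\<^sub>v ?k *\<^sub>v T) r"
      by (cases r) (simp add: nb_lift_lift[OF W _ _ X Y] vf_add_def vf_scale_def)
  qed
  also have "\<dots> = (nb Z (lift (nabF X Y)) +\<^sub>v nb Z (?k *\<^sub>v T)) (t, p)"
    by (rule B.nab_add_right[OF oM Z lXY M.vector_fields_scale[OF fT k] qM])
  finally show ?thesis
    using B.nab_scale_right[OF oM Z fT k qM] by (simp add: vf_add_def vf_scale_def add.assoc)
qed

lemma nb_scale_time:
  assumes Z: "Z \<in> vector_fields M (I \<times> W)" and Y: "Y \<in> vector_fields M (I \<times> W)" and a: "smooth_on I a"
    and V: "\<And>t p. t \<in> I \<Longrightarrow> p \<in> W \<Longrightarrow> V (t, p) = (\<lambda>h. a t * Y (t, p) h)"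
  shows "nb Z V (t, p) = (\<lambda>h. Z (t, p) (\<lambda>r. a (fst r)) * Y (t, p) h + a t * nb Z Y (t, p) h)"
proof -
  note s = smooth_time_function[OF oM a]
  have "nb Z V (t, p) = nb Z ((\<lambda>r. a (fst r)) *\<^sub>v Y) (t, p)"
  proof (rule B.nab_cong[OF oM Z M.vector_fields_scale[OF Y s] qM refl])
    fix r assume "r \<in> I \<times> W"
    then show "V r = ((\<lambda>r. a (fst r)) *\<^sub>v Y) r"
      by (cases r) (simp add: V vf_scale_def)
  qed
  then show ?thesis
    using B.nab_scale_right[OF oM Z Y s qM] by (simp add: vf_add_def vf_scale_def)
qed

lemma nb_zero_bracket:
  assumes "\<And>t p. t \<in> I \<Longrightarrow> p \<in> W \<Longrightarrow> lie_bracket M X Y (t, p) = (\<lambda>h. 0)" and Z: "Z \<in> vector_fields M (I \<times> W)"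
  shows "nb (lie_bracket M X Y) Z (t, p) h = 0"
proof -
  have "nb (lie_bracket M X Y) Z (t, p) = nb (\<lambda>r h. 0) Z (t, p)"
    by (rule B.nab_cong[OF oM M.vector_fields_zero[OF oM] Z qM]) (use assms(1) in auto)
  then show ?thesis
    using B.nab_zero_left[OF oM Z qM] by simp
qed

section \<open>Curvature components in the directions of time and space\<close>

lemma curvature_T_lift_T:
  assumes X: "X \<in> vector_fields F W"
  shows "curvature M nb T (lift X) T (t, p) =
    (\<lambda>h. (deriv H t + (H t - l1) * (H t - l2 + l1)) * lift X (t, p) h)"
proof -
  have 1: "nb T (nb (lift X) T) (t, p) = (\<lambda>h. deriv H t * lift X (t, p) h + (H t - l1) * (H t * lift X (t, p) h))"
    using nb_scale_time[OF fT fl[OF X] smooth_H_diff nb_lift_T[OF W _ _ X]]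
    by (simp add: T_time[OF smooth_H_diff] deriv_H_diff[OF t] nb_T_lift[OF W p t X])
  have 2: "nb (lift X) (nb T T) (t, p) = (\<lambda>h. (l2 - l1) * ((H t - l1) * lift X (t, p) h))"
    using nb_scale_time[OF fl[OF X] fT smooth_on_const[OF open_I] nb_T_T[OF W]]
    by (simp add: lift_time[OF smooth_on_const[OF open_I] X] nb_lift_T[OF W p t X])
  show ?thesis
    by (simp add: curvature_def vf_diff_def 1 2 nb_zero_bracket[OF bracket_T_lift[OF W _ _ X] fT] algebra_simps)
qed

text \<open>Only the value on \<open>fst\<close> is recorded: the curvature is going to be paired
  with \<open>T\<close>, and that pairing sees no other component.\<close>

lemma curvature_lift_T_lift:
  assumes X: "X \<in> vector_fields F W" and Y: "Y \<in> vector_fields F W"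
  shows "curvature M nb (lift X) T (lift Y) (t, p) fst =
    - ((f t)\<^sup>2 * gF p (X p) (Y p) * (deriv H t + (H t - l2) * (H t + l2 - l1)))"
proof -
  note nF = F.nab_field[OF W X Y]
  have 1: "nb (lift X) (nb T (lift Y)) (t, p) =
      (\<lambda>h. H t * (lift (nabF X Y) (t, p) h + A t * gF p (X p) (Y p) * T (t, p) h))"
    using nb_scale_time[OF fl[OF X] fl[OF Y] smooth_H nb_T_lift[OF W _ _ Y]]
    by (simp add: lift_time[OF smooth_H X] nb_lift_lift[OF W p t X Y])
  have 2: "nb T (nb (lift X) (lift Y)) (t, p) = (\<lambda>h. H t * lift (nabF X Y) (t, p) h
      + deriv A t * gF p (X p) (Y p) * T (t, p) h + A t * gF p (X p) (Y p) * ((l2 - l1) * T (t, p) h))"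
    using nb_right_T[OF X Y fT] by (simp add: T_A_metric[OF X Y] nb_T_lift[OF W p t nF] nb_T_T[OF W p t])
  show ?thesis
    by (simp add: curvature_def vf_diff_def 1 2 nb_zero_bracket[OF bracket_lift_T[OF W _ _ X] fl[OF Y]]
        tl'(2)[OF nF] tT'(2) deriv_A[OF t])
      (simp add: A_def algebra_simps)
qed

text \<open>A Gauss-type equation: the curvature of \<open>F\<close> plus a term of
  constant-curvature shape. Evaluation on \<open>h \<circ> snd\<close> drops the \<open>T\<close>
  components, which a pairing with a lift cannot see.\<close>

lemma curvature_lift_lift_lift:
  assumes X: "X \<in> vector_fields F W" and Y: "Y \<in> vector_fields F W" and Z: "Z \<in> vector_fields F W"
  shows "curvature M nb (lift X) (lift Y) (lift Z) (t, p) (h \<circ> snd) = 1 * curvature F nabF X Y Z p h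
    + 1 * (A t * (H t - l1) * gF p (Y p) (Z p) * X p h + (- (A t * (H t - l1) * gF p (X p) (Z p))) * Y p h)"
proof -
  note bF = F.lie_bracket_field[OF W X Y]
  have n: "nb (lift X) (nb (lift Y) (lift Z)) (t, p) (h \<circ> snd) =
      nabF X (nabF Y Z) p h + A t * gF p (Y p) (Z p) * ((H t - l1) * X p h)"
    if X: "X \<in> vector_fields F W" and Y: "Y \<in> vector_fields F W" for X Y
    using F.nab_field[OF W Y Z]
    by (simp add: nb_right_T[OF Y Z fl[OF X]] nb_lift_lift[OF W p t X] nb_lift_T[OF W p t X] T_snd
        tl'(3)[OF X] tl'(3)[OF F.nab_field[OF W X]])
  have "nb (lie_bracket M (lift X) (lift Y)) (lift Z) (t, p) = nb (lift (lie_bracket F X Y)) (lift Z) (t, p)"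
    by (rule B.nab_cong[OF oM fl[OF bF] fl[OF Z] qM]) (use bracket_lift_lift[OF W _ _ X Y] in auto)
  then have "nb (lie_bracket M (lift X) (lift Y)) (lift Z) (t, p) (h \<circ> snd) = nabF (lie_bracket F X Y) Z p h"
    by (simp add: nb_lift_lift[OF W p t bF Z] T_snd tl'(3)[OF F.nab_field[OF W bF Z]])
  then show ?thesis
    by (simp add: curvature_def vf_diff_def n[OF X Y] n[OF Y X] algebra_simps)
qed

lemma curvature4_T_lift:
  assumes X: "X \<in> vector_fields F W"
  shows "B.curvature4 (t, p) T (lift X) T (lift X) =
    (deriv H t + (H t - l1) * (H t - l2 + l1)) * ((f t)\<^sup>2 * gF p (X p) (X p))"
  by (simp add: B.curvature4_def curvature_T_lift_T[OF X] M.metric_scale_left[OF tl'(1)[OF X] tl'(1)[OF X]]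
      G_lift_lift[OF W p t X X])

lemma curvature4_lift_T:
  assumes X: "X \<in> vector_fields F W"
  shows "B.curvature4 (t, p) (lift X) T (lift X) T =
    (deriv H t + (H t - l2) * (H t + l2 - l1)) * ((f t)\<^sup>2 * gF p (X p) (X p))"
  by (simp add: B.curvature4_def curvature_lift_T_lift[OF X X]
      G_tangent_T[OF vector_fields_tangent[OF B.curvature_field[OF oM fl[OF X] fT fl[OF X]] qM]])

lemma curvature4_lift_lift:
  assumes X: "X \<in> vector_fields F W" and Y: "Y \<in> vector_fields F W"
  shows "B.curvature4 (t, p) (lift X) (lift Y) (lift X) (lift Y) = (f t)\<^sup>2 * F.curvature4 p X Y X Y
    + (H t - l1) * (H t - l2) * (f t)^4 * ((gF p (X p) (Y p))\<^sup>2 - gF p (X p) (X p) * gF p (Y p) (Y p))"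
proof -
  let ?a = "A t * (H t - l1) * gF p (Y p) (X p)" and ?b = "- (A t * (H t - l1) * gF p (X p) (X p))"
  note tX = vector_fields_tangent[OF X p] and tY = vector_fields_tangent[OF Y p]
  note tR = vector_fields_tangent[OF F.curvature_field[OF W X Y X] p]
  have "B.curvature4 (t, p) (lift X) (lift Y) (lift X) (lift Y) = (f t)\<^sup>2 *
      gF p (\<lambda>h. 1 * curvature F nabF X Y X p h + 1 * (?a * X p h + ?b * Y p h)) (Y p)"
    unfolding B.curvature4_def
      G_tangent_lift[where X=Y, OF vector_fields_tangent[OF B.curvature_field[OF oM fl[OF X] fl[OF Y] fl[OF X]] qM] tY]
      curvature_lift_lift_lift[OF X Y X] ..
  also have "\<dots> = (f t)\<^sup>2 * (F.curvature4 p X Y X Y + (?a * gF p (X p) (Y p) + ?b * gF p (Y p) (Y p)))"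
    unfolding F.metric_lincomb_left[OF tR F.tangent_lincomb[OF tX tY] tY] F.metric_lincomb_left[OF tX tY tY]
      F.curvature4_def by simp
  finally show ?thesis
    unfolding F.metric_sym[OF tY tX] by (simp add: A_def power2_eq_square power4_eq_xxxx algebra_simps)
qed

end

text \<open>Each of the \<open>l\<close> space directions is paired with time in both orders, which
  contributes \<open>- l * (?P + ?Q)\<close>; pairs of space directions contribute the rescaled
  scalar curvature of \<open>F\<close> and \<open>l * (1 - l) * ?L\<close>. Expanding in powers of
  \<open>H\<close> gives the formula.\<close>

lemma scalar_curvature_warped:
  assumes p: "p \<in> points F" and t: "t \<in> I"
  shows "scalar_curvature M G nb (t, p) = scalar_curvature F gF nabF p / (f t)\<^sup>2
    - real DIM('e) * (2 * deriv H t + (real DIM('e) + 1) * (H t)\<^sup>2 - real DIM('e) * (l1 + l2) * H t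
      + (real DIM('e) + 1) * l1 * l2 - l1\<^sup>2 - l2\<^sup>2)"
proof -
  obtain W E \<epsilon> where pW: "p \<in> W" and E: "orthonormal_frame F gF W E \<epsilon>"
    using F.orthonormal_frame_exists[OF p] by blast
  have W: "openin (mtop F) W" and Ef: "\<And>b. b \<in> Basis \<Longrightarrow> E b \<in> vector_fields F W"
    and sign: "\<And>b. b \<in> Basis \<Longrightarrow> \<epsilon> b = 1 \<or> \<epsilon> b = - 1"
    and on: "\<And>b c p. b \<in> Basis \<Longrightarrow> c \<in> Basis \<Longrightarrow> p \<in> W \<Longrightarrow> gF p (E b p) (E c p) = (if b = c then \<epsilon> b else 0)"
    using E by (auto simp: orthonormal_frame_def)
  note oM = openin_Times[OF W] and qM = point_M[OF W pW t]
  note fT = T_field[OF oM]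
  define c where "c = (\<lambda>r::real \<times> 'p. inverse (f (fst r)))"
  have c: "c \<in> smooth_functions M (I \<times> W)"
    unfolding c_def by (rule smooth_time_function[OF oM smooth_inverse_f])
  \<comment> \<open>A basis index is \<open>(1, 0)\<close> or \<open>(0, b)\<close> with
    \<open>b\<close> nonzero, so the test \<open>snd i = 0\<close> singles out the time
    direction.\<close>
  define K where "K = (\<lambda>i::real \<times> 'e. if snd i = 0 then T else c *\<^sub>v lift (E (snd i)))"
  define \<delta> where "\<delta> = (\<lambda>i::real \<times> 'e. if snd i = 0 then - 1 else \<epsilon> (snd i))"
  have K1: "K (1, 0) = T" "\<delta> (1, 0) = - 1"
    by (simp_all add: K_def \<delta>_def)
  have K2: "K (0, b) = c *\<^sub>v lift (E b)" "\<delta> (0, b) = \<epsilon> b" if "b \<in> Basis" for b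
    using that by (auto simp: K_def \<delta>_def)
  have lE: "lift (E b) \<in> vector_fields M (I \<times> W)" if "b \<in> Basis" for b
    by (rule lift_field[OF W Ef[OF that]])
  have cE: "c *\<^sub>v lift (E b) \<in> vector_fields M (I \<times> W)" if "b \<in> Basis" for b
    by (rule M.vector_fields_scale[OF lE[OF that] c])
  have frame: "orthonormal_frame M G (I \<times> W) K \<delta>"
    unfolding orthonormal_frame_def
  proof (intro conjI ballI)
    show "openin (mtop M) (I \<times> W)"
      by (rule oM)
    fix i :: "real \<times> 'e" assume i: "i \<in> Basis"
    show "K i \<in> vector_fields M (I \<times> W)"
      using i by (cases rule: Basis_real_prod_cases) (simp_all add: K1 K2 fT cE)
    show "\<delta> i = 1 \<or> \<delta> i = - 1"
      using i by (cases rule: Basis_real_prod_cases) (simp_all add: K1 K2 sign)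
    fix j :: "real \<times> 'e" and r assume j: "j \<in> Basis" and r: "r \<in> I \<times> W"
    obtain s x where sx: "r = (s, x)" "s \<in> I" "x \<in> W"
      using r by auto
    note tl = lift_at(1)[OF W sx(3,2) Ef] and tT = T_at(1)[OF W sx(3,2)]
    have fs: "inverse (f s) * (inverse (f s) * ((f s)\<^sup>2 * y)) = y" for y
      using pos_f[OF sx(2)] by (simp add: field_simps power2_eq_square)
    have cr: "(c *\<^sub>v lift (E b)) r = (\<lambda>h. inverse (f s) * lift (E b) (s, x) h)" for b
      by (simp add: sx c_def vf_scale_def)
    have ct: "(\<lambda>h. inverse (f s) * lift (E b) (s, x) h) \<in> tangent_space M (s, x)" if "b \<in> Basis" for b
      by (rule M.tangent_scale[OF tl[OF that]])
    have ll: "G r (K (0, a) r) (K (0, b) r) = (if a = b then \<epsilon> a else 0)" if a: "a \<in> Basis" and b: "b \<in> Basis" for a b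
      unfolding K2[OF a] K2[OF b] cr
      by (simp add: fs sx(1) M.metric_scale_left[OF tl[OF a] ct[OF b]] M.metric_scale_right[OF tl[OF b] tl[OF a]]
          G_lift_lift[OF W sx(3,2) Ef[OF a] Ef[OF b]] on[OF a b sx(3)])
    have lT: "G r (K (0, b) r) (K (1, 0) r) = 0" "G r (K (1, 0) r) (K (0, b) r) = 0" if b: "b \<in> Basis" for b
      unfolding K1 K2[OF b] cr
      by (simp_all add: sx(1) M.metric_scale_left[OF tl[OF b] tT] M.metric_scale_right[OF tl[OF b] tT]
          G_lift_T[OF W sx(3,2) Ef[OF b]])
    have TT: "G r (K (1, 0) r) (K (1, 0) r) = - 1"
      using G_T_T[OF W sx(3,2)] by (simp add: K1 sx(1))
    from i show "G r (K i r) (K j r) = (if i = j then \<delta> i else 0)"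
    proof (cases rule: Basis_real_prod_cases)
      case 1
      from j show ?thesis
        by (cases rule: Basis_real_prod_cases) (use 1 TT lT K1 in auto)
    next
      case (2 b)
      from j show ?thesis
        by (cases rule: Basis_real_prod_cases) (use 2 ll lT K2 in auto)
    qed
  qed
  let ?c4 = "B.curvature4 (t, p)" and ?i = "inverse (f t)" and ?l = "real DIM('e)"
  \<comment> \<open>\<open>?P\<close> and \<open>?Q\<close> belong to time and space in the two
    orders. They are computed separately, because \<open>nb\<close> need not preserve
    \<open>G\<close> and the lowered curvature need not be skew in its last two arguments.\<close>
  let ?P = "deriv H t + (H t - l1) * (H t - l2 + l1)" and ?Q = "deriv H t + (H t - l2) * (H t + l2 - l1)"
    and ?L = "(H t - l1) * (H t - l2)"
  have i: "?i * ?i * (f t)\<^sup>2 = 1" "?i * ?i * (?i * ?i) * (f t)^4 = 1"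
    using pos_f[OF t] by (simp_all add: field_simps power2_eq_square power4_eq_xxxx)
  have ct: "c (t, p) = ?i"
    by (simp add: c_def)
  have g: "gF p (E b p) (E b' p) = (if b = b' then \<epsilon> b else 0)" if "b \<in> Basis" "b' \<in> Basis" for b b'
    by (rule on[OF that pW])
  have e2: "\<epsilon> b * \<epsilon> b = 1" if "b \<in> Basis" for b
    using sign[OF that] by auto
  note sc = B.curvature4_scale[OF oM qM _ _ _ _ c]
  have "curvature M nb T T T (t, p) = (\<lambda>h. 0)"
  proof
    show "curvature M nb T T T (t, p) h = 0" for h
      using B.curvature_skew[OF oM qM fT fT fT, of h] by simp
  qed
  then have "?c4 T T T T = 0"
    using M.metric_zero_left[OF T_at(1)[OF W pW t]] by (simp add: B.curvature4_def)
  then have TT: "?c4 (K (1, 0)) (K (1, 0)) (K (1, 0)) (K (1, 0)) = 0"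
    by (simp add: K1)
  have Tl: "?c4 (K (1, 0)) (K (0, b)) (K (1, 0)) (K (0, b)) = ?P * \<epsilon> b" if b: "b \<in> Basis" for b
  proof -
    have "?c4 (K (1, 0)) (K (0, b)) (K (1, 0)) (K (0, b)) = ?i * (?i * ?c4 T (lift (E b)) T (lift (E b)))"
      unfolding K1 K2[OF b] using sc(2)[OF lE[OF b] fT fT cE[OF b]] sc(4)[OF lE[OF b] fT lE[OF b] fT]
      by (simp add: ct)
    also have "\<dots> = ?P * (?i * ?i * (f t)\<^sup>2) * \<epsilon> b"
      by (simp add: curvature4_T_lift[OF W pW t Ef[OF b]] g[OF b b])
    finally show ?thesis
      by (simp only: i mult_1_right)
  qed
  have lT: "?c4 (K (0, b)) (K (1, 0)) (K (0, b)) (K (1, 0)) = ?Q * \<epsilon> b" if b: "b \<in> Basis" for b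
  proof -
    have "?c4 (K (0, b)) (K (1, 0)) (K (0, b)) (K (1, 0)) = ?i * (?i * ?c4 (lift (E b)) T (lift (E b)) T)"
      unfolding K1 K2[OF b] using sc(1)[OF lE[OF b] fT cE[OF b] fT] sc(3)[OF lE[OF b] lE[OF b] fT fT]
      by (simp add: ct)
    also have "\<dots> = ?Q * (?i * ?i * (f t)\<^sup>2) * \<epsilon> b"
      by (simp add: curvature4_lift_T[OF W pW t Ef[OF b]] g[OF b b])
    finally show ?thesis
      by (simp only: i mult_1_right)
  qed
  have ll: "?c4 (K (0, a)) (K (0, b)) (K (0, a)) (K (0, b)) =
      F.curvature4 p (E a) (E b) (E a) (E b) / (f t)\<^sup>2 + ?L * ((if a = b then 1 else 0) - \<epsilon> a * \<epsilon> b)"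
    if a: "a \<in> Basis" and b: "b \<in> Basis" for a b
  proof -
    let ?A = "lift (E a)" and ?B = "lift (E b)"
    have "?c4 (K (0, a)) (K (0, b)) (K (0, a)) (K (0, b)) = ?i * (?i * (?i * (?i * ?c4 ?A ?B ?A ?B)))"
      unfolding K2[OF a] K2[OF b]
      using sc(1)[OF lE[OF a] cE[OF b] cE[OF a] cE[OF b]] sc(2)[OF lE[OF b] lE[OF a] cE[OF a] cE[OF b]]
        sc(3)[OF lE[OF a] lE[OF a] lE[OF b] cE[OF b]] sc(4)[OF lE[OF b] lE[OF a] lE[OF b] lE[OF a]]
      by (simp add: ct)
    also have "\<dots> = ?i * ?i * (?i * ?i * (f t)\<^sup>2) * F.curvature4 p (E a) (E b) (E a) (E b)
        + ?L * (?i * ?i * (?i * ?i) * (f t)^4) * ((if a = b then \<epsilon> a else 0)\<^sup>2 - \<epsilon> a * \<epsilon> b)"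
      by (simp add: curvature4_lift_lift[OF W pW t Ef[OF a] Ef[OF b]] g[OF a b] g[OF a a] g[OF b b] algebra_simps)
    also have "(if a = b then \<epsilon> a else 0)\<^sup>2 = (if a = b then 1 else 0)"
      using e2[OF a] by (auto simp: power2_eq_square)
    finally show ?thesis
      by (simp only: i mult_1_right) (simp add: power2_eq_square divide_inverse)
  qed
  have "scalar_curvature M G nb (t, p) = (\<Sum>i\<in>Basis. \<Sum>j\<in>Basis. \<delta> i * \<delta> j * ?c4 (K i) (K j) (K i) (K j))"
    by (rule B.scalar_curvature_frame[OF frame qM])
  also have "\<dots> = (\<Sum>b\<in>Basis. - 1 * \<epsilon> b * (?P * \<epsilon> b)) + (\<Sum>a\<in>Basis. \<epsilon> a * - 1 * (?Q * \<epsilon> a)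
      + (\<Sum>b\<in>Basis. \<epsilon> a * \<epsilon> b * (F.curvature4 p (E a) (E b) (E a) (E b) / (f t)\<^sup>2
        + ?L * ((if a = b then 1 else 0) - \<epsilon> a * \<epsilon> b))))"
    unfolding sum_Basis_real_prod
    by (intro arg_cong2[where f="(+)"] sum.cong refl) (simp_all only: K1(2) K2(2) TT Tl lT ll mult_zero_right add_0_left cong: sum.cong)
  also have "\<dots> = (\<Sum>a::'e\<in>Basis. - ?P) + (\<Sum>a::'e\<in>Basis. - ?Q)
      + ((\<Sum>a\<in>Basis. \<Sum>b\<in>Basis. \<epsilon> a * \<epsilon> b * F.curvature4 p (E a) (E b) (E a) (E b)) / (f t)\<^sup>2
      + (\<Sum>a::'e\<in>Basis. \<Sum>b\<in>Basis. ?L * ((if a = b then 1 else 0) - 1)))"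
  proof -
    have "- 1 * \<epsilon> b * (?P * \<epsilon> b) = - ?P" "\<epsilon> b * - 1 * (?Q * \<epsilon> b) = - ?Q" if "b \<in> Basis" for b
      using e2[OF that] by (simp_all add: mult.left_commute[of "\<epsilon> b"])
    moreover have "\<epsilon> a * \<epsilon> b * (F.curvature4 p (E a) (E b) (E a) (E b) / (f t)\<^sup>2
        + ?L * ((if a = b then 1 else 0) - \<epsilon> a * \<epsilon> b)) =
      \<epsilon> a * \<epsilon> b * F.curvature4 p (E a) (E b) (E a) (E b) / (f t)\<^sup>2 + ?L * ((if a = b then 1 else 0) - 1)"
      if "a \<in> Basis" "b \<in> Basis" for a b
      using sign[OF that(1)] sign[OF that(2)] by (auto simp: algebra_simps)
    ultimately show ?thesis
      by (simp add: sum.distrib sum_divide_distrib)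
  qed
  finally have "scalar_curvature M G nb (t, p) = \<dots>" .
  moreover have "(\<Sum>a\<in>Basis. \<Sum>b\<in>Basis. \<epsilon> a * \<epsilon> b * F.curvature4 p (E a) (E b) (E a) (E b)) = scalar_curvature F gF nabF p"
    by (rule F.scalar_curvature_frame[OF E pW, symmetric])
  \<comment> \<open>The diagonal entries vanish, and each of the \<open>?l * (?l - 1)\<close>
    ordered pairs of distinct indices contributes \<open>- ?L\<close>.\<close>
  moreover have "(\<Sum>a::'e\<in>Basis. \<Sum>b\<in>Basis. ?L * ((if a = b then 1 else 0) - 1)) = ?l * (?L * (1 - ?l))"
    by (simp add: sum_subtractf flip: sum_distrib_left)
  ultimately show ?thesis
    by (simp add: power2_eq_square algebra_simps)
qed

end


section \<open>The differential equation\<close>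

lemma zero_derivative_constant:
  fixes y :: "real \<Rightarrow> real"
  assumes "is_interval I" "\<And>t. t \<in> I \<Longrightarrow> (y has_real_derivative 0) (at t)"
  obtains c where "\<And>t. t \<in> I \<Longrightarrow> y t = c"
  using has_field_derivative_zero_constant[of I y] assms is_interval_convex has_field_derivative_at_within
  by (metis (no_types, lifting))

text \<open>This and the next two have the shape of the brackets in the theorem, for the equation
  \<open>w'' = a * w' - b * w\<close> with discriminant \<open>d\<close>, so that unfolding them at
  the end yields the stated form.\<close>

definition exp_solution :: "real \<Rightarrow> real \<Rightarrow> real \<Rightarrow> real \<Rightarrow> real \<Rightarrow> real"
  where "exp_solution a d c1 c2 t = c1 * exp (1/2 * (a + sqrt d) * t) + c2 * exp (1/2 * (a - sqrt d) * t)"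

definition lin_solution :: "real \<Rightarrow> real \<Rightarrow> real \<Rightarrow> real \<Rightarrow> real"
  where "lin_solution r c1 c2 t = c1 * exp (r * t) + c2 * t * exp (r * t)"

definition trig_solution :: "real \<Rightarrow> real \<Rightarrow> real \<Rightarrow> real \<Rightarrow> real \<Rightarrow> real"
  where "trig_solution r k c1 c2 t = c1 * exp (r * t) * cos (k * t) + c2 * exp (r * t) * sin (k * t)"

text \<open>The equation factors through its roots: \<open>w' - r2 * w\<close> grows at rate
  \<open>r1\<close> and \<open>w' - r1 * w\<close> at rate \<open>r2\<close>. Both are therefore
  explicit exponentials, and their difference is \<open>(r1 - r2) * w\<close>, with
  \<open>r1 - r2 = sqrt d\<close> nonzero.\<close>

lemma exp_solution_exists:
  assumes I: "is_interval I" and w: "\<And>t. t \<in> I \<Longrightarrow> (w has_real_derivative w' t) (at t)"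
    and w': "\<And>t. t \<in> I \<Longrightarrow> (w' has_real_derivative a * w' t - b * w t) (at t)"
    and d: "d = a\<^sup>2 - 4 * b" "d > 0"
  shows "\<exists>c1 c2. \<forall>t\<in>I. w t = exp_solution a d c1 c2 t"
proof -
  define r1 r2 where "r1 = 1/2 * (a + sqrt d)" and "r2 = 1/2 * (a - sqrt d)"
  have sum: "r1 + r2 = a" and diff: "r1 - r2 = sqrt d"
    by (simp_all add: r1_def r2_def field_simps)
  have prod: "r1 * r2 = b"
    using d by (simp add: r1_def r2_def field_simps power2_eq_square)
  have const: "\<exists>k. \<forall>t\<in>I. (w' t - s * w t) * exp (- (r * t)) = k" if rs: "r + s = a" "r * s = b" for r s
  proof -
    have "((\<lambda>t. (w' t - s * w t) * exp (- (r * t))) has_real_derivative 0) (at t)" if "t \<in> I" for t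
      by (rule derivative_eq_intros refl w[OF that] w'[OF that])+
         (simp add: rs[symmetric] algebra_simps)
    from zero_derivative_constant[OF I this] show ?thesis
      by blast
  qed
  obtain k1 where k1: "\<And>t. t \<in> I \<Longrightarrow> (w' t - r2 * w t) * exp (- (r1 * t)) = k1"
    using const[of r1 r2] sum prod by auto
  obtain k2 where k2: "\<And>t. t \<in> I \<Longrightarrow> (w' t - r1 * w t) * exp (- (r2 * t)) = k2"
    using const[of r2 r1] sum prod by (auto simp: ac_simps)
  have "w t = exp_solution a d (k1 / sqrt d) (- k2 / sqrt d) t" if "t \<in> I" for t
  proof -
    have "w' t - r2 * w t = k1 * exp (r1 * t)"
      unfolding k1[OF that, symmetric] by (simp add: mult.assoc flip: exp_add)
    moreover have "w' t - r1 * w t = k2 * exp (r2 * t)"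
      unfolding k2[OF that, symmetric] by (simp add: mult.assoc flip: exp_add)
    ultimately have "(r1 - r2) * w t = k1 * exp (r1 * t) - k2 * exp (r2 * t)"
      by (simp add: algebra_simps)
    then show ?thesis
      using d(2) unfolding diff by (simp add: exp_solution_def r1_def r2_def field_simps)
  qed
  then show ?thesis
    by blast
qed

text \<open>Multiplication by \<open>exp (- (r * t))\<close>, with \<open>r\<close> half the sum of
  the roots, removes the first-order term and leaves \<open>y'' = - m * y\<close>. The cases
  \<open>m = 0\<close> and \<open>m = k^2\<close> give the double root and the complex
  roots.\<close>

lemma shifted_derivatives:
  assumes w: "(w has_real_derivative w' t) (at t)"
    and w': "(w' has_real_derivative 2 * r * w' t - (r\<^sup>2 + m) * w t) (at t)"
  shows "((\<lambda>t. w t * exp (- (r * t))) has_real_derivative (w' t - r * w t) * exp (- (r * t))) (at t)"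
    and "((\<lambda>t. (w' t - r * w t) * exp (- (r * t))) has_real_derivative - m * (w t * exp (- (r * t)))) (at t)"
  by (rule derivative_eq_intros refl w w' | simp add: power2_eq_square algebra_simps)+

lemma lin_solution_exists:
  assumes I: "is_interval I" and w: "\<And>t. t \<in> I \<Longrightarrow> (w has_real_derivative w' t) (at t)"
    and w': "\<And>t. t \<in> I \<Longrightarrow> (w' has_real_derivative a * w' t - b * w t) (at t)"
    and d: "a\<^sup>2 - 4 * b = 0"
  shows "\<exists>c1 c2. \<forall>t\<in>I. w t = lin_solution (a / 2) c1 c2 t"
proof -
  define r where "r = a / 2"
  \<comment> \<open>The summand 0 is the \<open>m\<close> of
    \<open>shifted_derivatives\<close>.\<close>
  have ab: "a = 2 * r" "b = r\<^sup>2 + 0"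
    using d by (simp_all add: r_def power2_eq_square)
  note s = shifted_derivatives[OF w w'[unfolded ab]]
  obtain c2 where c2: "\<And>t. t \<in> I \<Longrightarrow> (w' t - r * w t) * exp (- (r * t)) = c2"
    using zero_derivative_constant[OF I, of "\<lambda>t. (w' t - r * w t) * exp (- (r * t))"] s(2) by force
  have "((\<lambda>t. w t * exp (- (r * t)) - c2 * t) has_real_derivative 0) (at t)" if "t \<in> I" for t
    by (rule derivative_eq_intros refl s(1)[OF that that])+ (simp add: c2[OF that])
  then obtain c1 where c1: "\<And>t. t \<in> I \<Longrightarrow> w t * exp (- (r * t)) - c2 * t = c1"
    using zero_derivative_constant[OF I, of "\<lambda>t. w t * exp (- (r * t)) - c2 * t"] by blast
  have "w t = lin_solution r c1 c2 t" if "t \<in> I" for t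
  proof -
    have "w t = (w t * exp (- (r * t))) * exp (r * t)"
      by (simp add: mult.assoc flip: exp_add)
    also have "w t * exp (- (r * t)) = c1 + c2 * t"
      using c1[OF that] by simp
    finally show ?thesis
      by (simp add: lin_solution_def algebra_simps)
  qed
  then show ?thesis
    unfolding r_def by blast
qed

text \<open>After the shift the point \<open>(y, z / k)\<close> rotates with angular speed
  \<open>k\<close>. Turning it back by the angle \<open>k * t\<close> gives two conserved
  quantities, which become \<open>c1\<close> and \<open>c2\<close>; turning forward again recovers
  \<open>y\<close>.\<close>

lemma trig_solution_exists:
  assumes I: "is_interval I" and w: "\<And>t. t \<in> I \<Longrightarrow> (w has_real_derivative w' t) (at t)"
    and w': "\<And>t. t \<in> I \<Longrightarrow> (w' has_real_derivative a * w' t - b * w t) (at t)"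
    and d: "d = a\<^sup>2 - 4 * b" "d < 0"
  shows "\<exists>c1 c2. \<forall>t\<in>I. w t = trig_solution (a / 2) (1/2 * sqrt (- d)) c1 c2 t"
proof -
  define r k where "r = a / 2" and "k = 1/2 * sqrt (- d)"
  have k: "k > 0" "k\<^sup>2 = - d / 4"
    using d(2) by (simp_all add: k_def power_mult_distrib power_divide)
  have ab: "a = 2 * r" "b = r\<^sup>2 + k\<^sup>2"
    using d(1) k(2) by (simp_all add: r_def power_divide)
  define y z where "y t = w t * exp (- (r * t))" and "z t = (w' t - r * w t) * exp (- (r * t))" for t
  have y: "(y has_real_derivative z t) (at t)" and z: "(z has_real_derivative - k\<^sup>2 * y t) (at t)" if "t \<in> I" for t
    using shifted_derivatives[OF w[OF that] w'[OF that, unfolded ab]] unfolding y_def[abs_def] z_def[abs_def] .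
  have "((\<lambda>t. y t * cos (k * t) - z t / k * sin (k * t)) has_real_derivative 0) (at t)" if "t \<in> I" for t
    using k(1) by (auto intro!: derivative_eq_intros y[OF that] z[OF that] simp: power2_eq_square field_simps)
  then obtain c1 where c1: "\<And>t. t \<in> I \<Longrightarrow> y t * cos (k * t) - z t / k * sin (k * t) = c1"
    using zero_derivative_constant[OF I, of "\<lambda>t. y t * cos (k * t) - z t / k * sin (k * t)"] by blast
  have "((\<lambda>t. y t * sin (k * t) + z t / k * cos (k * t)) has_real_derivative 0) (at t)" if "t \<in> I" for t
    using k(1) by (auto intro!: derivative_eq_intros y[OF that] z[OF that] simp: power2_eq_square field_simps)
  then obtain c2 where c2: "\<And>t. t \<in> I \<Longrightarrow> y t * sin (k * t) + z t / k * cos (k * t) = c2"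
    using zero_derivative_constant[OF I, of "\<lambda>t. y t * sin (k * t) + z t / k * cos (k * t)"] by blast
  have "w t = trig_solution r k c1 c2 t" if "t \<in> I" for t
  proof -
    have "c1 * cos (k * t) + c2 * sin (k * t) = y t * (cos (k * t) * cos (k * t) + sin (k * t) * sin (k * t))"
      unfolding c1[OF that, symmetric] c2[OF that, symmetric] by (simp only: algebra_simps)
    also have "\<dots> = y t"
      by (simp only: sin_cos_squared_add3 mult_1_right)
    finally have "(c1 * cos (k * t) + c2 * sin (k * t)) * exp (r * t) = y t * exp (r * t)"
      by simp
    also have "\<dots> = w t"
      by (simp add: y_def mult.assoc flip: exp_add)
    finally show ?thesis
      by (simp add: trig_solution_def algebra_simps)
  qed
  then show ?thesis
    unfolding r_def k_def by blast
qed

section \<open>The closed forms solve the equation\<close>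

lemma exp_solution_ode:
  assumes "d = a\<^sup>2 - 4 * b" "d \<ge> 0"
  shows "\<exists>B'. \<forall>t. (exp_solution a d c1 c2 has_real_derivative B' t) (at t) \<and>
    (B' has_real_derivative a * B' t - b * exp_solution a d c1 c2 t) (at t)"
proof -
  define r1 r2 where "r1 = 1/2 * (a + sqrt d)" and "r2 = 1/2 * (a - sqrt d)"
  have ab: "a = r1 + r2" "b = r1 * r2"
    using assms by (simp_all add: r1_def r2_def field_simps power2_eq_square)
  have B: "exp_solution a d c1 c2 = (\<lambda>t. c1 * exp (r1 * t) + c2 * exp (r2 * t))"
    by (simp add: exp_solution_def r1_def r2_def fun_eq_iff)
  show ?thesis
    unfolding B unfolding ab
    by (intro exI[of _ "\<lambda>t. c1 * (r1 * exp (r1 * t)) + c2 * (r2 * exp (r2 * t))"] allI conjI)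
       (auto intro!: derivative_eq_intros simp: algebra_simps)
qed

lemma lin_solution_ode:
  assumes "a\<^sup>2 - 4 * b = 0"
  shows "\<exists>B'. \<forall>t. (lin_solution (a / 2) c1 c2 has_real_derivative B' t) (at t) \<and>
    (B' has_real_derivative a * B' t - b * lin_solution (a / 2) c1 c2 t) (at t)"
proof -
  define r where "r = a / 2"
  have ab: "a = 2 * r" "b = r * r"
    using assms by (simp_all add: r_def power2_eq_square)
  have B: "lin_solution (a / 2) c1 c2 = (\<lambda>t. c1 * exp (r * t) + c2 * t * exp (r * t))"
    by (simp add: lin_solution_def r_def fun_eq_iff)
  show ?thesis
    unfolding B unfolding ab
    by (intro exI[of _ "\<lambda>t. c1 * (r * exp (r * t)) + (c2 * exp (r * t) + c2 * t * (r * exp (r * t)))"] allI conjI)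
       (auto intro!: derivative_eq_intros simp: algebra_simps)
qed

lemma trig_solution_ode:
  assumes "d = a\<^sup>2 - 4 * b" "d \<le> 0"
  shows "\<exists>B'. \<forall>t. (trig_solution (a / 2) (1/2 * sqrt (- d)) c1 c2 has_real_derivative B' t) (at t) \<and>
    (B' has_real_derivative a * B' t - b * trig_solution (a / 2) (1/2 * sqrt (- d)) c1 c2 t) (at t)"
proof -
  define r k where "r = a / 2" and "k = 1/2 * sqrt (- d)"
  have "k * k = - d / 4"
    using assms(2) by (simp add: k_def)
  then have ab: "a = 2 * r" "b = r * r + k * k"
    using assms(1) by (simp_all add: r_def power2_eq_square)
  have B: "trig_solution (a / 2) (1/2 * sqrt (- d)) c1 c2 =
      (\<lambda>t. c1 * exp (r * t) * cos (k * t) + c2 * exp (r * t) * sin (k * t))"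
    by (simp add: trig_solution_def r_def k_def fun_eq_iff)
  show ?thesis
    unfolding B unfolding ab
    by (intro exI[of _ "\<lambda>t. (c1 * r + c2 * k) * (exp (r * t) * cos (k * t)) +
          (c2 * r - c1 * k) * (exp (r * t) * sin (k * t))"] allI conjI)
       (auto intro!: derivative_eq_intros simp: algebra_simps)
qed

text \<open>Functions equal on an open set share their derivatives there, so the equation of the
  closed form \<open>B\<close>, valid on the whole line, passes to \<open>w\<close>.\<close>

lemma ode_transfer:
  assumes I: "open I" "t \<in> I" and eq: "\<And>t. t \<in> I \<Longrightarrow> w t = B t"
    and w: "\<And>t. t \<in> I \<Longrightarrow> (w has_real_derivative w' t) (at t)" "\<And>t. t \<in> I \<Longrightarrow> (w' has_real_derivative w'' t) (at t)"
    and B: "\<exists>B'. \<forall>t. (B has_real_derivative B' t) (at t) \<and> (B' has_real_derivative a * B' t - b * B t) (at t)"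
  shows "w'' t = a * w' t - b * w t"
proof -
  obtain B' where B': "\<And>t. (B has_real_derivative B' t) (at t)"
    "\<And>t. (B' has_real_derivative a * B' t - b * B t) (at t)"
    using B by blast
  have eq': "w' t = B' t" if "t \<in> I" for t
    using DERIV_unique[OF w(1)[OF that]] has_field_derivative_transform_within_open[OF B'(1) I(1) that, of w] eq
    by simp
  have "(w' has_real_derivative a * B' t - b * B t) (at t)"
    using has_field_derivative_transform_within_open[OF B'(2) I, of w'] eq' by simp
  from DERIV_unique[OF w(2)[OF I(2)] this] show ?thesis
    by (simp add: eq[OF I(2)] eq'[OF I(2)])
qed

lemma ode_solutions:
  assumes I: "open I" "is_interval I"
    and w: "\<And>t. t \<in> I \<Longrightarrow> (w has_real_derivative w' t) (at t)" "\<And>t. t \<in> I \<Longrightarrow> (w' has_real_derivative w'' t) (at t)"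
    and d: "d = a\<^sup>2 - 4 * b"
  shows "(\<forall>t\<in>I. w'' t = a * w' t - b * w t) \<longleftrightarrow>
    (\<exists>c1 c2. (d > 0 \<and> (\<forall>t\<in>I. w t = exp_solution a d c1 c2 t)) \<or>
      (d = 0 \<and> (\<forall>t\<in>I. w t = lin_solution (a / 2) c1 c2 t)) \<or>
      (d < 0 \<and> (\<forall>t\<in>I. w t = trig_solution (a / 2) (1/2 * sqrt (- d)) c1 c2 t)))"
    (is "?ode \<longleftrightarrow> (\<exists>c1 c2. ?sol c1 c2)")
proof
  assume ?ode
  then have w': "(w' has_real_derivative a * w' t - b * w t) (at t)" if "t \<in> I" for t
    using w(2)[OF that] that by simp
  consider "d > 0" | "d = 0" | "d < 0"
    by linarith
  then show "\<exists>c1 c2. ?sol c1 c2"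
  proof cases
    case 1
    then show ?thesis
      using exp_solution_exists[OF I(2) w(1) w' d] by blast
  next
    case 2
    then show ?thesis
      using lin_solution_exists[OF I(2) w(1) w'] d by auto
  next
    case 3
    then show ?thesis
      using trig_solution_exists[OF I(2) w(1) w' d] by blast
  qed
next
  assume "\<exists>c1 c2. ?sol c1 c2"
  then obtain c1 c2 where "?sol c1 c2"
    by blast
  then show ?ode
  proof (elim disjE conjE)
    assume "d > 0" "\<forall>t\<in>I. w t = exp_solution a d c1 c2 t"
    then show ?ode
      using ode_transfer[OF I(1) _ _ w exp_solution_ode[OF d]] by auto
  next
    assume "d = 0" "\<forall>t\<in>I. w t = lin_solution (a / 2) c1 c2 t"
    then show ?ode
      using ode_transfer[OF I(1) _ _ w lin_solution_ode] d by auto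
  next
    assume "d < 0" "\<forall>t\<in>I. w t = trig_solution (a / 2) (1/2 * sqrt (- d)) c1 c2 t"
    then show ?ode
      using ode_transfer[OF I(1) _ _ w trig_solution_ode[OF d]] by auto
  qed
qed

text \<open>With \<open>v = x^2\<close> the exponents \<open>4 / n\<close> and \<open>n / 2\<close>
  undo each other. On the right positivity of \<open>B\<close> is automatic, \<open>B\<close> being
  a power of \<open>x\<close>; on the left it is what allows the power to be inverted.\<close>

lemma powr_solution_iff:
  fixes x B v n :: real
  assumes "x > 0" "n > 0" "v = x\<^sup>2"
  shows "B > 0 \<and> v = B powr (4 / n) \<longleftrightarrow> x powr (n / 2) = B"
proof
  assume B: "B > 0 \<and> v = B powr (4 / n)"
  have "x powr (n / 2) = (x powr 2) powr (n / 4)"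
    by (simp add: powr_powr)
  also have "x powr 2 = B powr (4 / n)"
    using assms B by (simp add: powr_numeral)
  finally show "x powr (n / 2) = B"
    using B assms(2) by (simp add: powr_powr)
next
  assume B: "x powr (n / 2) = B"
  have "B powr (4 / n) = x powr 2"
    using assms(2) by (simp add: B[symmetric] powr_powr)
  then show "B > 0 \<and> v = B powr (4 / n)"
    using assms(1,3) by (auto simp: B[symmetric] powr_numeral)
qed

text \<open>With \<open>n = (l + 1) / 2\<close> one has \<open>w' = n * H * w\<close> and
  \<open>w'' = (n * H' + n^2 * H^2) * w\<close>, hence
  \<open>2 * H' + (l + 1) * H^2 = 4 / (l + 1) * w'' / w\<close>. Multiplying the curvature formula
  by \<open>(l + 1) / (4 * l) * w\<close> gives the stated coefficients.\<close>

lemma (in warped_quarter_symmetric) scalar_curvature_ode: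
  assumes "t \<in> I" "p \<in> points F" "scalar_curvature F gF nabF p = 0" "l = real DIM('e)"
  defines "w \<equiv> \<lambda>t. f t powr ((l + 1) / 2)"
    and "w' \<equiv> \<lambda>t. (l + 1) / 2 * H t * f t powr ((l + 1) / 2)"
    and "w'' \<equiv> \<lambda>t. ((l + 1) / 2 * deriv H t + ((l + 1) / 2 * H t)\<^sup>2) * f t powr ((l + 1) / 2)"
  shows "scalar_curvature M G nb (t, p) = S \<longleftrightarrow>
      w'' t = l / 2 * (l1 + l2) * w' t - (l + 1) / 4 * ((l + 1) * l1 * l2 - l1\<^sup>2 - l2\<^sup>2 + S / l) * w t"
    and "(w has_real_derivative w' t) (at t)" "(w' has_real_derivative w'' t) (at t)"
proof -
  have l: "l > 0"
    by (simp add: assms(4))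
  have w_pos: "w t > 0"
    using pos_f[OF assms(1)] by (simp add: w_def)
  let ?R = "scalar_curvature M G nb (t, p)"
  have R: "?R = - l * (2 * deriv H t + (l + 1) * (H t)\<^sup>2 - l * (l1 + l2) * H t + (l + 1) * l1 * l2 - l1\<^sup>2 - l2\<^sup>2)"
    using scalar_curvature_warped[OF assms(2,1)] by (simp add: assms(3,4))
  \<comment> \<open>The two sides of the equation differ by a nonzero multiple of
    \<open>S - ?R\<close>, which gives both directions at once.\<close>
  have "w'' t - (l / 2 * (l1 + l2) * w' t - (l + 1) / 4 * ((l + 1) * l1 * l2 - l1\<^sup>2 - l2\<^sup>2 + S / l) * w t) =
      (l + 1) / (4 * l) * (S - ?R) * w t"
    using l unfolding R w_def w'_def w''_def by (simp add: field_simps power2_eq_square)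
  then show "?R = S \<longleftrightarrow>
      w'' t = l / 2 * (l1 + l2) * w' t - (l + 1) / 4 * ((l + 1) * l1 * l2 - l1\<^sup>2 - l2\<^sup>2 + S / l) * w t"
    using l w_pos by (smt (verit) divide_pos_pos mult_eq_0_iff)
  show w: "(w has_real_derivative w' t) (at t)"
  proof -
    have "(w has_real_derivative (l + 1) / 2 * f t powr ((l + 1) / 2 - 1) * deriv f t) (at t)"
      unfolding w_def
      using DERIV_fun_powr[OF has_derivative_f[OF assms(1)] pos_f[OF assms(1)], of "(l + 1) / 2"] by simp
    moreover have "f t powr ((l + 1) / 2 - 1) = f t powr ((l + 1) / 2) / f t"
      by (subst powr_diff) (use pos_f[OF assms(1)] in simp)
    ultimately show ?thesis
      by (simp add: w'_def H_def ac_simps)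
  qed
  have 1: "w' = (\<lambda>t. (l + 1) / 2 * (H t * w t))"
    by (simp add: w_def w'_def mult.assoc)
  have 2: "w'' t = (l + 1) / 2 * (deriv H t * w t + w' t * H t)"
    by (simp add: w_def w'_def w''_def power2_eq_square field_simps)
  show "(w' has_real_derivative w'' t) (at t)"
    using DERIV_cmult[OF DERIV_mult[OF has_derivative_H[OF assms(1)] w], of "(l + 1) / 2"]
    by (simp only: 1[symmetric] 2[symmetric])
qed

theorem theorem3p20:
  fixes F :: "('p, 'e::euclidean_space) manifold" and g\<^sub>F :: "'p metric"
    and nab\<^sub>F :: "'p connection" and nab :: "(real \<times> 'p) connection"
    and I :: "real set" and f v :: "real \<Rightarrow> real"
    and lam\<^sub>1 lam\<^sub>2 S D S\<^sub>0 :: real and l :: nat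
  assumes "open I" "is_interval I" "I \<noteq> {}"
    and "pseudo_riemannian_manifold F g\<^sub>F" "points F \<noteq> {}"
    and "l = DIM('e)" "l \<noteq> 3"
    and "levi_civita_connection F g\<^sub>F nab\<^sub>F"
    and "\<forall>p \<in> points F. scalar_curvature F g\<^sub>F nab\<^sub>F p = 0"
    and "smooth_on I f" "\<forall>t\<in>I. f t > 0"
    and "lam\<^sub>1 \<noteq> 0" "lam\<^sub>2 \<noteq> 0"
    and "levi_civita_connection (interval_product I F) (warped_metric f g\<^sub>F) nab"
    and "\<forall>t\<in>I. v t = (f t)\<^sup>2"
    and "D = (real l)\<^sup>2 / 4 * (lam\<^sub>1 + lam\<^sub>2)\<^sup>2
             - (real l + 1) * ((real l + 1) * lam\<^sub>1 * lam\<^sub>2 - lam\<^sub>1\<^sup>2 - lam\<^sub>2\<^sup>2 + S / real l)"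
    and "S\<^sub>0 = (real l) ^ 3 / (4 * (real l + 1)) * (lam\<^sub>1 + lam\<^sub>2)\<^sup>2
              - real l * ((real l + 1) * lam\<^sub>1 * lam\<^sub>2 - lam\<^sub>1\<^sup>2 - lam\<^sub>2\<^sup>2)"
  shows "(\<forall>q \<in> points (interval_product I F).
            scalar_curvature (interval_product I F) (warped_metric f g\<^sub>F)
              (quarter_symmetric_connection (warped_metric f g\<^sub>F) nab (time_field I F) lam\<^sub>1 lam\<^sub>2) q = S)
    \<longleftrightarrow>
    (\<exists>c\<^sub>1 c\<^sub>2 :: real.
       (S < S\<^sub>0 \<and>
         (\<forall>t\<in>I. let B = c\<^sub>1 * exp (1/2 * (real l / 2 * (lam\<^sub>1 + lam\<^sub>2) + sqrt D) * t)
                        + c\<^sub>2 * exp (1/2 * (real l / 2 * (lam\<^sub>1 + lam\<^sub>2) - sqrt D) * t)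
                in B > 0 \<and> v t = B powr (4 / (real l + 1)))) \<or>
       (S = S\<^sub>0 \<and>
         (\<forall>t\<in>I. let B = c\<^sub>1 * exp (real l / 4 * (lam\<^sub>1 + lam\<^sub>2) * t)
                        + c\<^sub>2 * t * exp (real l / 4 * (lam\<^sub>1 + lam\<^sub>2) * t)
                in B > 0 \<and> v t = B powr (4 / (real l + 1)))) \<or>
       (S > S\<^sub>0 \<and>
         (\<forall>t\<in>I. let B = c\<^sub>1 * exp (real l / 4 * (lam\<^sub>1 + lam\<^sub>2) * t) * cos (1/2 * sqrt (- D) * t)
                        + c\<^sub>2 * exp (real l / 4 * (lam\<^sub>1 + lam\<^sub>2) * t) * sin (1/2 * sqrt (- D) * t)
                in B > 0 \<and> v t = B powr (4 / (real l + 1)))))"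
proof -
  have F: "smooth_atlas F" "pseudo_riemannian_metric F g\<^sub>F"
    using assms(4) smooth_atlasI by (auto simp: pseudo_riemannian_manifold_def)
  interpret pseudo_riemannian F g\<^sub>F
    using F by (simp add: pseudo_riemannian_def pseudo_riemannian_axioms_def)
  interpret warped_product F g\<^sub>F I f
    by unfold_locales (use assms in auto)
  interpret warped_quarter_symmetric F g\<^sub>F nab\<^sub>F I f nab lam\<^sub>1 lam\<^sub>2
    by unfold_locales (use assms in auto)
  let ?l = "real l"
  define w where "w = (\<lambda>t. f t powr ((?l + 1) / 2))"
  define w' where "w' = (\<lambda>t. (?l + 1) / 2 * H t * f t powr ((?l + 1) / 2))"
  define w'' where "w'' = (\<lambda>t. ((?l + 1) / 2 * deriv H t + ((?l + 1) / 2 * H t)\<^sup>2) * f t powr ((?l + 1) / 2))"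
  \<comment> \<open>\<open>a\<close> and \<open>b\<close> are the sum and the product of the
    characteristic roots of the linear equation for \<open>w\<close>, so that \<open>D\<close> is
    its discriminant.\<close>
  define a where "a = ?l / 2 * (lam\<^sub>1 + lam\<^sub>2)"
  define b where "b = (?l + 1) / 4 * ((?l + 1) * lam\<^sub>1 * lam\<^sub>2 - lam\<^sub>1\<^sup>2 - lam\<^sub>2\<^sup>2 + S / ?l)"
  have l: "?l > 0"
    using assms(6) by simp
  \<comment> \<open>The equation involves \<open>t\<close> alone; a point of \<open>F\<close> is
    needed to read it off, for each \<open>t\<close>, from the curvature at
    \<open>(t, p)\<close>.\<close>
  obtain p\<^sub>0 where p0: "p\<^sub>0 \<in> points F"
    using assms(5) by blast
  have ode: "scalar_curvature M G nb (t, p) = S \<longleftrightarrow> w'' t = a * w' t - b * w t"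
    "(w has_real_derivative w' t) (at t)" "(w' has_real_derivative w'' t) (at t)"
    if "t \<in> I" "p \<in> points F" for t p
    using scalar_curvature_ode(1)[where l="?l" and S=S, OF that] scalar_curvature_ode(2,3)[where l="?l", OF that]
      assms(6,9) that
    by (simp_all add: w_def w'_def w''_def a_def b_def)
  have D: "D = a\<^sup>2 - 4 * b"
    unfolding assms(16) a_def b_def using l by (simp add: power2_eq_square field_simps)
  \<comment> \<open>\<open>S\<^sub>0\<close> is the value of \<open>S\<close> at which
    \<open>D\<close>, an affine function of \<open>S\<close> with negative slope, vanishes.\<close>
  have "D = (?l + 1) / ?l * (S\<^sub>0 - S)"
  proof -
    have "m\<^sup>2 / 4 * x - n * (y + S / m) = n / m * (m ^ 3 / (4 * n) * x - m * y - S)"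
      if "m > 0" "n > 0" for m n x y :: real
      using that by (simp add: field_simps power2_eq_square power3_eq_cube)
    then show ?thesis
      unfolding assms(16,17) using l by simp
  qed
  moreover have "(?l + 1) / ?l > 0"
    using l by simp
  ultimately have sign: "D > 0 \<longleftrightarrow> S < S\<^sub>0" "D = 0 \<longleftrightarrow> S = S\<^sub>0" "D < 0 \<longleftrightarrow> S > S\<^sub>0"
    by (simp_all only: zero_less_mult_iff mult_less_0_iff mult_eq_0_iff) auto
  have a2: "a / 2 = ?l / 4 * (lam\<^sub>1 + lam\<^sub>2)"
    by (simp add: a_def)
  have "(\<forall>q \<in> points M. scalar_curvature M G nb q = S) \<longleftrightarrow> (\<forall>t\<in>I. w'' t = a * w' t - b * w t)"
    using ode(1) p0 by (auto simp: points_interval_product)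
  also have "\<dots> \<longleftrightarrow> (\<exists>c1 c2. (D > 0 \<and> (\<forall>t\<in>I. w t = exp_solution a D c1 c2 t)) \<or>
      (D = 0 \<and> (\<forall>t\<in>I. w t = lin_solution (a / 2) c1 c2 t)) \<or>
      (D < 0 \<and> (\<forall>t\<in>I. w t = trig_solution (a / 2) (1/2 * sqrt (- D)) c1 c2 t)))"
    by (rule ode_solutions[OF assms(1,2) ode(2)[OF _ p0] ode(3)[OF _ p0] D])
  also have "\<dots> \<longleftrightarrow> (\<exists>c1 c2.
      (S < S\<^sub>0 \<and> (\<forall>t\<in>I. exp_solution a D c1 c2 t > 0 \<and> v t = exp_solution a D c1 c2 t powr (4 / (?l + 1)))) \<or>
      (S = S\<^sub>0 \<and> (\<forall>t\<in>I. lin_solution (a / 2) c1 c2 t > 0 \<and> v t = lin_solution (a / 2) c1 c2 t powr (4 / (?l + 1)))) \<or>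
      (S > S\<^sub>0 \<and> (\<forall>t\<in>I. trig_solution (a / 2) (1/2 * sqrt (- D)) c1 c2 t > 0 \<and>
        v t = trig_solution (a / 2) (1/2 * sqrt (- D)) c1 c2 t powr (4 / (?l + 1)))))"
  proof -
    \<comment> \<open>The three cases differ only in \<open>B\<close>, so one pointwise equivalence
      between \<open>w\<close> and \<open>v\<close> serves them all.\<close>
    have "(\<forall>t\<in>I. w t = B t) \<longleftrightarrow> (\<forall>t\<in>I. B t > 0 \<and> v t = B t powr (4 / (?l + 1)))" for B
      using powr_solution_iff[of "f t" "?l + 1" "v t" "B t" for t] assms(11,15) l
      by (auto simp: w_def)
    then show ?thesis
      by (simp only: sign)
  qed
  finally show ?thesis
    unfolding exp_solution_def lin_solution_def trig_solution_def Let_def a2 unfolding a_def .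
qed

end
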